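(* Let $M$ be a closed manifold, let $f\in \operatorname{Diff}^1(M)$ and let $S\subset\Omega(f)$. Then $S$ is finite if and only if there are a neighborhood $\mathcal{U}\subset\operatorname{Diff}^1(M)$ of $f$ and a map with finite preimages $n:S\to\mathbb{N}^+$ such that $$\sup_{(h,p)\in\mathcal{U}\times S}\|Dh^{n(p)}(p)\|<\infty.$$
   Context: A closed manifold is a compact connected boundaryless manifold $M$ with $\dim(M)\ge 2$, equipped with a Riemannian metric inducing norms $\|\cdot\|$ on tangent spaces and on linear maps between them. $\operatorname{Diff}^1(M)$ is the space of $C^1$ diffeomorphisms of $M$ with the $C^1$ topology. $\mathbb{N}^+$ denotes the positive integers. A point $p\in M$ is wandering for $f$ if $U\cap\left(\bigcup_{n\in\mathbb{N}^+}f^n(U)\right)=\emptyset$ for some neighborhood $U$ of $p$; otherwise $p$ is nonwandering. $\Omega(f)$ is the set of nonwandering points. A map $n:O\to Q$ has finite preimages if $n^{-1}(k)$ is finite for every $k\in Q$. *)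

theory Defs
  imports "HOL-Analysis.Analysis"
begin

subsection \<open>Differentiability classes on open subsets of normed spaces\<close>

text \<open>\<open>Ck_on k S f\<close> is meant for open \<open>S\<close>; in finite dimension, continuity of all iterated
  directional derivatives is the usual notion of class \<open>C\<^sup>k\<close>.\<close>

primrec Ck_on ::
  "nat \<Rightarrow> 'a::real_normed_vector set \<Rightarrow> ('a \<Rightarrow> 'b::real_normed_vector) \<Rightarrow> bool" where
  "Ck_on 0 S f \<longleftrightarrow> continuous_on S f"
| "Ck_on (Suc k) S f \<longleftrightarrow>
     (\<forall>x\<in>S. f differentiable (at x)) \<and> (\<forall>v. Ck_on k S (\<lambda>x. frechet_derivative f (at x) v))"

definition smooth_on :: "'a::real_normed_vector set \<Rightarrow> ('a \<Rightarrow> 'b::real_normed_vector) \<Rightarrow> bool" where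
  "smooth_on S f \<longleftrightarrow> (\<forall>k. Ck_on k S f)"

subsection \<open>Closed manifolds\<close>

text \<open>The manifold is the whole type \<open>'a\<close>; its topology is that of the type, and its smooth
  structure is given by an atlas \<open>A\<close> (not necessarily maximal) modelled on \<open>'b\<close>.\<close>

type_synonym ('a, 'b) chart = "'a set \<times> ('a \<Rightarrow> 'b)"

definition local_rep ::
  "('a, 'b) chart \<Rightarrow> ('a \<Rightarrow> 'a) \<Rightarrow> ('a, 'b) chart \<Rightarrow> 'b \<Rightarrow> 'b" where
  "local_rep c f d = snd d \<circ> f \<circ> inv_into (fst c) (snd c)"

definition is_chart :: "('a::topological_space, 'b::euclidean_space) chart \<Rightarrow> bool" where
  "is_chart c \<longleftrightarrow> open (fst c) \<and> open (snd c ` fst c) \<and>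
     (\<exists>\<psi>. homeomorphism (fst c) (snd c ` fst c) (snd c) \<psi>)"

definition smooth_atlas :: "('a::topological_space, 'b::euclidean_space) chart set \<Rightarrow> bool" where
  "smooth_atlas A \<longleftrightarrow> (\<forall>c\<in>A. is_chart c) \<and> (\<Union>c\<in>A. fst c) = UNIV \<and>
     (\<forall>c\<in>A. \<forall>d\<in>A. smooth_on (snd c ` (fst c \<inter> fst d)) (local_rep c id d))"

definition closed_manifold :: "('a::t2_space, 'b::euclidean_space) chart set \<Rightarrow> bool" where
  "closed_manifold A \<longleftrightarrow> smooth_atlas A \<and>
     compact (UNIV :: 'a set) \<and> connected (UNIV :: 'a set) \<and> DIM('b) \<ge> 2"

subsection \<open>Tangent spaces and Riemannian metrics\<close>

text \<open>A tangent vector at \<open>p\<close> is the family of its coordinate vectors in the charts around \<open>p\<close>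
  (and 0 at all other arguments), any two of them being related by the derivative of the
  change of coordinates. The vector space operations are pointwise.\<close>

definition charts_at :: "('a, 'b) chart set \<Rightarrow> 'a \<Rightarrow> ('a, 'b) chart set" where
  "charts_at A p = {c \<in> A. p \<in> fst c}"

type_synonym ('a, 'b) tvec = "('a, 'b) chart \<Rightarrow> 'b"

definition tangent_space ::
  "('a, 'b::euclidean_space) chart set \<Rightarrow> 'a \<Rightarrow> ('a, 'b) tvec set" where
  "tangent_space A p = {\<xi>. (\<forall>c. c \<notin> charts_at A p \<longrightarrow> \<xi> c = 0) \<and>
     (\<forall>c\<in>charts_at A p. \<forall>d\<in>charts_at A p.
        \<xi> d = frechet_derivative (local_rep c id d) (at (snd c p)) (\<xi> c))}"

text \<open>The tangent vector at \<open>p\<close> whose coordinates in the chart \<open>c\<close> are \<open>u\<close>.\<close>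

definition coord_vector ::
  "('a, 'b::euclidean_space) chart set \<Rightarrow> ('a, 'b) chart \<Rightarrow> 'a \<Rightarrow> 'b \<Rightarrow> ('a, 'b) tvec" where
  "coord_vector A c p u = (\<lambda>d. if d \<in> charts_at A p
     then frechet_derivative (local_rep c id d) (at (snd c p)) u else 0)"

definition inner_product_on_tangent_space ::
  "('a, 'b::euclidean_space) chart set \<Rightarrow> 'a \<Rightarrow> (('a, 'b) tvec \<Rightarrow> ('a, 'b) tvec \<Rightarrow> real) \<Rightarrow> bool" where
  "inner_product_on_tangent_space A p G \<longleftrightarrow>
     (\<forall>\<xi>\<in>tangent_space A p. \<forall>\<eta>\<in>tangent_space A p. G \<xi> \<eta> = G \<eta> \<xi>) \<and>
     (\<forall>\<xi>\<in>tangent_space A p. \<forall>\<eta>\<in>tangent_space A p. \<forall>\<zeta>\<in>tangent_space A p.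
        G (\<lambda>c. \<xi> c + \<eta> c) \<zeta> = G \<xi> \<zeta> + G \<eta> \<zeta>) \<and>
     (\<forall>r. \<forall>\<xi>\<in>tangent_space A p. \<forall>\<eta>\<in>tangent_space A p. G (\<lambda>c. r *\<^sub>R \<xi> c) \<eta> = r * G \<xi> \<eta>) \<and>
     (\<forall>\<xi>\<in>tangent_space A p. \<xi> \<noteq> (\<lambda>c. 0) \<longrightarrow> 0 < G \<xi> \<xi>)"

definition riemannian_metric ::
  "('a, 'b::euclidean_space) chart set \<Rightarrow>
   ('a \<Rightarrow> ('a, 'b) tvec \<Rightarrow> ('a, 'b) tvec \<Rightarrow> real) \<Rightarrow> bool" where
  "riemannian_metric A g \<longleftrightarrow>
     (\<forall>p. inner_product_on_tangent_space A p (g p)) \<and>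
     (\<forall>c\<in>A. \<forall>u v. smooth_on (snd c ` fst c)
        (\<lambda>x. let p = inv_into (fst c) (snd c) x
              in g p (coord_vector A c p u) (coord_vector A c p v)))"

definition tangent_norm ::
  "('a \<Rightarrow> ('a, 'b) tvec \<Rightarrow> ('a, 'b) tvec \<Rightarrow> real) \<Rightarrow> 'a \<Rightarrow> ('a, 'b) tvec \<Rightarrow> real" where
  "tangent_norm g p \<xi> = sqrt (g p \<xi> \<xi>)"

text \<open>Operator norm of a linear map \<open>T\<close> from the tangent space at \<open>p\<close> to the one at \<open>q\<close>.\<close>

definition tangent_onorm ::
  "('a, 'b::euclidean_space) chart set \<Rightarrow>
   ('a \<Rightarrow> ('a, 'b) tvec \<Rightarrow> ('a, 'b) tvec \<Rightarrow> real) \<Rightarrow> 'a \<Rightarrow> 'a \<Rightarrow>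
   (('a, 'b) tvec \<Rightarrow> ('a, 'b) tvec) \<Rightarrow> real" where
  "tangent_onorm A g p q T =
     (SUP \<xi>\<in>{\<xi> \<in> tangent_space A p. tangent_norm g p \<xi> \<le> 1}. tangent_norm g q (T \<xi>))"

text \<open>The derivative of \<open>f\<close> at \<open>p\<close>. By the chain rule, for \<open>f\<close> differentiable at \<open>p\<close> the choice of
  the chart \<open>c\<close> is irrelevant on the tangent space at \<open>p\<close>.\<close>

definition differential ::
  "('a, 'b::euclidean_space) chart set \<Rightarrow> ('a \<Rightarrow> 'a) \<Rightarrow> 'a \<Rightarrow> ('a, 'b) tvec \<Rightarrow> ('a, 'b) tvec" where
  "differential A f p \<xi> = (\<lambda>d. if d \<in> charts_at A (f p)
     then let c = (SOME c. c \<in> charts_at A p)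
          in frechet_derivative (local_rep c f d) (at (snd c p)) (\<xi> c)
     else 0)"

subsection \<open>\<open>C\<^sup>1\<close> diffeomorphisms and the \<open>C\<^sup>1\<close> topology\<close>

definition C1_map :: "('a::topological_space, 'b::euclidean_space) chart set \<Rightarrow> ('a \<Rightarrow> 'a) \<Rightarrow> bool" where
  "C1_map A f \<longleftrightarrow> continuous_on UNIV f \<and>
     (\<forall>c\<in>A. \<forall>d\<in>A. Ck_on 1 (snd c ` (fst c \<inter> f -` fst d)) (local_rep c f d))"

definition Diff1 :: "('a::topological_space, 'b::euclidean_space) chart set \<Rightarrow> ('a \<Rightarrow> 'a) set" where
  "Diff1 A = {f. bij f \<and> C1_map A f \<and> C1_map A (inv f)}"

text \<open>The standard subbasis of the \<open>C\<^sup>1\<close> topology (as in Hirsch, Differential Topology): closeness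
  of values and first derivatives in a pair of charts, uniformly over a compact set \<open>K\<close>.\<close>

definition C1_subbasic ::
  "('a::topological_space, 'b::euclidean_space) chart set \<Rightarrow> ('a \<Rightarrow> 'a) \<Rightarrow>
   ('a, 'b) chart \<Rightarrow> ('a, 'b) chart \<Rightarrow> 'a set \<Rightarrow> real \<Rightarrow> ('a \<Rightarrow> 'a) set" where
  "C1_subbasic A f c d K e = {h \<in> Diff1 A. h ` K \<subseteq> fst d \<and>
     (\<forall>x\<in>snd c ` K.
        norm (local_rep c h d x - local_rep c f d x) < e \<and>
        onorm (\<lambda>v. frechet_derivative (local_rep c h d) (at x) v
                 - frechet_derivative (local_rep c f d) (at x) v) < e)}"

definition C1_topology ::
  "('a::topological_space, 'b::euclidean_space) chart set \<Rightarrow> ('a \<Rightarrow> 'a) topology" where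
  "C1_topology A = topology_generated_by
     {C1_subbasic A f c d K e | f c d K e.
        f \<in> Diff1 A \<and> c \<in> A \<and> d \<in> A \<and> compact K \<and> K \<subseteq> fst c \<and> f ` K \<subseteq> fst d \<and> 0 < e}"

definition neighbourhood_in :: "'a topology \<Rightarrow> 'a \<Rightarrow> 'a set \<Rightarrow> bool" where
  "neighbourhood_in X x U \<longleftrightarrow> U \<subseteq> topspace X \<and> (\<exists>W. openin X W \<and> x \<in> W \<and> W \<subseteq> U)"

subsection \<open>Nonwandering points and maps with finite preimages\<close>

definition wandering :: "('a::topological_space \<Rightarrow> 'a) \<Rightarrow> 'a \<Rightarrow> bool" where
  "wandering f p \<longleftrightarrow> (\<exists>U. p \<in> interior U \<and> U \<inter> (\<Union>n\<in>{1::nat..}. (f ^^ n) ` U) = {})"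

definition nonwandering_set :: "('a::topological_space \<Rightarrow> 'a) \<Rightarrow> 'a set" where
  "nonwandering_set f = {p. \<not> wandering f p}"

definition finite_preimages :: "('a \<Rightarrow> 'b) \<Rightarrow> 'a set \<Rightarrow> 'b set \<Rightarrow> bool" where
  "finite_preimages n S Q \<longleftrightarrow> n \<in> S \<rightarrow> Q \<and> (\<forall>k\<in>Q. finite {p \<in> S. n p = k})"

end

theory Submission
  imports Defs
begin

text \<open>If \<open>S\<close> is finite, \<open>n = 1\<close> works. Conversely, let \<open>S\<close> be infinite, so that \<open>n p\<close> is unbounded on
  \<open>S\<close>. After a small perturbation making the points \<open>p, f(p), \<dots>\<close> distinct up to time \<open>n p\<close>, local
  bumps realise every product \<open>P\<^sub>n A\<^sub>n\<^sub>-\<^sub>1 \<dots> P\<^sub>1 A\<^sub>0\<close> of the derivatives \<open>A\<^sub>j\<close> of \<open>f\<close> along the orbit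
  with arbitrary \<open>P\<^sub>j\<close> close to the identity, so all these products are bounded by one constant.
  The supremum of \<open>|P\<^sub>n A\<^sub>n\<^sub>-\<^sub>1 \<dots> P\<^sub>j\<^sub>+\<^sub>1 A\<^sub>j v|\<close> over the \<open>P\<close>'s is a norm of \<open>v\<close> at time \<open>j\<close>; it is
  contracted by \<open>f\<close> (take multiples of the identity for \<open>P\<^sub>j\<^sub>+\<^sub>1\<close>) and has bounded eccentricity
  (rotate by \<open>P\<^sub>j\<^sub>+\<^sub>1\<close>). A Pliss type argument then yields a time \<open>i\<close> from which \<open>f\<close> contracts a
  disc of uniform radius around \<open>f\<^sup>i(p)\<close> for a number of steps tending to infinity with \<open>n p\<close>. By
  compactness infinitely many of these points \<open>f\<^sup>i(p)\<close> lie in one open set whose iterates shrink to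
  points. Such a set contains only finitely many nonwandering points, all periodic, so infinitely
  many \<open>p\<close> lie on finitely many periodic orbits, a contradiction.\<close>

subsection \<open>Maps of class C1 between Euclidean spaces\<close>

text \<open>A bound on derivatives of \<open>f\<close> alone gives no rate of decay; the rate comes
  from a bound over all nearby maps. As scaling every factor by 1 + \<epsilon> is an admissible
  perturbation, unperturbed products must decay like (1 + \<epsilon>)^(-n). One \<epsilon> serves
  all \<open>p\<close> and all lengths \<open>n p\<close>, because the C1 size of a bump fixing its
  centre depends on its linear part and not on its radius, and because bumps with disjoint supports
  do not add up in the C1 distance. If the orbit of \<open>p\<close> repeats, bumps at different
  times would sit at the same point; hence they are placed on the orbit of a nearby
  \<open>h\<close>, and letting \<open>h\<close> tend to \<open>f\<close> gives the bound for
  \<open>f\<close>, since products are continuous in their factors. The remaining obstacle is that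
  the adapted norm belongs to one orbit segment and resembles the Euclidean norm only up to a scale
  varying along it. Starting times must be selected from which this scale does not drop too fast.
  Only the number of contracted steps then depends on \<open>p\<close>; the radius of the disc and
  the rate do not.\<close>

definition fderiv :: "('a::euclidean_space \<Rightarrow> 'b::euclidean_space) \<Rightarrow> 'a \<Rightarrow> 'a \<Rightarrow>\<^sub>L 'b" where
  "fderiv F x = Blinfun (frechet_derivative F (at x))"

lemma fderiv_apply:
  assumes "F differentiable (at x)"
  shows "blinfun_apply (fderiv F x) = frechet_derivative F (at x)"
  unfolding fderiv_def using assms
  by (meson bounded_linear_Blinfun_apply frechet_derivative_works has_derivative_bounded_linear)

lemma fderiv_has_derivative:
  assumes "F differentiable (at x)"
  shows "(F has_derivative blinfun_apply (fderiv F x)) (at x)"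
  using assms by (simp add: fderiv_apply frechet_derivative_works[symmetric])

lemma fderiv_eqI:
  assumes "(F has_derivative blinfun_apply T) (at x)"
  shows "fderiv F x = T"
  unfolding fderiv_def using frechet_derivative_at[OF assms] by (metis blinfun_apply_inverse)

lemma fderiv_cong_ev:
  assumes "eventually (\<lambda>y. F y = G y) (nhds x)"
  shows "fderiv F x = fderiv G x"
proof -
  have e: "eventually (\<lambda>y. F y = G y) (at x)" "F x = G x"
    using assms by (auto simp: eventually_nhds_conv_at)
  then have "(F has_derivative D) (at x) = (G has_derivative D) (at x)" for D
    using has_derivative_transform_eventually[of F D x UNIV G]
      has_derivative_transform_eventually[of G D x UNIV F] by (auto simp: eq_commute)
  then show ?thesis by (simp add: fderiv_def frechet_derivative_def)
qed

lemma differentiable_cong_ev: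
  assumes "eventually (\<lambda>y. F y = G y) (nhds x)"
  shows "F differentiable (at x) \<longleftrightarrow> G differentiable (at x)"
proof -
  have e: "eventually (\<lambda>y. F y = G y) (at x)" "F x = G x"
    using assms by (auto simp: eventually_nhds_conv_at)
  then have "(F has_derivative D) (at x) = (G has_derivative D) (at x)" for D
    using has_derivative_transform_eventually[of F D x UNIV G]
      has_derivative_transform_eventually[of G D x UNIV F] by (auto simp: eq_commute)
  then show ?thesis by (simp add: differentiable_def)
qed

lemma fderiv_compose:
  assumes "F differentiable (at x)" "G differentiable (at (F x))"
  shows "(G \<circ> F) differentiable (at x)" "fderiv (G \<circ> F) x = fderiv G (F x) o\<^sub>L fderiv F x"
proof -
  have "((G \<circ> F) has_derivative (blinfun_apply (fderiv G (F x)) \<circ> blinfun_apply (fderiv F x))) (at x)"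
    by (intro diff_chain_at fderiv_has_derivative assms)
  moreover have "blinfun_apply (fderiv G (F x)) \<circ> blinfun_apply (fderiv F x)
      = blinfun_apply (fderiv G (F x) o\<^sub>L fderiv F x)"
    by (auto simp: fun_eq_iff)
  ultimately have *: "((G \<circ> F) has_derivative blinfun_apply (fderiv G (F x) o\<^sub>L fderiv F x)) (at x)"
    by simp
  then show "(G \<circ> F) differentiable (at x)" by (rule differentiableI)
  show "fderiv (G \<circ> F) x = fderiv G (F x) o\<^sub>L fderiv F x" using * by (rule fderiv_eqI)
qed

definition C1_on :: "'a::euclidean_space set \<Rightarrow> ('a \<Rightarrow> 'b::euclidean_space) \<Rightarrow> bool" where
  "C1_on S F \<longleftrightarrow> (\<forall>x\<in>S. F differentiable (at x)) \<and> continuous_on S (fderiv F)"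

text \<open>In finite dimension a family of linear maps is norm continuous as soon as its values at
  fixed vectors are continuous. This turns the componentwise definition into one about a single
  operator-valued map.\<close>

lemma Ck_on_1_iff:
  fixes F :: "'a::euclidean_space \<Rightarrow> 'b::euclidean_space"
  shows "Ck_on 1 S F \<longleftrightarrow> C1_on S F"
proof -
  { assume d: "\<forall>x\<in>S. F differentiable (at x)"
    have "(\<forall>v. continuous_on S (\<lambda>x. frechet_derivative F (at x) v))
      \<longleftrightarrow> (\<forall>v. continuous_on S (\<lambda>x. blinfun_apply (fderiv F x) v))"
      using d by (intro all_cong1 continuous_on_cong) (auto simp: fderiv_apply)
    also have "\<dots> \<longleftrightarrow> continuous_on S (fderiv F)"
    proof
      assume "\<forall>v. continuous_on S (\<lambda>x. blinfun_apply (fderiv F x) v)"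
      then show "continuous_on S (fderiv F)" by (intro continuous_on_blinfun_componentwise) simp
    next
      assume "continuous_on S (fderiv F)"
      then show "\<forall>v. continuous_on S (\<lambda>x. blinfun_apply (fderiv F x) v)"
        by (intro allI continuous_intros)
    qed
    finally have "(\<forall>v. continuous_on S (\<lambda>x. frechet_derivative F (at x) v))
      \<longleftrightarrow> continuous_on S (fderiv F)" . }
  then show ?thesis unfolding One_nat_def Ck_on.simps C1_on_def by blast
qed

lemma C1_I:
  fixes F :: "'a::euclidean_space \<Rightarrow> 'b::euclidean_space"
  assumes "\<And>x. x \<in> S \<Longrightarrow> (F has_derivative blinfun_apply (D x)) (at x)" "continuous_on S D"
  shows "C1_on S F"
proof -
  have "\<And>x. x \<in> S \<Longrightarrow> D x = fderiv F x" using assms(1) fderiv_eqI by metis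
  then have "continuous_on S (fderiv F)" using assms(2) continuous_on_cong[of S S D "fderiv F"] by simp
  then show ?thesis using assms(1) unfolding C1_on_def by (auto intro: differentiableI)
qed

lemma C1_continuous_on:
  fixes F :: "'a::euclidean_space \<Rightarrow> 'b::euclidean_space"
  assumes "C1_on S F" shows "continuous_on S F"
  using assms unfolding C1_on_def
  by (meson continuous_at_imp_continuous_on differentiable_imp_continuous_within)

lemma C1_subset:
  fixes F :: "'a::euclidean_space \<Rightarrow> 'b::euclidean_space"
  assumes "C1_on S F" "T \<subseteq> S" shows "C1_on T F"
  using assms unfolding C1_on_def by (auto intro: continuous_on_subset)

lemma C1_local:
  fixes F :: "'a::euclidean_space \<Rightarrow> 'b::euclidean_space"
  assumes "\<And>x. x \<in> S \<Longrightarrow> \<exists>T G. open T \<and> x \<in> T \<and> C1_on T G \<and> (\<forall>y\<in>T. F y = G y)"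
  shows "C1_on S F"
proof -
  have "F differentiable (at x) \<and> isCont (fderiv F) x" if xS: "x \<in> S" for x
  proof -
    obtain T G where T: "open T" "x \<in> T" "C1_on T G" "\<forall>y\<in>T. F y = G y"
      using assms[OF xS] by blast
    have ev: "eventually (\<lambda>y. F y = G y) (nhds u)" if "u \<in> T" for u
      unfolding eventually_nhds using T(1,4) that by blast
    have "F differentiable (at x)" using differentiable_cong_ev[OF ev[OF T(2)]] T(2,3)
      unfolding C1_on_def by blast
    moreover have "isCont (fderiv G) x"
      using T(1-3) unfolding C1_on_def by (metis continuous_on_eq_continuous_at)
    moreover have "eventually (\<lambda>u. fderiv F u = fderiv G u) (nhds x)"
      using T(1,2) fderiv_cong_ev[OF ev] by (auto simp: eventually_nhds)
    ultimately show ?thesis by (simp add: isCont_cong)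
  qed
  then show ?thesis unfolding C1_on_def by (auto intro: continuous_at_imp_continuous_on)
qed

lemma C1_compose:
  fixes F :: "'a::euclidean_space \<Rightarrow> 'b::euclidean_space" and G :: "'b \<Rightarrow> 'c::euclidean_space"
  assumes "C1_on S F" "C1_on T G" "F ` S \<subseteq> T"
  shows "C1_on S (G \<circ> F)"
proof (rule C1_I)
  fix x assume "x \<in> S"
  then show "((G \<circ> F) has_derivative blinfun_apply (fderiv G (F x) o\<^sub>L fderiv F x)) (at x)"
    using assms fderiv_compose[of F x G] fderiv_has_derivative[of "G \<circ> F" x] unfolding C1_on_def by auto
next
  show "continuous_on S (\<lambda>x. fderiv G (F x) o\<^sub>L fderiv F x)"
    using assms C1_continuous_on[OF assms(1)] unfolding C1_on_def
    by (auto intro!: continuous_intros continuous_on_compose2[of T "fderiv G"])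
qed

text \<open>A Lebesgue number of the cover of \<open>K\<close> by sets on which \<open>F\<close> and
  its derivative oscillate little gives one radius for all of \<open>K\<close>; the last estimate is
  the mean value inequality on the ball.\<close>

lemma C1_uniform:
  fixes F :: "'a::euclidean_space \<Rightarrow> 'b::euclidean_space"
  assumes "open S" "C1_on S F" "compact K" "K \<subseteq> S" "0 < e"
  obtains r where "0 < r" "\<And>a. a \<in> K \<Longrightarrow> cball a r \<subseteq> S"
    "\<And>a u. a \<in> K \<Longrightarrow> u \<in> cball a r \<Longrightarrow> norm (F u - F a) \<le> e"
    "\<And>a u. a \<in> K \<Longrightarrow> u \<in> cball a r \<Longrightarrow> norm (fderiv F u - fderiv F a) \<le> e"
    "\<And>a u. a \<in> K \<Longrightarrow> u \<in> cball a r \<Longrightarrow> norm (F u - F a - fderiv F a (u - a)) \<le> e * norm (u - a)"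
proof -
  define \<C> where
    "\<C> = (\<lambda>a. {u \<in> S. norm (F u - F a) < e / 2 \<and> norm (fderiv F u - fderiv F a) < e / 2}) ` K"
  have cF: "continuous_on S F" and cD: "continuous_on S (fderiv F)"
    using assms C1_continuous_on unfolding C1_on_def by auto
  have op: "open U" if U: "U \<in> \<C>" for U
  proof -
    obtain a where a: "a \<in> K"
      "U = {u \<in> S. norm (F u - F a) < e / 2 \<and> norm (fderiv F u - fderiv F a) < e / 2}"
      using U unfolding \<C>_def by auto
    have "U = (S \<inter> F -` ball (F a) (e/2)) \<inter> (S \<inter> fderiv F -` ball (fderiv F a) (e/2))"
      unfolding a by (auto simp: dist_norm norm_minus_commute)
    then show ?thesis
      using continuous_open_preimage[OF cF assms(1)] continuous_open_preimage[OF cD assms(1)]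
      by (metis open_Int open_ball)
  qed
  have cov: "K \<subseteq> \<Union>\<C>" unfolding \<C>_def using assms by auto
  obtain d where d: "0 < d" "\<And>x. x \<in> K \<Longrightarrow> \<exists>G\<in>\<C>. ball x d \<subseteq> G"
    using Heine_Borel_lemma[OF assms(3) cov op] by metis
  have main: "u \<in> S \<and> norm (F u - F a) \<le> e \<and> norm (fderiv F u - fderiv F a) \<le> e"
    if aK: "a \<in> K" and u: "u \<in> ball a d" for a u
  proof -
    obtain b where b: "b \<in> K"
      "ball a d \<subseteq> {u \<in> S. norm (F u - F b) < e / 2 \<and> norm (fderiv F u - fderiv F b) < e / 2}"
      using d(2)[OF aK] unfolding \<C>_def by blast
    have "u \<in> S" "norm (F u - F b) < e/2" "norm (fderiv F u - fderiv F b) < e / 2" using b(2) u by blast+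
    moreover have aa: "a \<in> ball a d" using d(1) by simp
    moreover have "norm (F a - F b) < e/2" "norm (fderiv F a - fderiv F b) < e / 2"
      using aa b(2) by blast+
    moreover have "norm (F u - F a) \<le> norm (F u - F b) + norm (F a - F b)"
      "norm (fderiv F u - fderiv F a) \<le> norm (fderiv F u - fderiv F b) + norm (fderiv F a - fderiv F b)"
      by norm+
    ultimately show ?thesis by linarith
  qed
  show ?thesis
  proof
    \<comment> \<open>Half the Lebesgue number, so that closed balls fit into the open ones.\<close>
    show "0 < d / 2" using d by simp
    have sub: "u \<in> ball a d" if "u \<in> cball a (d/2)" for a u using that d(1) by auto
    show "cball a (d/2) \<subseteq> S" if "a \<in> K" for a using main[OF that] sub by blast
    show "norm (F u - F a) \<le> e" "norm (fderiv F u - fderiv F a) \<le> e" if "a \<in> K" "u \<in> cball a (d/2)"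
      for a u
      using main[OF that(1) sub[OF that(2)]] by auto
    show "norm (F u - F a - fderiv F a (u - a)) \<le> e * norm (u - a)" if "a \<in> K" "u \<in> cball a (d/2)"
      for a u
    proof -
      have "norm (F u - F a - fderiv F a (u - a)) \<le> norm (u - a) * e"
      proof (rule differentiable_bound_linearization[where S = "cball a (d/2)"])
        show "a + t *\<^sub>R (u - a) \<in> cball a (d/2)" if "t \<in> {0..1}" for t
        proof -
          have "t * norm (u - a) \<le> 1 * (d/2)" 
            using that \<open>u \<in> cball a (d/2)\<close> by (intro mult_mono) (auto simp: dist_norm norm_minus_commute)
          then show ?thesis using that by (simp add: dist_norm)
        qed
        show "(F has_derivative fderiv F x) (at x within cball a (d/2))" if x: "x \<in> cball a (d/2)" for x
          using main[OF \<open>a \<in> K\<close> sub[OF x]] assms(2) fderiv_has_derivative unfolding C1_on_def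
          by (auto intro: has_derivative_at_withinI)
        show "onorm (blinfun_apply (fderiv F x) - blinfun_apply (fderiv F a)) \<le> e" if x:
          "x \<in> cball a (d/2)" for x
        proof -
          have "blinfun_apply (fderiv F x) - blinfun_apply (fderiv F a) = blinfun_apply (fderiv F x - fderiv F a)"
            by (auto simp: fun_eq_iff blinfun.diff_left)
          then show ?thesis using main[OF \<open>a \<in> K\<close> sub[OF x]] by (simp add: norm_blinfun.rep_eq)
        qed
        show "a \<in> cball a (d/2)" using d by simp
      qed
      then show ?thesis by (simp add: mult.commute)
    qed
  qed
qed

subsection \<open>Compactly supported perturbations of the identity of a Euclidean space\<close>

text \<open>The derivative bound makes \<open>\<psi>\<close> a 1/2-contraction. Hence
  \<open>\<beta>\<close> shrinks distances at most by half, and \<open>\<beta> w = y\<close> is a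
  fixed point equation for the contraction \<open>\<lambda>w. y - \<psi> w\<close>.\<close>

lemma C1_small_perturbation:
  fixes \<psi> :: "'b::euclidean_space \<Rightarrow> 'b" and D :: "'b \<Rightarrow> 'b \<Rightarrow>\<^sub>L 'b"
  assumes der: "\<And>w. (\<psi> has_derivative blinfun_apply (D w)) (at w)" and cont: "continuous_on UNIV D"
    and small: "\<And>w. norm (D w) \<le> 1 / 2"
  defines "\<beta> \<equiv> \<lambda>w. w + \<psi> w"
  shows "bij \<beta>" "C1_on UNIV \<beta>" "C1_on UNIV (inv \<beta>)"
proof -
  have lip: "norm (\<psi> v - \<psi> w) \<le> 1/2 * norm (v - w)" for v w
    by (rule differentiable_bound[of UNIV]) (use der small in \<open>auto simp: norm_blinfun.rep_eq[symmetric]\<close>)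
  have low: "norm (\<beta> v - \<beta> w) \<ge> 1/2 * norm (v - w)" for v w
  proof -
    have "\<beta> v - \<beta> w = (v - w) + (\<psi> v - \<psi> w)" by (simp add: \<beta>_def)
    then have "norm (v - w) \<le> norm (\<beta> v - \<beta> w) + norm (\<psi> v - \<psi> w)"
      by (metis add_diff_cancel_right' norm_triangle_ineq4)
    then show ?thesis using lip[of v w] by linarith
  qed
  have inj: "inj \<beta>"
  proof (rule injI)
    fix v w assume "\<beta> v = \<beta> w" then show "v = w" using low[of v w] by simp
  qed
  have "\<exists>w. \<beta> w = y" for y
  proof -
    have "\<forall>v w. dist (y - \<psi> v) (y - \<psi> w) \<le> 1/2 * dist v w"
    proof (intro allI)
      fix v w
      have "dist (y - \<psi> v) (y - \<psi> w) = norm (\<psi> v - \<psi> w)"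
        by (simp add: dist_norm norm_minus_commute)
      then show "dist (y - \<psi> v) (y - \<psi> w) \<le> 1/2 * dist v w" using lip[of v w] by (simp add: dist_norm)
    qed
    then obtain w where "y - \<psi> w = w" using banach_fix_type[of "1/2" "\<lambda>w. y - \<psi> w"] by auto
    then show ?thesis unfolding \<beta>_def by (metis diff_add_cancel)
  qed
  then have sur: "surj \<beta>" by (metis surjI surj_def)
  show bij: "bij \<beta>" using inj sur by (simp add: bij_def)
  let ?E = "\<lambda>w. id_blinfun + D w"
  have derb: "(\<beta> has_derivative blinfun_apply (?E w)) (at w)" for w
  proof -
    have "(\<beta> has_derivative (\<lambda>v. v + D w v)) (at w)"
      unfolding \<beta>_def by (intro derivative_intros der)
    then show ?thesis by (simp add: plus_blinfun.rep_eq)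
  qed
  have contE: "continuous_on UNIV ?E" by (intro continuous_intros cont)
  show "C1_on UNIV \<beta>" using derb contE by (rule C1_I)
  have Elow: "norm (?E w v) \<ge> 1/2 * norm v" for w v
  proof -
    have "norm (D w v) \<le> 1/2 * norm v"
      using norm_blinfun[of "D w" v] small[of w] by (meson mult_right_mono norm_ge_zero order_trans)
    moreover have "norm v \<le> norm (v + D w v) + norm (D w v)"
      by (metis add_diff_cancel_right' norm_triangle_ineq4)
    ultimately show ?thesis by (simp add: plus_blinfun.rep_eq)
  qed
  have bijE: "bij (blinfun_apply (?E w))" for w
  proof -
    have "inj (blinfun_apply (?E w))"
    proof (rule injI)
      fix u v assume "?E w u = ?E w v"
      then have "?E w (u - v) = 0" by (simp only: blinfun.diff_right) simp
      then show "u = v" using Elow[of "u - v" w] by simp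
    qed
    moreover have "linear (blinfun_apply (?E w))"
      by (simp add: bounded_linear.linear blinfun.bounded_linear_right)
    ultimately show ?thesis using linear_injective_imp_surjective by (auto simp: bij_def)
  qed
  define G where "G w = Blinfun (inv (blinfun_apply (?E w)))" for w
  have G: "blinfun_apply (G w) = inv (blinfun_apply (?E w))" for w
  proof -
    have lin: "linear (blinfun_apply (?E w))"
      by (simp add: bounded_linear.linear blinfun.bounded_linear_right)
    then have "linear (inv (blinfun_apply (?E w)))"
      using inj_linear_imp_inv_linear bijE bij_def by blast
    then show ?thesis unfolding G_def
      by (simp add: bounded_linear_Blinfun_apply linear_conv_bounded_linear)
  qed
  have EG: "?E w (G w v) = v" and GE: "G w (?E w v) = v" for w v
    unfolding G using bijE by (simp_all add: bij_is_surj surj_f_inv_f bij_is_inj)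
  have Gn: "norm (G w) \<le> 2" for w
  proof (rule norm_blinfun_bound)
    fix v show "norm (G w v) \<le> 2 * norm v" using Elow[of "G w v" w] EG by auto
  qed simp
  have contG: "continuous_on UNIV G"
  proof -
    \<comment> \<open>Resolvent identity: with both inverses bounded by 2, \<open>G\<close> inherits
      the continuity of \<open>?E\<close>.\<close>
    have diff: "norm (G w - G w') \<le> 4 * norm (?E w' - ?E w)" for w w'
    proof -
      have "G w - G w' = G w o\<^sub>L (?E w' - ?E w) o\<^sub>L G w'"
      proof (rule blinfun_eqI)
        fix v
        have "G w (?E w' (G w' v)) - G w (?E w (G w' v)) = G w v - G w' v"
          by (simp only: EG GE)
        then show "(G w - G w') v = (G w o\<^sub>L (?E w' - ?E w) o\<^sub>L G w') v"
          by (simp only: blinfun_apply_blinfun_compose blinfun.diff_left blinfun.diff_right)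
      qed
      also have "norm \<dots> \<le> norm (G w o\<^sub>L (?E w' - ?E w)) * norm (G w')" by (rule norm_blinfun_compose)
      also have "\<dots> \<le> (norm (G w) * norm (?E w' - ?E w)) * norm (G w')"
        by (intro mult_right_mono norm_blinfun_compose) auto
      also have "\<dots> \<le> (2 * norm (?E w' - ?E w)) * 2"
        by (intro mult_mono Gn) auto
      finally show ?thesis by simp
    qed
    show ?thesis unfolding continuous_on_def
    proof
      fix w
      have "(?E \<longlongrightarrow> ?E w) (at w within UNIV)" using contE unfolding continuous_on_def by blast
      then have "((\<lambda>w'. 4 * norm (?E w - ?E w')) \<longlongrightarrow> 4 * norm (?E w - ?E w)) (at w within UNIV)"
        by (intro tendsto_mult tendsto_norm tendsto_diff tendsto_const)
      then have "((\<lambda>w'. 4 * norm (?E w - ?E w')) \<longlongrightarrow> 0) (at w within UNIV)" by simp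
      then have "((\<lambda>w'. G w' - G w) \<longlongrightarrow> 0) (at w within UNIV)"
        by (rule Lim_null_comparison[rotated]) (use diff in auto)
      then show "(G \<longlongrightarrow> G w) (at w within UNIV)" by (rule LIM_zero_cancel)
    qed
  qed
  have invl: "norm (inv \<beta> x - inv \<beta> y) \<le> 2 * norm (x - y)" for x y
    using low[of "inv \<beta> x" "inv \<beta> y"] sur by (simp add: surj_f_inv_f)
  have continv: "continuous_on UNIV (inv \<beta>)"
    by (rule lipschitz_on_continuous_on[where L=2])
       (use invl in \<open>auto simp: dist_norm lipschitz_on_def\<close>)
  show "C1_on UNIV (inv \<beta>)"
  proof (rule C1_I)
    fix y
    show "(inv \<beta> has_derivative blinfun_apply (G (inv \<beta> y))) (at y)"
    proof (rule has_derivative_inverse_basic[where f = \<beta> and T = UNIV])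
      show "(\<beta> has_derivative blinfun_apply (?E (inv \<beta> y))) (at (inv \<beta> y))" by (rule derb)
      show "blinfun_apply (G (inv \<beta> y)) \<circ> blinfun_apply (?E (inv \<beta> y)) = id"
        using GE by (auto simp: fun_eq_iff)
      show "continuous (at y) (inv \<beta>)" using continv by (simp add: continuous_on_eq_continuous_at)
    qed (use sur in \<open>auto simp: surj_f_inv_f blinfun.bounded_linear_right\<close>)
  next
    show "continuous_on UNIV (\<lambda>y. G (inv \<beta> y))"
      using continuous_on_compose2[OF contG continv] by auto
  qed
qed

text \<open>Squaring removes the corner of the positive part at 0, which makes the cutoff of the
  bump below continuously differentiable.\<close>

lemma DERIV_max_square: "((\<lambda>t::real. (max 0 t)\<^sup>2) has_real_derivative 2 * max 0 t) (at t)"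
proof -
  consider "t < 0" | "t > 0" | "t = 0" by linarith
  then show ?thesis
  proof cases
    case 1
    have "((\<lambda>t::real. 0) has_real_derivative 0) (at t)" by simp
    then have "((\<lambda>t::real. (max 0 t)\<^sup>2) has_real_derivative 0) (at t)"
      by (rule has_field_derivative_transform_within_open[where S = "{..<0}"]) (use 1 in auto)
    then show ?thesis using 1 by simp
  next
    case 2
    have "((\<lambda>t::real. t\<^sup>2) has_real_derivative 2 * t) (at t)" by (auto intro!: derivative_eq_intros)
    then have "((\<lambda>t::real. (max 0 t)\<^sup>2) has_real_derivative 2 * t) (at t)"
      by (rule has_field_derivative_transform_within_open[where S = "{0<..}"]) (use 2 in auto)
    then show ?thesis using 2 by simp
  next
    case 3
    have "((\<lambda>h::real. (max 0 h)\<^sup>2 / h) \<longlongrightarrow> 0) (at 0)"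
    proof (rule Lim_null_comparison[where g = "\<lambda>h. \<bar>h\<bar>"])
      show "\<forall>\<^sub>F h::real in at 0. norm ((max 0 h)\<^sup>2 / h) \<le> \<bar>h\<bar>"
        by (rule always_eventually) (auto simp: max_def power2_eq_square)
      show "((\<lambda>h::real. \<bar>h\<bar>) \<longlongrightarrow> 0) (at 0)" by (rule tendsto_eq_intros | simp)+
    qed
    then show ?thesis using 3 by (simp add: DERIV_def)
  qed
qed

text \<open>The bump \<open>w \<mapsto> w + \<chi>(|w - z|\<^sup>2 / \<rho>\<^sup>2) (a + L (w - z))\<close> with the cutoff \<open>\<chi>(s) = max(0, 1 - s)\<^sup>2\<close>.\<close>

lemma bump_exists:
  fixes z a :: "'b::euclidean_space" and L :: "'b \<Rightarrow>\<^sub>L 'b"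
  assumes "0 < \<rho>" and small: "5 * norm L + 5 * norm a / \<rho> \<le> e" and "e \<le> 1 / 2"
  obtains \<beta> where "bij \<beta>" "C1_on UNIV \<beta>" "C1_on UNIV (inv \<beta>)"
    "\<And>w. w \<notin> ball z \<rho> \<Longrightarrow> \<beta> w = w" "\<beta> z = z + a" "a = 0 \<Longrightarrow> fderiv \<beta> z = id_blinfun + L"
    "\<And>w. norm (\<beta> w - w) \<le> e * \<rho>" "\<And>w. norm (fderiv \<beta> w - id_blinfun) \<le> e"
proof -
  define s where "s w = 1 - (norm (w - z))\<^sup>2 / \<rho>\<^sup>2" for w
  define \<psi> where "\<psi> w = (max 0 (s w))\<^sup>2 *\<^sub>R (a + L (w - z))" for w
  \<comment> \<open>Product rule for \<open>\<psi>\<close>: the squared cutoff contributes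
    \<open>2 * max 0 (s w)\<close> times the gradient
    \<open>(- 2 / \<rho>\<^sup>2) *\<^sub>R (w - z)\<close> of \<open>s\<close>.\<close>
  define D where "D w = (max 0 (s w))\<^sup>2 *\<^sub>R L +
    (blinfun_scaleR_left (a + L (w - z)) o\<^sub>L ((2 * max 0 (s w) * (- 2 / \<rho>\<^sup>2)) *\<^sub>R blinfun_inner_right (w - z)))" for w
  have e0: "0 \<le> e" using small assms(1) by (smt (verit) divide_nonneg_pos norm_ge_zero)
  have s1: "s w \<le> 1" for w by (simp add: s_def)
  have sout: "s w \<le> 0" if "w \<notin> ball z \<rho>" for w
  proof -
    have "\<rho> \<le> norm (w - z)" using that by (simp add: dist_norm norm_minus_commute)
    then have "\<rho>\<^sup>2 \<le> (norm (w - z))\<^sup>2" using assms(1) by (simp add: power_mono)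
    then show ?thesis using assms(1) by (simp add: s_def)
  qed
  have ders: "(s has_derivative (\<lambda>v. (- 2 / \<rho>\<^sup>2) * ((w - z) \<bullet> v))) (at w)" for w
  proof -
    have "((\<lambda>w. (w - z) \<bullet> (w - z)) has_derivative (\<lambda>v. (w - z) \<bullet> v + v \<bullet> (w - z))) (at w)"
      by (intro has_derivative_inner) (auto intro!: derivative_eq_intros)
    from has_derivative_diff[OF has_derivative_const has_derivative_mult_right[OF this, of
      "1 / \<rho>\<^sup>2"], of 1]
    have "((\<lambda>w. 1 - 1 / \<rho>\<^sup>2 * ((w - z) \<bullet> (w - z))) has_derivative
      (\<lambda>v. 0 - 1 / \<rho>\<^sup>2 * ((w - z) \<bullet> v + v \<bullet> (w - z)))) (at w)" .
    moreover have "s = (\<lambda>w. 1 - 1 / \<rho>\<^sup>2 * ((w - z) \<bullet> (w - z)))"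
      by (simp add: s_def power2_norm_eq_inner fun_eq_iff)
    moreover have "(\<lambda>v. 0 - 1 / \<rho>\<^sup>2 * ((w - z) \<bullet> v + v \<bullet> (w - z))) = (\<lambda>v. (- 2 / \<rho>\<^sup>2) * ((w - z) \<bullet> v))"
      by (simp add: fun_eq_iff inner_commute)
    ultimately show ?thesis by simp
  qed
  have derm: "((\<lambda>w. (max 0 (s w))\<^sup>2) has_derivative (\<lambda>v. 2 * max 0 (s w) * ((- 2 / \<rho>\<^sup>2) * ((w - z) \<bullet> v)))) (at w)" for w
    using has_derivative_compose[OF ders DERIV_max_square[unfolded has_field_derivative_def]] by simp
  have derp: "(\<psi> has_derivative blinfun_apply (D w)) (at w)" for w
  proof -
    have "((\<lambda>w. a + L (w - z)) has_derivative (\<lambda>v. L v)) (at w)"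
      by (auto intro!: derivative_eq_intros)
    from has_derivative_scaleR[OF derm this]
    have "(\<psi> has_derivative (\<lambda>v. (max 0 (s w))\<^sup>2 *\<^sub>R L v + (2 * max 0 (s w) * ((- 2 / \<rho>\<^sup>2) * ((w - z) \<bullet> v))) *\<^sub>R (a + L (w - z)))) (at w)"
      unfolding \<psi>_def .
    moreover have "blinfun_apply (D w) = (\<lambda>v. (max 0 (s w))\<^sup>2 *\<^sub>R L v + (2 * max 0 (s w) * ((- 2 / \<rho>\<^sup>2) * ((w - z) \<bullet> v))) *\<^sub>R (a + L (w - z)))"
      by (auto simp: fun_eq_iff D_def blinfun.bilinear_simps blinfun_inner_right.rep_eq inner_commute)
    ultimately show ?thesis by simp
  qed
  have conts: "continuous_on UNIV s" unfolding s_def by (intro continuous_intros) (use assms in auto)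
  have contD: "continuous_on UNIV D" unfolding D_def
    by (intro continuous_intros conts bounded_linear.continuous_on[OF bounded_linear_blinfun_scaleR_left]
        bounded_linear.continuous_on[OF bounded_linear_blinfun_inner_right])
  have aL: "norm (a + L (w - z)) \<le> norm a + norm L * \<rho>" if "w \<in> ball z \<rho>" for w
  proof -
    have "norm (L (w - z)) \<le> norm L * norm (w - z)" by (rule norm_blinfun)
    also have "\<dots> \<le> norm L * \<rho>" using that
      by (intro mult_left_mono) (auto simp: dist_norm norm_minus_commute)
    finally show ?thesis using norm_triangle_ineq[of a "L (w - z)"] by linarith
  qed
  \<comment> \<open>Origin of the factor 5: \<open>L\<close> itself costs norm L, and the slope of
    the cutoff, at most 4 / \<rho>, times norm a + norm L * \<rho> costs the rest. The radius enters
    the derivative bound only through norm a / \<rho>.\<close>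
  have main: "norm L * \<rho> + norm a \<le> e * \<rho>" "norm L + 4 * (norm a / \<rho> + norm L) \<le> e"
  proof -
    have "5 * norm L * \<rho> + 5 * norm a \<le> e * \<rho>" using small assms(1) by (simp add: field_simps)
    moreover have "0 \<le> norm L * \<rho>" using assms(1) by simp
    ultimately show "norm L * \<rho> + norm a \<le> e * \<rho>" using norm_ge_zero[of a] by linarith
    have "0 \<le> norm a / \<rho>" using assms(1) by simp
    then show "norm L + 4 * (norm a / \<rho> + norm L) \<le> e" using small by simp
  qed
  have m2: "(max 0 (s w))\<^sup>2 \<le> 1" for w using s1[of w] by (auto simp: max_def power_le_one)
  have Dsm: "norm (D w) \<le> e" for w
  proof (cases "w \<in> ball z \<rho>")
    case True
    have i1: "norm ((max 0 (s w))\<^sup>2 *\<^sub>R L v) \<le> norm L * norm v" for v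
    proof -
      have "norm ((max 0 (s w))\<^sup>2 *\<^sub>R L v) \<le> 1 * (norm L * norm v)"
        unfolding norm_scaleR using m2[of w] by (intro mult_mono norm_blinfun) auto
      then show ?thesis by simp
    qed
    have i2: "norm ((2 * max 0 (s w) * ((- 2 / \<rho>\<^sup>2) * ((w - z) \<bullet> v))) *\<^sub>R (a + L (w - z)))
        \<le> 4 * (norm a / \<rho> + norm L) * norm v" for v
    proof -
      have "\<bar>(w - z) \<bullet> v\<bar> \<le> norm (w - z) * norm v" by (rule Cauchy_Schwarz_ineq2)
      also have "\<dots> \<le> \<rho> * norm v" using True
        by (intro mult_right_mono) (auto simp: dist_norm norm_minus_commute)
      finally have cs: "\<bar>(w - z) \<bullet> v\<bar> \<le> \<rho> * norm v" .
      have "\<bar>2 * max 0 (s w) * ((- 2 / \<rho>\<^sup>2) * ((w - z) \<bullet> v))\<bar> = max 0 (s w) * (4 / \<rho>\<^sup>2 * \<bar>(w - z) \<bullet> v\<bar>)"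
        by (simp add: abs_mult)
      also have "\<dots> \<le> 1 * (4 / \<rho>\<^sup>2 * (\<rho> * norm v))"
        using s1[of w] cs by (intro mult_mono mult_left_mono) auto
      also have "\<dots> = 4 / \<rho> * norm v" using assms(1) by (simp add: power2_eq_square)
      finally have "\<bar>2 * max 0 (s w) * ((- 2 / \<rho>\<^sup>2) * ((w - z) \<bullet> v))\<bar> * norm (a + L (w - z))
        \<le> (4 / \<rho> * norm v) * (norm a + norm L * \<rho>)"
        using aL[OF True] assms(1) by (intro mult_mono) auto
      also have "\<dots> = 4 * (norm a / \<rho> + norm L) * norm v" using assms(1) by (simp add: field_simps)
      finally show ?thesis by simp
    qed
    show ?thesis
    proof (rule norm_blinfun_bound[OF e0])
      fix v
      have "D w v = (max 0 (s w))\<^sup>2 *\<^sub>R L v + (2 * max 0 (s w) * ((- 2 / \<rho>\<^sup>2) * ((w - z) \<bullet> v))) *\<^sub>R (a + L (w - z))"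
        by (auto simp: fun_eq_iff D_def blinfun.bilinear_simps blinfun_inner_right.rep_eq inner_commute)
      then have "norm (D w v) \<le> norm L * norm v + 4 * (norm a / \<rho> + norm L) * norm v"
        using i1[of v] i2[of v] norm_triangle_ineq[of "(max 0 (s w))\<^sup>2 *\<^sub>R L v"] by (smt (verit))
      also have "\<dots> = (norm L + 4 * (norm a / \<rho> + norm L)) * norm v" by (simp add: algebra_simps)
      also have "\<dots> \<le> e * norm v" by (intro mult_right_mono main) auto
      finally show "norm (D w v) \<le> e * norm v" .
    qed
  next
    case False
    then have "max 0 (s w) = 0" using sout by simp
    then show ?thesis using e0 by (simp add: D_def)
  qed
  let ?\<beta> = "\<lambda>w. w + \<psi> w"
  have D12: "norm (D w) \<le> 1/2" for w using Dsm[of w] assms(3) by linarith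
  note P = C1_small_perturbation[OF derp contD D12]
  have fd: "fderiv ?\<beta> w = id_blinfun + D w" for w
  proof (rule fderiv_eqI)
    have "(?\<beta> has_derivative (\<lambda>v. v + D w v)) (at w)" by (intro derivative_intros derp)
    then show "(?\<beta> has_derivative blinfun_apply (id_blinfun + D w)) (at w)"
      by (simp add: plus_blinfun.rep_eq)
  qed
  show ?thesis
  proof (rule that[OF P])
    show "w + \<psi> w = w" if "w \<notin> ball z \<rho>" for w using sout[OF that] by (simp add: \<psi>_def)
    show "z + \<psi> z = z + a" by (simp add: \<psi>_def s_def blinfun.zero_right)
    show "fderiv ?\<beta> z = id_blinfun + L" if "a = 0"
      unfolding fd D_def using that by (auto intro!: blinfun_eqI simp: s_def blinfun.bilinear_simps)
    show "norm (w + \<psi> w - w) \<le> e * \<rho>" for w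
    proof (cases "w \<in> ball z \<rho>")
      case True
      have "norm (\<psi> w) \<le> 1 * (norm a + norm L * \<rho>)"
        unfolding \<psi>_def norm_scaleR using m2[of w] aL[OF True] by (intro mult_mono) auto
      then show ?thesis using main by simp
    next
      case False
      then show ?thesis using sout[OF False] e0 assms(1) by (simp add: \<psi>_def)
    qed
    show "norm (fderiv ?\<beta> w - id_blinfun) \<le> e" for w unfolding fd using Dsm by simp
  qed
qed

subsection \<open>Charts and coordinate derivatives\<close>

definition cinv :: "('a, 'b) chart \<Rightarrow> 'b \<Rightarrow> 'a" where
  "cinv c = inv_into (fst c) (snd c)"

text \<open>Taken in coordinates, as an operator on \<open>'b\<close>, so that derivatives along an
  orbit can be multiplied and can converge in one normed space.\<close>

definition chart_deriv ::
  "('a, 'b::euclidean_space) chart \<Rightarrow> ('a \<Rightarrow> 'a) \<Rightarrow> ('a, 'b) chart \<Rightarrow> 'a \<Rightarrow> 'b \<Rightarrow>\<^sub>L 'b" where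
  "chart_deriv c f d p = fderiv (local_rep c f d) (snd c p)"

locale closed_mfd =
  fixes A :: "('a::t2_space, 'b::euclidean_space) chart set"
  assumes closed_mfd: "closed_manifold A"
begin

lemma compact_UNIV: "compact (UNIV :: 'a set)"
  using closed_mfd by (simp add: closed_manifold_def)

lemma atlas: "smooth_atlas A"
  using closed_mfd by (simp add: closed_manifold_def)

lemma chart_exists: "\<exists>c\<in>A. x \<in> fst c"
  using atlas unfolding smooth_atlas_def by blast

lemma chart_open: "c \<in> A \<Longrightarrow> open (fst c)"
  and chart_open_range: "c \<in> A \<Longrightarrow> open (snd c ` fst c)"
  using atlas unfolding smooth_atlas_def is_chart_def by blast+

lemma chart_homeomorphism:
  assumes "c \<in> A" shows "homeomorphism (fst c) (snd c ` fst c) (snd c) (cinv c)"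
proof -
  obtain \<psi> where \<psi>: "homeomorphism (fst c) (snd c ` fst c) (snd c) \<psi>"
    using assms atlas unfolding smooth_atlas_def is_chart_def by blast
  have inj: "inj_on (snd c) (fst c)" using \<psi> by (metis homeomorphism_apply1 inj_on_inverseI)
  have "\<psi> y = cinv c y" if "y \<in> snd c ` fst c" for y
    using that homeomorphism_apply1[OF \<psi>] inj unfolding cinv_def by (auto simp: inv_into_f_f)
  then show ?thesis by (intro homeomorphism_cong[OF \<psi>]) auto
qed

lemma cinv_chart [simp]: "c \<in> A \<Longrightarrow> x \<in> fst c \<Longrightarrow> cinv c (snd c x) = x"
  and chart_cinv [simp]: "c \<in> A \<Longrightarrow> y \<in> snd c ` fst c \<Longrightarrow> snd c (cinv c y) = y"
  and cinv_in: "c \<in> A \<Longrightarrow> y \<in> snd c ` fst c \<Longrightarrow> cinv c y \<in> fst c"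
  and chart_continuous: "c \<in> A \<Longrightarrow> continuous_on (fst c) (snd c)"
  and cinv_continuous: "c \<in> A \<Longrightarrow> continuous_on (snd c ` fst c) (cinv c)"
  using chart_homeomorphism unfolding homeomorphism_def by blast+

lemma cinv_image:
  assumes "c \<in> A" "V \<subseteq> snd c ` fst c" shows "cinv c ` V = {x \<in> fst c. snd c x \<in> V}"
proof
  show "cinv c ` V \<subseteq> {x \<in> fst c. snd c x \<in> V}"
    using assms chart_cinv cinv_in by (auto simp: subset_eq)
  show "{x \<in> fst c. snd c x \<in> V} \<subseteq> cinv c ` V"
    using assms cinv_chart by (metis (mono_tags, lifting) image_eqI mem_Collect_eq subsetI)
qed

lemma chart_preimage_open:
  assumes "c \<in> A" "open V" shows "open {x \<in> fst c. snd c x \<in> V}"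
proof -
  have "{x \<in> fst c. snd c x \<in> V} = fst c \<inter> snd c -` V" by auto
  then show ?thesis using continuous_open_preimage[OF chart_continuous chart_open] assms by simp
qed

lemma chart_image_open:
  assumes "c \<in> A" "open U" "U \<subseteq> fst c" shows "open (snd c ` U)"
proof -
  have "snd c ` U = snd c ` fst c \<inter> cinv c -` U"
    using assms cinv_in[OF assms(1)] chart_cinv[OF assms(1)] cinv_chart[OF assms(1)]
      by (auto 4 3 simp: subset_eq)
  then show ?thesis
    using continuous_open_preimage[OF cinv_continuous chart_open_range] assms by simp
qed

lemma chart_preimage_compact:
  assumes "c \<in> A" "compact V" "V \<subseteq> snd c ` fst c" shows "compact {x \<in> fst c. snd c x \<in> V}"
  using compact_continuous_image[OF continuous_on_subset[OF cinv_continuous[OF assms(1)] assms(3)] assms(2)]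
    cinv_image[OF assms(1,3)] by simp

lemma chart_image_compact:
  assumes "c \<in> A" "compact K" "K \<subseteq> fst c" shows "compact (snd c ` K)"
  using compact_continuous_image[OF continuous_on_subset[OF chart_continuous]] assms by blast

lemma local_rep_apply: "c \<in> A \<Longrightarrow> x \<in> fst c \<Longrightarrow> local_rep c f d (snd c x) = snd d (f x)"
  unfolding local_rep_def cinv_def[symmetric] by simp

lemma C1_map_continuous: "C1_map A f \<Longrightarrow> continuous_on UNIV f"
  by (simp add: C1_map_def)

lemma C1_map_open_preimage:
  assumes "C1_map A f" "open U" shows "open (f -` U)"
  using C1_map_continuous[OF assms(1)] assms(2) by (simp add: continuous_on_open_vimage)

lemma C1_map_domain_open:
  assumes "C1_map A f" "c \<in> A" "d \<in> A"
  shows "open (fst c \<inter> f -` fst d)" "open (snd c ` (fst c \<inter> f -` fst d))"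
proof -
  show "open (fst c \<inter> f -` fst d)"
    by (intro open_Int C1_map_open_preimage[OF assms(1)] chart_open assms)
  then show "open (snd c ` (fst c \<inter> f -` fst d))" using chart_image_open assms by auto
qed

lemma C1_map_local_rep:
  assumes "C1_map A f" "c \<in> A" "d \<in> A"
  shows "C1_on (snd c ` (fst c \<inter> f -` fst d)) (local_rep c f d)"
  using assms unfolding C1_map_def Ck_on_1_iff by blast

lemma C1_map_id: "C1_map A id"
proof -
  have "Ck_on 1 (snd c ` (fst c \<inter> id -` fst d)) (local_rep c id d)" if "c \<in> A" "d \<in> A" for c d
  proof -
    have "id -` fst d = fst d" by auto
    then show ?thesis using atlas that unfolding smooth_atlas_def smooth_on_def by metis
  qed
  then show ?thesis unfolding C1_map_def by auto
qed

lemma local_rep_differentiable: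
  assumes "C1_map A f" "c \<in> A" "d \<in> A" "x \<in> fst c" "f x \<in> fst d"
  shows "local_rep c f d differentiable (at (snd c x))"
  using C1_map_local_rep[OF assms(1-3)] assms(4,5) unfolding C1_on_def by blast

lemma chart_deriv_apply:
  assumes "C1_map A f" "c \<in> A" "d \<in> A" "x \<in> fst c" "f x \<in> fst d"
  shows "frechet_derivative (local_rep c f d) (at (snd c x)) = blinfun_apply (chart_deriv c f d x)"
  unfolding chart_deriv_def by (rule fderiv_apply[OF local_rep_differentiable[OF assms], symmetric])

lemma eventually_chart:
  assumes "c \<in> A" "x \<in> fst c" "open U" "x \<in> U" "\<And>y. y \<in> fst c \<Longrightarrow> y \<in> U \<Longrightarrow> P (snd c y)"
  shows "eventually P (nhds (snd c x))"
proof -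
  have "open (snd c ` (fst c \<inter> U))"
    by (intro chart_image_open open_Int chart_open assms) simp
  then show ?thesis unfolding eventually_nhds using assms by blast
qed

lemma chart_deriv_cong:
  assumes "c \<in> A" "x \<in> fst c" "open U" "x \<in> U" "\<And>y. y \<in> U \<Longrightarrow> f y = h y"
  shows "chart_deriv c f d x = chart_deriv c h d x"
  unfolding chart_deriv_def
  by (intro fderiv_cong_ev eventually_chart[OF assms(1-4)]) (use assms in \<open>auto simp: local_rep_apply\<close>)

lemma chart_deriv_compose:
  assumes "C1_map A f" "C1_map A h" "c \<in> A" "d \<in> A" "e \<in> A" "x \<in> fst c" "f x \<in> fst d" "h (f x) \<in> fst e"
  shows "chart_deriv c (h \<circ> f) e x = chart_deriv d h e (f x) o\<^sub>L chart_deriv c f d x"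
proof -
  have "eventually (\<lambda>u. local_rep c (h \<circ> f) e u = (local_rep d h e \<circ> local_rep c f d) u) (nhds (snd c x))"
    by (rule eventually_chart[where U = "f -` fst d"])
       (use assms C1_map_open_preimage chart_open in \<open>auto simp: local_rep_apply\<close>)
  then have "chart_deriv c (h \<circ> f) e x = fderiv (local_rep d h e \<circ> local_rep c f d) (snd c x)"
    unfolding chart_deriv_def by (rule fderiv_cong_ev)
  also have "\<dots> = fderiv (local_rep d h e) (local_rep c f d (snd c x)) o\<^sub>L fderiv (local_rep c f d) (snd c x)"
    by (rule fderiv_compose) (use assms local_rep_differentiable in \<open>auto simp: local_rep_apply\<close>)
  finally show ?thesis using assms by (simp add: local_rep_apply chart_deriv_def)
qed

lemma chart_deriv_id:
  assumes "c \<in> A" "x \<in> fst c" shows "chart_deriv c id c x = id_blinfun"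
proof -
  have "eventually (\<lambda>u. local_rep c id c u = id u) (nhds (snd c x))"
    by (rule eventually_chart[where U = UNIV]) (use assms in \<open>auto simp: local_rep_apply\<close>)
  then have "chart_deriv c id c x = fderiv id (snd c x)"
    unfolding chart_deriv_def by (rule fderiv_cong_ev)
  also have "\<dots> = id_blinfun" by (intro fderiv_eqI) (simp add: id_def)
  finally show ?thesis .
qed

lemma chart_deriv_continuous_on:
  assumes "C1_map A f" "c \<in> A" "d \<in> A"
  shows "continuous_on (fst c \<inter> f -` fst d) (chart_deriv c f d)"
  unfolding chart_deriv_def
  by (rule continuous_on_compose2[where t = "snd c ` (fst c \<inter> f -` fst d)" and g =
    "fderiv (local_rep c f d)"])
     (use C1_map_local_rep[OF assms] chart_continuous[OF assms(2)] in \<open>auto simp: C1_on_def intro: continuous_on_subset\<close>)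

text \<open>One pair of charts near each point suffices: changes of coordinates are C1, and every
  other local representation is locally a composition with two of them.\<close>

lemma C1_mapI:
  assumes cont: "continuous_on UNIV f"
    and loc: "\<And>x. \<exists>c\<in>A. \<exists>d\<in>A. \<exists>U. open U \<and> x \<in> U \<and> U \<subseteq> fst c \<inter> f -` fst d \<and> C1_on (snd c ` U) (local_rep c f d)"
  shows "C1_map A f"
  unfolding C1_map_def Ck_on_1_iff
proof (intro conjI ballI cont C1_local)
  fix c' d' u assume cd: "c' \<in> A" "d' \<in> A" and u: "u \<in> snd c' ` (fst c' \<inter> f -` fst d')"
  then obtain x where x: "x \<in> fst c'" "f x \<in> fst d'" "u = snd c' x" by auto
  obtain c d U where c: "c \<in> A" "d \<in> A" and U: "open U" "x \<in> U" "U \<subseteq> fst c \<inter> f -` fst d"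
    "C1_on (snd c ` U) (local_rep c f d)" using loc[of x] by blast
  let ?V = "U \<inter> fst c' \<inter> f -` fst d'"
  have oV: "open ?V" using U chart_open[OF cd(1)] chart_open[OF cd(2)] cont
    by (auto simp: continuous_on_open_vimage)
  have C: "C1_on (snd c' ` ?V) (local_rep d id d' \<circ> (local_rep c f d \<circ> local_rep c' id c))"
  proof (intro C1_compose)
    show "C1_on (snd c' ` ?V) (local_rep c' id c)"
      by (rule C1_subset[OF C1_map_local_rep[OF C1_map_id]]) (use c cd U in auto)
    show "C1_on (snd c ` U) (local_rep c f d)" by fact
    show "local_rep c' id c ` snd c' ` ?V \<subseteq> snd c ` U"
      using cd by (auto simp: local_rep_apply)
    show "C1_on (snd d ` (fst d \<inter> id -` fst d')) (local_rep d id d')"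
      by (rule C1_map_local_rep[OF C1_map_id]) (use c cd in auto)
    show "(local_rep c f d \<circ> local_rep c' id c) ` snd c' ` ?V \<subseteq> snd d ` (fst d \<inter> id -` fst d')"
    proof
      fix w assume "w \<in> (local_rep c f d \<circ> local_rep c' id c) ` snd c' ` ?V"
      then obtain y where y: "y \<in> ?V" "w = local_rep c f d (local_rep c' id c (snd c' y))" by auto
      then have "w = snd d (f y)" using cd c U by (auto simp: local_rep_apply)
      then show "w \<in> snd d ` (fst d \<inter> id -` fst d')" using y U by auto
    qed
  qed
  show "\<exists>T G. open T \<and> u \<in> T \<and> C1_on T G \<and> (\<forall>y\<in>T. local_rep c' f d' y = G y)"
  proof (intro exI conjI ballI)
    show "open (snd c' ` ?V)" by (rule chart_image_open[OF cd(1) oV]) blast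
    show "u \<in> snd c' ` ?V" using x U by auto
    show "C1_on (snd c' ` ?V) (local_rep d id d' \<circ> (local_rep c f d \<circ> local_rep c' id c))" by fact
    fix w assume "w \<in> snd c' ` ?V"
    then obtain y where y: "y \<in> ?V" "w = snd c' y" by auto
    then show "local_rep c' f d' w = (local_rep d id d' \<circ> (local_rep c f d \<circ> local_rep c' id c)) w"
      using cd c subsetD[OF U(3), of y] by (simp add: local_rep_apply)
  qed
qed

lemma C1_map_compose:
  assumes f: "C1_map A f" and h: "C1_map A h" shows "C1_map A (h \<circ> f)"
proof (rule C1_mapI)
  show "continuous_on UNIV (h \<circ> f)"
    using continuous_on_compose[of UNIV f h] C1_map_continuous f h continuous_on_subset by blast
  fix x
  obtain c d e where cde: "c \<in> A" "d \<in> A" "e \<in> A" "x \<in> fst c" "f x \<in> fst d" "h (f x) \<in> fst e"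
    using chart_exists by metis
  let ?U = "(fst c \<inter> f -` fst d) \<inter> f -` (fst d \<inter> h -` fst e)"
  have oU: "open ?U"
    by (intro open_Int C1_map_open_preimage[OF f] C1_map_open_preimage[OF h] chart_open cde)
  have C: "C1_on (snd c ` ?U) (local_rep d h e \<circ> local_rep c f d)"
  proof (rule C1_compose)
    show "C1_on (snd c ` ?U) (local_rep c f d)"
      by (rule C1_subset[OF C1_map_local_rep[OF f cde(1,2)]]) blast
    show "C1_on (snd d ` (fst d \<inter> h -` fst e)) (local_rep d h e)" using C1_map_local_rep[OF h cde(2,3)] .
    show "local_rep c f d ` snd c ` ?U \<subseteq> snd d ` (fst d \<inter> h -` fst e)"
      using cde(1) by (auto simp: local_rep_apply)
  qed
  have eq: "local_rep c (h \<circ> f) e w = (local_rep d h e \<circ> local_rep c f d) w" if "w \<in> snd c ` ?U" for w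
    using that cde(1,2) by (auto simp: local_rep_apply)
  have oI: "open (snd c ` ?U)" by (rule chart_image_open[OF cde(1) oU]) blast
  have "C1_on (snd c ` ?U) (local_rep c (h \<circ> f) e)"
    by (rule C1_local) (use oI C eq in blast)
  moreover have "x \<in> ?U" "?U \<subseteq> fst c \<inter> (h \<circ> f) -` fst e" using cde by auto
  ultimately show "\<exists>c\<in>A. \<exists>d\<in>A. \<exists>U. open U \<and> x \<in> U \<and> U \<subseteq> fst c \<inter> (h \<circ> f) -` fst d
      \<and> C1_on (snd c ` U) (local_rep c (h \<circ> f) d)"
    using cde(1,3) oU by blast
qed

lemma Diff1_C1: "f \<in> Diff1 A \<Longrightarrow> C1_map A f"
  and Diff1_bij: "f \<in> Diff1 A \<Longrightarrow> bij f"
  and Diff1_inv: "f \<in> Diff1 A \<Longrightarrow> inv f \<in> Diff1 A"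
  by (auto simp: Diff1_def bij_imp_bij_inv inv_inv_eq)

lemma Diff1_inj: "f \<in> Diff1 A \<Longrightarrow> f x = f y \<Longrightarrow> x = y"
  using Diff1_bij by (meson bij_def injD)

lemma Diff1_continuous: "f \<in> Diff1 A \<Longrightarrow> continuous_on UNIV f"
  using Diff1_C1 C1_map_continuous by blast

lemma Diff1_id: "id \<in> Diff1 A"
  using C1_map_id by (simp add: Diff1_def)

lemma Diff1_compose: "f \<in> Diff1 A \<Longrightarrow> h \<in> Diff1 A \<Longrightarrow> h \<circ> f \<in> Diff1 A"
  by (auto simp: Diff1_def bij_comp C1_map_compose o_inv_distrib)

lemma Diff1_funpow: "f \<in> Diff1 A \<Longrightarrow> f ^^ n \<in> Diff1 A"
  by (induction n) (auto simp: Diff1_compose Diff1_id)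

lemma Diff1I:
  assumes "C1_map A f" "C1_map A h" "\<And>x. h (f x) = x" "\<And>x. f (h x) = x" shows "f \<in> Diff1 A"
proof -
  have "bij f" using assms(3,4) by (metis bijI')
  moreover have "inv f = h" using assms(3,4) by (metis inv_equality)
  ultimately show ?thesis using assms by (simp add: Diff1_def)
qed

subsection \<open>Transplanting compactly supported maps into a chart\<close>

definition transplant :: "('a, 'b) chart \<Rightarrow> ('b \<Rightarrow> 'b) \<Rightarrow> 'a \<Rightarrow> 'a" where
  "transplant c \<beta> x = (if x \<in> fst c then cinv c (\<beta> (snd c x)) else x)"

text \<open>Since \<open>\<beta>\<close> is the identity off a ball whose closure stays inside the
  image of the chart, the transplanted map is the identity off a compact set. Compact sets being
  closed here, the complement and the chart domain form an open cover along which the map is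
  glued.\<close>

lemma transplant:
  assumes c: "c \<in> A" and ball: "cball z \<rho> \<subseteq> snd c ` fst c"
    and \<beta>: "bij \<beta>" "C1_on UNIV \<beta>" and outside: "\<forall>w. w \<notin> ball z \<rho> \<longrightarrow> \<beta> w = w"
  shows "\<And>x. x \<in> fst c \<Longrightarrow> transplant c \<beta> x \<in> fst c \<and> snd c (transplant c \<beta> x) = \<beta> (snd c x)"
    and "\<And>x. \<not> (x \<in> fst c \<and> snd c x \<in> ball z \<rho>) \<Longrightarrow> transplant c \<beta> x = x"
    and "C1_map A (transplant c \<beta>)"
    and "\<And>x. x \<in> fst c \<Longrightarrow> chart_deriv c (transplant c \<beta>) c x = fderiv \<beta> (snd c x)"
proof -
  note out = outside[rule_format]
  have inball: "\<beta> w \<in> ball z \<rho>" if "w \<in> ball z \<rho>" for w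
    using out[of "\<beta> w"] that bij_is_inj[OF \<beta>(1)] by (metis injD)
  have rng: "\<beta> w \<in> snd c ` fst c" if "w \<in> snd c ` fst c" for w
  proof (cases "w \<in> ball z \<rho>")
    case True then show ?thesis using inball ball ball_subset_cball by blast
  next
    case False then show ?thesis using out that by simp
  qed
  show in_c: "transplant c \<beta> x \<in> fst c \<and> snd c (transplant c \<beta> x) = \<beta> (snd c x)" if "x \<in> fst c" for x
    using that rng[of "snd c x"] c by (simp add: transplant_def cinv_in)
  show fixed: "transplant c \<beta> x = x" if "\<not> (x \<in> fst c \<and> snd c x \<in> ball z \<rho>)" for x
    using that out[of "snd c x"] c by (auto simp: transplant_def)
  define K where "K = {x \<in> fst c. snd c x \<in> cball z \<rho>}"
  have "compact K" unfolding K_def by (rule chart_preimage_compact[OF c compact_cball ball])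
  then have oK: "open (- K)" by (simp add: compact_imp_closed open_Compl)
  have cov: "fst c \<union> - K = UNIV" by (auto simp: K_def)
  have offK: "transplant c \<beta> x = x" if "x \<in> - K" for x
    using that ball_subset_cball by (intro fixed) (auto simp: K_def)
  have cont: "continuous_on UNIV (transplant c \<beta>)"
    unfolding cov[symmetric]
  proof (rule continuous_on_open_Un[OF chart_open[OF c] oK])
    have "continuous_on (fst c) (\<lambda>x. cinv c (\<beta> (snd c x)))"
      using continuous_on_compose2[OF cinv_continuous[OF c] continuous_on_compose2[OF C1_continuous_on[OF \<beta>(2)] chart_continuous[OF c]]]
        rng by (auto simp: image_subset_iff)
    then show "continuous_on (fst c) (transplant c \<beta>)"
      using continuous_on_cong[of "fst c" "fst c" "transplant c \<beta>" "\<lambda>x. cinv c (\<beta> (snd c x))"]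
        by (simp add: transplant_def)
    show "continuous_on (- K) (transplant c \<beta>)"
      using continuous_on_cong[of "- K" "- K" "transplant c \<beta>" "\<lambda>x. x"] offK by simp
  qed
  have rep: "local_rep c (transplant c \<beta>) c u = \<beta> u" if "u \<in> snd c ` fst c" for u
    using that in_c c by (auto simp: local_rep_apply)
  show C1: "C1_map A (transplant c \<beta>)"
  proof (rule C1_mapI[OF cont])
    fix x
    show "\<exists>c'\<in>A. \<exists>d'\<in>A. \<exists>U. open U \<and> x \<in> U \<and> U \<subseteq> fst c' \<inter> transplant c \<beta> -` fst d' \<and> C1_on (snd c' ` U) (local_rep c' (transplant c \<beta>) d')"
    proof (cases "x \<in> fst c")
      case True
      have "C1_on (snd c ` fst c) (local_rep c (transplant c \<beta>) c)"
        by (rule C1_local) (use C1_subset[OF \<beta>(2)] chart_open_range[OF c] rep in blast)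
      then show ?thesis using c True chart_open[OF c] in_c
        by (intro bexI[of _ c] exI[of _ "fst c"]) auto
    next
      case False
      then have xK: "x \<in> - K" by (auto simp: K_def)
      obtain d where d: "d \<in> A" "x \<in> fst d" using chart_exists by blast
      let ?U = "fst d \<inter> - K"
      have oU: "open ?U" using oK chart_open[OF d(1)] by auto
      have oI: "open (snd d ` ?U)" by (rule chart_image_open[OF d(1) oU]) blast
      have C: "C1_on (snd d ` ?U) (local_rep d id d)"
        by (rule C1_subset[OF C1_map_local_rep[OF C1_map_id d(1) d(1)]]) auto
      have eq: "local_rep d (transplant c \<beta>) d w = local_rep d id d w" if "w \<in> snd d ` ?U" for w
        using that d(1) offK by (auto simp: local_rep_apply)
      have "C1_on (snd d ` ?U) (local_rep d (transplant c \<beta>) d)"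
        by (rule C1_local) (use oI C eq in blast)
      then show ?thesis using d xK oU offK by (intro bexI[of _ d] exI[of _ ?U]) auto
    qed
  qed
  show "chart_deriv c (transplant c \<beta>) c x = fderiv \<beta> (snd c x)" if "x \<in> fst c" for x
    unfolding chart_deriv_def
    by (rule fderiv_cong_ev, rule eventually_chart[OF c that open_UNIV]) (use rep in auto)
qed

lemma transplant_Diff1:
  assumes c: "c \<in> A" and ball: "cball z \<rho> \<subseteq> snd c ` fst c"
    and \<beta>: "bij \<beta>" "C1_on UNIV \<beta>" "C1_on UNIV (inv \<beta>)" and outside: "\<forall>w. w \<notin> ball z \<rho> \<longrightarrow> \<beta> w = w"
  shows "transplant c \<beta> \<in> Diff1 A"
proof -
  have out': "\<forall>w. w \<notin> ball z \<rho> \<longrightarrow> inv \<beta> w = w"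
    using outside \<beta>(1) by (metis bij_inv_eq_iff)
  note T = transplant[OF c ball \<beta>(1,2) outside] and T' = transplant[OF c ball bij_imp_bij_inv[OF \<beta>(1)] \<beta>(3) out']
  have inv: "inv \<beta> (\<beta> w) = w" "\<beta> (inv \<beta> w) = w" for w
    using \<beta>(1) by (simp_all add: bij_is_inj bij_is_surj surj_f_inv_f)
  show ?thesis
  proof (rule Diff1I[OF T(3) T'(3)])
    fix x
    show "transplant c (inv \<beta>) (transplant c \<beta> x) = x"
      using T(1)[of x] inv c by (cases "x \<in> fst c") (auto simp: transplant_def)
    show "transplant c \<beta> (transplant c (inv \<beta>) x) = x"
      using T'(1)[of x] inv c by (cases "x \<in> fst c") (auto simp: transplant_def)
  qed
qed

end

subsection \<open>Products of linear maps that stay bounded under perturbation\<close>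

text \<open>Peeled off at time 0 and not at the last factor, so that a shift of both sequences
  describes the orbit segment that remains; \<open>growth\<close> recurses in the same way.\<close>

primrec pert_prod ::
  "(nat \<Rightarrow> 'b::euclidean_space \<Rightarrow>\<^sub>L 'b) \<Rightarrow> (nat \<Rightarrow> 'b \<Rightarrow>\<^sub>L 'b) \<Rightarrow> nat \<Rightarrow> 'b \<Rightarrow>\<^sub>L 'b" where
  "pert_prod P T 0 = id_blinfun"
| "pert_prod P T (Suc k) = pert_prod (\<lambda>j. P (Suc j)) (\<lambda>j. T (Suc j)) k o\<^sub>L (P 0 o\<^sub>L T 0)"

text \<open>This is the adapted norm: every unperturbed step contracts it by the factor \<open>1 / (1 + \<epsilon>)\<close>.\<close>

primrec growth :: "real \<Rightarrow> (nat \<Rightarrow> 'b::euclidean_space \<Rightarrow>\<^sub>L 'b) \<Rightarrow> nat \<Rightarrow> 'b \<Rightarrow> real" where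
  "growth \<epsilon> T 0 v = norm v"
| "growth \<epsilon> T (Suc k) v = (SUP P\<in>cball id_blinfun \<epsilon>. growth \<epsilon> (\<lambda>j. T (Suc j)) k (blinfun_apply P (T 0 v)))"

definition cocycle :: "real \<Rightarrow> (nat \<Rightarrow> 'b::euclidean_space \<Rightarrow>\<^sub>L 'b) \<Rightarrow> bool" where
  "cocycle K T \<longleftrightarrow> (\<forall>j. norm (T j) \<le> K \<and> (\<forall>v. norm v \<le> K * norm (T j v)))"

definition robustly_bounded ::
  "real \<Rightarrow> (nat \<Rightarrow> 'b::euclidean_space \<Rightarrow>\<^sub>L 'b) \<Rightarrow> nat \<Rightarrow> real \<Rightarrow> bool" where
  "robustly_bounded \<epsilon> T n b \<longleftrightarrow> (\<forall>P. (\<forall>j. P j \<in> cball id_blinfun \<epsilon>) \<longrightarrow> norm (pert_prod P T n) \<le> b)"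

text \<open>The sequences \<open>w\<close> are pseudo-orbits of the linear maps. In coordinates, the
  displacement between two nearby orbits of \<open>f\<close> is such a sequence, with
  \<open>T\<close> the derivatives along the first orbit; in this form the linear algebra needs no
  nonlinear map.\<close>

definition contracts_near ::
  "real \<Rightarrow> real \<Rightarrow> real \<Rightarrow> (nat \<Rightarrow> 'b::euclidean_space \<Rightarrow>\<^sub>L 'b) \<Rightarrow> nat \<Rightarrow> bool" where
  "contracts_near \<delta> Q \<kappa> T m \<longleftrightarrow> (\<forall>w l. l \<le> m \<and> (\<forall>k<l. norm (w (Suc k) - T k (w k)) \<le> \<delta> * norm (w k))
     \<longrightarrow> norm (w l) \<le> Q * \<kappa> ^ l * norm (w 0))"

section \<open>The adapted norm: one-step contraction and bounded eccentricity\<close>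

locale bounded_cocycle =
  fixes \<epsilon> K :: real
  assumes eps: "0 < \<epsilon>" "\<epsilon> \<le> 1" and K: "1 \<le> K"
begin

lemma cocycle_shift: "cocycle K T \<Longrightarrow> cocycle K (\<lambda>j. T (i + j))"
  and cocycle_Suc: "cocycle K T \<Longrightarrow> cocycle K (\<lambda>j. T (Suc j))"
  by (auto simp: cocycle_def)

lemma cocycle_step:
  assumes "cocycle K T" "P \<in> cball id_blinfun \<epsilon>"
  shows "norm (blinfun_apply P (T 0 v)) \<le> (1 + \<epsilon>) * (K * norm v)"
proof -
  have "norm P \<le> norm (id_blinfun :: 'a \<Rightarrow>\<^sub>L 'a) + norm (P - id_blinfun)" by norm
  also have "\<dots> \<le> 1 + \<epsilon>" using assms(2) norm_blinfun_id_le
    by (intro add_mono) (auto simp: dist_norm norm_minus_commute)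
  finally have P: "norm P \<le> 1 + \<epsilon>" .
  have "norm (T 0 v) \<le> norm (T 0) * norm v" by (rule norm_blinfun)
  also have "\<dots> \<le> K * norm v" using assms(1) by (intro mult_right_mono) (auto simp: cocycle_def)
  finally have T: "norm (T 0 v) \<le> K * norm v" .
  have "norm (blinfun_apply P (T 0 v)) \<le> norm P * norm (T 0 v)" by (rule norm_blinfun)
  also have "\<dots> \<le> (1 + \<epsilon>) * (K * norm v)" using P T eps by (intro mult_mono) auto
  finally show ?thesis .
qed

text \<open>The upper bound also shows that each supremum in \<open>growth\<close> runs over a
  bounded set, as a real supremum must to be meaningful.\<close>

lemma growth_bounds:
  assumes "cocycle K T"
  shows "0 \<le> growth \<epsilon> T k v" "growth \<epsilon> T k v \<le> ((1 + \<epsilon>) * K) ^ k * norm v"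
proof -
  have "0 \<le> growth \<epsilon> T k v \<and> growth \<epsilon> T k v \<le> ((1 + \<epsilon>) * K) ^ k * norm v"
    using assms
  proof (induction k arbitrary: T v)
    case (Suc k)
    let ?G = "\<lambda>P. growth \<epsilon> (\<lambda>j. T (Suc j)) k (blinfun_apply P (T 0 v))"
    note IH = Suc.IH[OF cocycle_Suc[OF Suc.prems]]
    have up: "?G P \<le> ((1 + \<epsilon>) * K) ^ Suc k * norm v" if "P \<in> cball id_blinfun \<epsilon>" for P
    proof -
      have "?G P \<le> ((1 + \<epsilon>) * K) ^ k * norm (blinfun_apply P (T 0 v))" using IH by blast
      also have "\<dots> \<le> ((1 + \<epsilon>) * K) ^ k * ((1 + \<epsilon>) * (K * norm v))"
        using eps K by (intro mult_left_mono cocycle_step[OF Suc.prems that]) auto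
      finally show ?thesis by (simp add: mult_ac)
    qed
    have id: "id_blinfun \<in> cball (id_blinfun :: 'a \<Rightarrow>\<^sub>L 'a) \<epsilon>" using eps by simp
    have "growth \<epsilon> T (Suc k) v \<le> ((1 + \<epsilon>) * K) ^ Suc k * norm v"
      unfolding growth.simps by (rule cSUP_least) (use id up in auto)
    moreover have "0 \<le> ?G id_blinfun" using IH by blast
    then have "0 \<le> growth \<epsilon> T (Suc k) v"
      unfolding growth.simps
      by (rule cSUP_upper2[OF _ id, rotated]) (use up in \<open>auto intro!: bdd_aboveI2\<close>)
    ultimately show ?case by blast
  qed auto
  then show "0 \<le> growth \<epsilon> T k v" "growth \<epsilon> T k v \<le> ((1 + \<epsilon>) * K) ^ k * norm v" by auto
qed

lemma growth_Suc_ge: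
  assumes "cocycle K T" "P \<in> cball id_blinfun \<epsilon>"
  shows "growth \<epsilon> (\<lambda>j. T (Suc j)) k (blinfun_apply P (T 0 v)) \<le> growth \<epsilon> T (Suc k) v"
  unfolding growth.simps
proof (rule cSUP_upper[OF assms(2)], rule bdd_aboveI2)
  fix Q assume "Q \<in> cball (id_blinfun :: 'a \<Rightarrow>\<^sub>L 'a) \<epsilon>"
  have "growth \<epsilon> (\<lambda>j. T (Suc j)) k (blinfun_apply Q (T 0 v)) \<le> ((1 + \<epsilon>) * K) ^ k * norm (blinfun_apply Q (T 0 v))"
    by (rule growth_bounds[OF cocycle_Suc[OF assms(1)]])
  also have "\<dots> \<le> ((1 + \<epsilon>) * K) ^ k * ((1 + \<epsilon>) * (K * norm v))"
    using eps K \<open>Q \<in> _\<close> by (intro mult_left_mono cocycle_step[OF assms(1)]) auto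
  finally show "growth \<epsilon> (\<lambda>j. T (Suc j)) k (blinfun_apply Q (T 0 v)) \<le> ((1 + \<epsilon>) * K) ^ k * ((1 + \<epsilon>) * (K * norm v))" .
qed

lemma growth_Suc_le:
  assumes "\<And>P. P \<in> cball id_blinfun \<epsilon> \<Longrightarrow> growth \<epsilon> (\<lambda>j. T (Suc j)) k (blinfun_apply P (T 0 v)) \<le> b"
  shows "growth \<epsilon> T (Suc k) v \<le> b"
  unfolding growth.simps by (rule cSUP_least) (use assms eps in auto)

lemma growth_triangle:
  assumes "cocycle K T" shows "growth \<epsilon> T k (v + w) \<le> growth \<epsilon> T k v + growth \<epsilon> T k w"
  using assms
proof (induction k arbitrary: T v w)
  case (Suc k)
  show ?case
  proof (rule growth_Suc_le)
    fix P assume P: "P \<in> cball (id_blinfun :: 'a \<Rightarrow>\<^sub>L 'a) \<epsilon>"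
    have "growth \<epsilon> (\<lambda>j. T (Suc j)) k (P (T 0 (v + w)))
      \<le> growth \<epsilon> (\<lambda>j. T (Suc j)) k (P (T 0 v)) + growth \<epsilon> (\<lambda>j. T (Suc j)) k (P (T 0 w))"
      using Suc.IH[OF cocycle_Suc[OF Suc.prems]] by (simp add: blinfun.add_right)
    also have "\<dots> \<le> growth \<epsilon> T (Suc k) v + growth \<epsilon> T (Suc k) w"
      by (intro add_mono growth_Suc_ge[OF Suc.prems P])
    finally show "growth \<epsilon> (\<lambda>j. T (Suc j)) k (P (T 0 (v + w))) \<le> growth \<epsilon> T (Suc k) v + growth \<epsilon> T (Suc k) w" .
  qed
qed (auto simp: norm_triangle_ineq)

lemma growth_scale_le:
  assumes "cocycle K T" shows "growth \<epsilon> T k (c *\<^sub>R v) \<le> \<bar>c\<bar> * growth \<epsilon> T k v"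
  using assms
proof (induction k arbitrary: T v)
  case (Suc k)
  show ?case
  proof (rule growth_Suc_le)
    fix P assume P: "P \<in> cball (id_blinfun :: 'a \<Rightarrow>\<^sub>L 'a) \<epsilon>"
    have "growth \<epsilon> (\<lambda>j. T (Suc j)) k (P (T 0 (c *\<^sub>R v))) \<le> \<bar>c\<bar> * growth \<epsilon> (\<lambda>j. T (Suc j)) k (P (T 0 v))"
      using Suc.IH[OF cocycle_Suc[OF Suc.prems]] by (simp add: blinfun.scaleR_right)
    also have "\<dots> \<le> \<bar>c\<bar> * growth \<epsilon> T (Suc k) v"
      by (intro mult_left_mono growth_Suc_ge[OF Suc.prems P]) auto
    finally show "growth \<epsilon> (\<lambda>j. T (Suc j)) k (P (T 0 (c *\<^sub>R v))) \<le> \<bar>c\<bar> * growth \<epsilon> T (Suc k) v" .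
  qed
qed auto

lemma growth_scale:
  assumes "cocycle K T" "0 < c" shows "growth \<epsilon> T k (c *\<^sub>R v) = c * growth \<epsilon> T k v"
proof (rule antisym)
  have "growth \<epsilon> T k (inverse c *\<^sub>R (c *\<^sub>R v)) \<le> inverse c * growth \<epsilon> T k (c *\<^sub>R v)"
    using growth_scale_le[OF assms(1), of k "inverse c" "c *\<^sub>R v"] assms(2) by simp
  then show "c * growth \<epsilon> T k v \<le> growth \<epsilon> T k (c *\<^sub>R v)" using assms(2) by (simp add: field_simps)
qed (use growth_scale_le[OF assms(1), of k c v] assms(2) in simp)

lemma growth_zero: "cocycle K T \<Longrightarrow> growth \<epsilon> T k 0 = 0"
  using growth_bounds[of T k 0] by auto

lemma growth_contract:
  assumes "cocycle K T"
  shows "(1 + \<epsilon>) * growth \<epsilon> (\<lambda>j. T (Suc j)) k (T 0 v) \<le> growth \<epsilon> T (Suc k) v"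
proof -
  let ?P = "(1 + \<epsilon>) *\<^sub>R (id_blinfun :: 'a \<Rightarrow>\<^sub>L 'a)"
  have "id_blinfun - ?P = (- \<epsilon>) *\<^sub>R (id_blinfun :: 'a \<Rightarrow>\<^sub>L 'a)" by (simp add: algebra_simps)
  then have "dist id_blinfun ?P = \<epsilon> * norm (id_blinfun :: 'a \<Rightarrow>\<^sub>L 'a)" using eps unfolding dist_norm
    by simp
  also have "\<dots> \<le> \<epsilon> * 1" using eps norm_blinfun_id_le by (intro mult_left_mono) auto
  finally have "?P \<in> cball id_blinfun \<epsilon>" by simp
  from growth_Suc_ge[OF assms this, of k v] show ?thesis
    using growth_scale[OF cocycle_Suc[OF assms], of "1 + \<epsilon>" k] eps by (simp add: scaleR_blinfun.rep_eq)
qed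

text \<open>Any vector \<open>w\<close> in the ball of radius \<open>\<epsilon> |u|\<close> around \<open>u\<close> is the image of \<open>u\<close> under a rank one
  perturbation of the identity.\<close>

lemma growth_ball:
  assumes T: "cocycle K T" and w: "norm (w - T 0 v) \<le> \<epsilon> * norm (T 0 v)"
  shows "growth \<epsilon> (\<lambda>j. T (Suc j)) k w \<le> growth \<epsilon> T (Suc k) v"
proof -
  define u where "u = T 0 v"
  define P where "P = id_blinfun + (blinfun_scaleR_left (w - u) o\<^sub>L ((1 / (norm u)\<^sup>2) *\<^sub>R blinfun_inner_right u))"
  have Pv: "P x = x + ((u \<bullet> x) / (norm u)\<^sup>2) *\<^sub>R (w - u)" for x
    by (simp add: P_def blinfun.bilinear_simps blinfun_inner_right.rep_eq)
  \<comment> \<open>For u = 0 the closeness hypothesis forces w = 0, and division by zero makes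
    \<open>P\<close> the identity.\<close>
  have "P u = w"
  proof (cases "u = 0")
    case True then show ?thesis using w by (simp add: u_def[symmetric] blinfun.zero_right)
  next
    case False then show ?thesis by (simp add: Pv power2_norm_eq_inner)
  qed
  moreover have "norm (P - id_blinfun) \<le> \<epsilon>"
  proof (rule norm_blinfun_bound)
    fix x
    have "norm ((P - id_blinfun) x) = \<bar>u \<bullet> x\<bar> / (norm u)\<^sup>2 * norm (w - u)"
      by (simp add: blinfun.diff_left Pv)
    also have "\<dots> \<le> (norm u * norm x) / (norm u)\<^sup>2 * (\<epsilon> * norm u)"
      using w eps by (intro mult_mono divide_right_mono Cauchy_Schwarz_ineq2) (auto simp: u_def)
    also have "\<dots> \<le> \<epsilon> * norm x" using eps by (cases "u = 0") (auto simp: power2_eq_square)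
    finally show "norm ((P - id_blinfun) x) \<le> \<epsilon> * norm x" .
  qed (use eps in simp)
  ultimately show ?thesis
    using growth_Suc_ge[OF T, of P k v] by (simp add: u_def dist_norm norm_minus_commute)
qed

text \<open>As norm (T 0 v) is at least norm v / K, the perturbed images of \<open>v\<close> fill a
  ball of radius \<epsilon> * norm v / K about \<open>T 0 v\<close>. Half the difference of the
  opposite points \<open>T 0 v + c *\<^sub>R u\<close> and \<open>T 0 v - c *\<^sub>R u\<close> is
  \<open>c *\<^sub>R u\<close>, so a bound for the norm at both points is a bound there. The form
  without quotients includes zero vectors.\<close>

lemma growth_next:
  assumes T: "cocycle K T"
  shows "growth \<epsilon> (\<lambda>j. T (Suc j)) k u * norm v \<le> (K / \<epsilon>) * norm u * growth \<epsilon> T (Suc k) v"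
proof (cases "u = 0 \<or> v = 0")
  case True
  then show ?thesis using growth_zero[OF cocycle_Suc[OF T]] growth_bounds[OF T, of "Suc k" v] eps K
    by (auto simp del: growth.simps)
next
  case False
  define c where "c = \<epsilon> * norm v / (K * norm u)"
  have c: "0 < c" using False eps K by (simp add: c_def)
  have "norm v \<le> K * norm (T 0 v)" using T by (simp add: cocycle_def)
  then have "norm v / K \<le> norm (T 0 v)" using K by (simp add: field_simps)
  then have "\<epsilon> * (norm v / K) \<le> \<epsilon> * norm (T 0 v)" using eps by (intro mult_left_mono) auto
  moreover have "norm (c *\<^sub>R u) = \<epsilon> * (norm v / K)"
    using False K eps by (simp add: c_def abs_mult)
  ultimately have cu: "norm (c *\<^sub>R u) \<le> \<epsilon> * norm (T 0 v)" by simp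
  let ?G = "growth \<epsilon> (\<lambda>j. T (Suc j)) k"
  note T' = cocycle_Suc[OF T]
  have "?G (T 0 v + c *\<^sub>R u) \<le> growth \<epsilon> T (Suc k) v" "?G (T 0 v - c *\<^sub>R u) \<le> growth \<epsilon> T (Suc k) v"
    using cu by (intro growth_ball[OF T]; simp)+
  moreover have "?G ((-1) *\<^sub>R (T 0 v - c *\<^sub>R u)) \<le> ?G (T 0 v - c *\<^sub>R u)"
    using growth_scale_le[OF T', of k "-1" "T 0 v - c *\<^sub>R u"] by simp
  moreover have "?G (2 *\<^sub>R (c *\<^sub>R u)) \<le> ?G (T 0 v + c *\<^sub>R u) + ?G ((-1) *\<^sub>R (T 0 v - c *\<^sub>R u))"
  proof -
    have "2 *\<^sub>R (c *\<^sub>R u) = (T 0 v + c *\<^sub>R u) + (-1) *\<^sub>R (T 0 v - c *\<^sub>R u)" unfolding scaleR_2 by simp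
    then show ?thesis using growth_triangle[OF T', of k "T 0 v + c *\<^sub>R u" "(-1) *\<^sub>R (T 0 v - c *\<^sub>R u)"]
      by simp
  qed
  moreover have "?G (2 *\<^sub>R (c *\<^sub>R u)) = 2 * (c * ?G u)"
    using growth_scale[OF T', of 2 k "c *\<^sub>R u"] growth_scale[OF T' c, of k u]
      by (simp del: scaleR_scaleR)
  ultimately have "c * ?G u \<le> growth \<epsilon> T (Suc k) v" by linarith
  then have "\<epsilon> * norm v * ?G u \<le> K * norm u * growth \<epsilon> T (Suc k) v"
    using False K by (simp add: c_def field_simps del: growth.simps)
  then show ?thesis using eps by (simp add: field_simps del: growth.simps)
qed

text \<open>The factor K / \<epsilon> is that of \<open>growth_next\<close>; the other one bounds a
  perturbed step \<open>P (T 0 u)\<close>.\<close>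

definition distortion :: real where "distortion = K / \<epsilon> * ((1 + \<epsilon>) * K)"

lemma distortion: "1 \<le> distortion" "1 \<le> K / \<epsilon>"
proof -
  show *: "1 \<le> K / \<epsilon>" using eps K by simp
  have "1 * 1 \<le> (1 + \<epsilon>) * K" using eps K by (intro mult_mono) auto
  then have "1 * 1 \<le> K / \<epsilon> * ((1 + \<epsilon>) * K)" using * by (intro mult_mono) auto
  then show "1 \<le> distortion" by (simp add: distortion_def)
qed

text \<open>Every perturbed image of \<open>u\<close> after one step is compared with
  \<open>v\<close> by \<open>growth_next\<close>, and the supremum over the perturbations returns to
  time 0. So the adapted norm is a multiple of the Euclidean one up to the factor
  \<open>distortion\<close>; nothing is said about the multiple.\<close>

lemma growth_eccentricity:
  assumes T: "cocycle K T"
  shows "growth \<epsilon> T k u * norm v \<le> distortion * norm u * growth \<epsilon> T k v"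
proof (cases k)
  case 0
  have "1 * (norm u * norm v) \<le> distortion * (norm u * norm v)"
    using distortion by (intro mult_right_mono) auto
  then show ?thesis using 0 by (simp add: mult_ac)
next
  case (Suc m)
  show ?thesis
  proof (cases "v = 0")
    case True
    then show ?thesis using growth_zero[OF T] by simp
  next
    case False
    have "growth \<epsilon> T (Suc m) u \<le> distortion * norm u * growth \<epsilon> T (Suc m) v / norm v"
    proof (rule growth_Suc_le)
      fix P assume P: "P \<in> cball (id_blinfun :: 'a \<Rightarrow>\<^sub>L 'a) \<epsilon>"
      have "growth \<epsilon> (\<lambda>j. T (Suc j)) m (P (T 0 u)) * norm v \<le> (K / \<epsilon>) * norm (P (T 0 u)) * growth \<epsilon> T (Suc m) v"
        by (rule growth_next[OF T])
      also have "\<dots> \<le> (K / \<epsilon>) * ((1 + \<epsilon>) * (K * norm u)) * growth \<epsilon> T (Suc m) v"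
        using eps K by (intro mult_right_mono mult_left_mono cocycle_step[OF T P] growth_bounds[OF T]) auto
      finally show "growth \<epsilon> (\<lambda>j. T (Suc j)) m (P (T 0 u)) \<le> distortion * norm u * growth \<epsilon> T (Suc m) v / norm v"
        using False by (subst pos_le_divide_eq) (simp_all add: distortion_def mult_ac del: growth.simps)
    qed
    then show ?thesis using False Suc by (simp add: field_simps del: growth.simps)
  qed
qed

lemma growth_le_pert_prod:
  assumes "\<And>P. (\<And>j. P j \<in> cball id_blinfun \<epsilon>) \<Longrightarrow> norm (pert_prod P T k v) \<le> b"
  shows "growth \<epsilon> T k v \<le> b"
  using assms
proof (induction k arbitrary: T v)
  case 0
  from 0[of "\<lambda>_. id_blinfun"] show ?case using eps by simp
next
  case (Suc k)
  show ?case
  proof (rule growth_Suc_le, rule Suc.IH)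
    fix P and P' :: "nat \<Rightarrow> 'a \<Rightarrow>\<^sub>L 'a" assume P: "P \<in> cball (id_blinfun :: 'a \<Rightarrow>\<^sub>L 'a) \<epsilon>" and P':
      "\<And>j. P' j \<in> cball (id_blinfun :: 'a \<Rightarrow>\<^sub>L 'a) \<epsilon>"
    \<comment> \<open>Prefixing the perturbation of the first step to the later ones turns the
      nested suprema into one over sequences.\<close>
    have "norm (pert_prod (\<lambda>j. case j of 0 \<Rightarrow> P | Suc m \<Rightarrow> P' m) T (Suc k) v) \<le> b"
      by (rule Suc.prems) (use P P' in \<open>auto split: nat.split\<close>)
    then show "norm (pert_prod P' (\<lambda>j. T (Suc j)) k (P (T 0 v))) \<le> b" by simp
  qed
qed

text \<open>A Pliss type argument: at the minimiser \<open>i\<close> of growth times \<open>\<theta>\<^sup>i\<close> the growth is at most \<open>b \<theta>\<^sup>-\<^sup>i\<close>; as it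
  increases at most by the factor \<open>K / \<epsilon>\<close> per unit of time and is 1 at time \<open>n\<close>, \<open>n - i\<close> is large.\<close>

lemma hyperbolic_time:
  fixes b \<theta> :: real and L :: nat
  assumes "1 < \<theta>"
  obtains N where "\<And>(T :: nat \<Rightarrow> 'b::euclidean_space \<Rightarrow>\<^sub>L 'b) e n. \<lbrakk>cocycle K T; norm e = 1; growth \<epsilon> T n e \<le> b; N \<le> n\<rbrakk> \<Longrightarrow>
    \<exists>i\<le>n. L \<le> n - i \<and> (\<forall>k\<le>n - i. growth \<epsilon> (\<lambda>j. T (i + j)) (n - i) e
       \<le> growth \<epsilon> (\<lambda>j. T (i + k + j)) (n - i - k) e * \<theta> ^ k)"
proof -
  \<comment> \<open>If n - i were less than L, the bound for \<theta>^n obtained below would stay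
    under \<theta>^N. The maximum with 1 keeps that bound positive whatever \<open>b\<close>
    is.\<close>
  obtain N where N: "max 1 b * (\<theta> * (K / \<epsilon>)) ^ L < \<theta> ^ N" using real_arch_pow[OF assms] by blast
  show ?thesis
  proof (rule that[of N])
    fix T :: "nat \<Rightarrow> 'b \<Rightarrow>\<^sub>L 'b" and e :: 'b and n
    assume T: "cocycle K T" and e: "norm e = 1" and b: "growth \<epsilon> T n e \<le> b" and n: "N \<le> n"
    define \<mu> where "\<mu> i = growth \<epsilon> (\<lambda>j. T (i + j)) (n - i) e" for i
    obtain i where i: "i \<in> {..n}" "\<And>j. j \<in> {..n} \<Longrightarrow> \<mu> i * \<theta> ^ i \<le> \<mu> j * \<theta> ^ j"
      using ex_min_if_finite[of "(\<lambda>i. \<mu> i * \<theta> ^ i) ` {..n}"] by (auto simp: not_less) 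
    have step: "\<mu> (Suc j) \<le> K / \<epsilon> * \<mu> j" if "j < n" for j
    proof -
      define m where "m = n - Suc j"
      have m: "n - j = Suc m" using that by (simp add: m_def)
      then have m': "n - Suc j = m" by simp
      show ?thesis using growth_next[OF cocycle_shift[OF T, of j], of m e e] e unfolding \<mu>_def m m'
        by simp
    qed
    have up: "\<mu> (i + k) \<le> (K / \<epsilon>) ^ k * \<mu> i" if "i + k \<le> n" for k
      using that
    proof (induction k)
      case (Suc k)
      have "\<mu> (i + Suc k) \<le> K / \<epsilon> * \<mu> (i + k)" using step[of "i + k"] Suc.prems by simp
      also have "\<dots> \<le> K / \<epsilon> * ((K / \<epsilon>) ^ k * \<mu> i)"
        using Suc eps K by (intro mult_left_mono) auto
      finally show ?case by (simp add: mult_ac)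
    qed simp
    have "\<mu> i * \<theta> ^ i \<le> \<mu> 0" using i(2)[of 0] by simp
    also have "\<dots> \<le> max 1 b" using b by (simp add: \<mu>_def)
    finally have mi: "\<mu> i * \<theta> ^ i \<le> max 1 b" .
    have "1 = \<mu> n" using e by (simp add: \<mu>_def)
    also have "\<dots> \<le> (K / \<epsilon>) ^ (n - i) * \<mu> i" using up[of "n - i"] i(1) by simp
    finally have "1 * \<theta> ^ i \<le> (K / \<epsilon>) ^ (n - i) * \<mu> i * \<theta> ^ i" using assms
      by (intro mult_right_mono) auto
    also have "\<dots> = (K / \<epsilon>) ^ (n - i) * (\<mu> i * \<theta> ^ i)" by simp
    also have "\<dots> \<le> (K / \<epsilon>) ^ (n - i) * max 1 b" using mi eps K by (intro mult_left_mono) auto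
    finally have "\<theta> ^ i * \<theta> ^ (n - i) \<le> (K / \<epsilon>) ^ (n - i) * max 1 b * \<theta> ^ (n - i)"
      using assms by (intro mult_right_mono) auto
    then have tn: "\<theta> ^ n \<le> max 1 b * (\<theta> * (K / \<epsilon>)) ^ (n - i)"
      using i(1) by (simp add: power_add[symmetric] power_mult_distrib power_divide mult_ac)
    have L: "L \<le> n - i"
    proof (rule ccontr)
      assume "\<not> L \<le> n - i"
      moreover have "1 * 1 \<le> \<theta> * (K / \<epsilon>)" using assms distortion by (intro mult_mono) auto
      ultimately have "(\<theta> * (K / \<epsilon>)) ^ (n - i) \<le> (\<theta> * (K / \<epsilon>)) ^ L" by (intro power_increasing) auto
      then have "max 1 b * (\<theta> * (K / \<epsilon>)) ^ (n - i) \<le> max 1 b * (\<theta> * (K / \<epsilon>)) ^ L"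
        by (intro mult_left_mono) auto
      moreover have "\<theta> ^ N \<le> \<theta> ^ n" using n assms by (intro power_increasing) auto
      ultimately show False using tn N by linarith
    qed
    show "\<exists>i\<le>n. L \<le> n - i \<and> (\<forall>k\<le>n - i. growth \<epsilon> (\<lambda>j. T (i + j)) (n - i) e
       \<le> growth \<epsilon> (\<lambda>j. T (i + k + j)) (n - i - k) e * \<theta> ^ k)"
    proof (intro exI[of _ i] conjI allI impI)
      \<comment> \<open>Minimality of i, compared with i + k: from time i on, the scale of the
        adapted norm drops by at most the factor \<theta> per step on average.\<close>
      fix k assume k: "k \<le> n - i"
      have "\<mu> i * \<theta> ^ i \<le> (\<mu> (i + k) * \<theta> ^ k) * \<theta> ^ i"
        using i(2)[of "i + k"] k i(1) by (simp add: power_add mult_ac)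
      then have "\<mu> i \<le> \<mu> (i + k) * \<theta> ^ k" using assms by simp
      then show "growth \<epsilon> (\<lambda>j. T (i + j)) (n - i) e \<le> growth \<epsilon> (\<lambda>j. T (i + k + j)) (n - i - k) e * \<theta> ^ k"
        by (simp add: \<mu>_def)
    qed (use i L in auto)
  qed
qed

section \<open>Contraction of pseudo-orbits from a selected time on\<close>

lemma growth_pos:
  assumes T: "cocycle K T" and "v \<noteq> 0" shows "0 < growth \<epsilon> T k v"
  using assms
proof (induction k arbitrary: T)
  case (Suc k)
  have "0 < growth \<epsilon> (\<lambda>j. T (Suc j)) k v * norm v"
    using Suc.IH[OF cocycle_Suc[OF Suc.prems(1)] Suc.prems(2)] Suc.prems(2) by simp
  also have "\<dots> \<le> (K / \<epsilon>) * norm v * growth \<epsilon> T (Suc k) v" by (rule growth_next[OF Suc.prems(1)])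
  finally have "0 < K / \<epsilon> * norm v * growth \<epsilon> T (Suc k) v" .
  moreover have "0 < K / \<epsilon> * norm v" using eps K Suc.prems(2) by simp
  ultimately show ?case using zero_less_mult_pos by blast
qed simp

text \<open>In the adapted norm \<open>G k\<close> a step costs 1 / (1 + \<epsilon>), plus K /
  \<epsilon> * \<delta> for the error by \<open>growth_next\<close>, together at most \<sigma>. The
  unit vector \<open>e\<close> is the yardstick for the scale: each passage between \<open>G\<close>
  and the Euclidean norm costs one \<open>distortion\<close>, and \<open>hyp\<close> exchanges the
  scale at time 0 for that at time \<open>l\<close> at the price \<theta>^l.\<close>

lemma nonlinear_contraction:
  fixes T :: "nat \<Rightarrow> 'b::euclidean_space \<Rightarrow>\<^sub>L 'b" and w :: "nat \<Rightarrow> 'b"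
  assumes T: "cocycle K T" and e: "norm e = 1" and \<theta>: "0 < \<theta>" and \<delta>: "0 \<le> \<delta>"
    and \<sigma>: "1 / (1 + \<epsilon>) + K / \<epsilon> * \<delta> \<le> \<sigma>"
    and hyp: "\<And>k. k \<le> m \<Longrightarrow> growth \<epsilon> T m e \<le> growth \<epsilon> (\<lambda>j. T (k + j)) (m - k) e * \<theta> ^ k"
    and near: "\<And>k. k < l \<Longrightarrow> norm (w (Suc k) - T k (w k)) \<le> \<delta> * norm (w k)" and l: "l \<le> m"
  shows "norm (w l) \<le> distortion\<^sup>2 * (\<sigma> * \<theta>) ^ l * norm (w 0)"
proof -
  define G where "G k = growth \<epsilon> (\<lambda>j. T (k + j)) (m - k)" for k
  have s0: "0 < \<sigma>"
  proof -
    have "0 < 1 / (1 + \<epsilon>)" "0 \<le> K / \<epsilon> * \<delta>" using eps K \<delta> by auto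
    then show ?thesis using \<sigma> by linarith
  qed
  have Gs: "G (Suc k) (w (Suc k)) \<le> \<sigma> * G k (w k)" if "k < l" for k
  proof -
    define T' where "T' j = T (k + j)" for j
    have T': "cocycle K T'" unfolding T'_def by (rule cocycle_shift[OF T])
    define r where "r = m - Suc k"
    have r: "m - k = Suc r" using that l by (simp add: r_def)
    then have r': "m - Suc k = r" by simp
    have G1: "G k = growth \<epsilon> T' (Suc r)" unfolding G_def r T'_def ..
    have G2: "G (Suc k) = growth \<epsilon> (\<lambda>j. T' (Suc j)) r" unfolding G_def r' T'_def by simp
    have T0: "T' 0 = T k" by (simp add: T'_def)
    show ?thesis
    proof (cases "w k = 0")
      case True
      then have "w (Suc k) = 0" using near[OF that] by (simp add: blinfun.zero_right)
      then show ?thesis using True growth_zero[OF T', of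
        "Suc r"] growth_zero[OF cocycle_Suc[OF T'], of r]
        by (simp add: G1 G2 del: growth.simps)
    next
      case False
      let ?u = "w (Suc k) - T k (w k)"
      have "G (Suc k) (T k (w k) + ?u) \<le> G (Suc k) (T k (w k)) + G (Suc k) ?u"
        unfolding G2 by (rule growth_triangle[OF cocycle_Suc[OF T']])
      moreover have "(1 + \<epsilon>) * G (Suc k) (T k (w k)) \<le> G k (w k)"
        using growth_contract[OF T', of r "w k"] by (simp add: G1 G2 T0 del: growth.simps)
      then have "G (Suc k) (T k (w k)) \<le> 1 / (1 + \<epsilon>) * G k (w k)" using eps by (simp add: field_simps)
      moreover have "G (Suc k) ?u \<le> K / \<epsilon> * \<delta> * G k (w k)"
      proof -
        have "G (Suc k) ?u * norm (w k) \<le> K / \<epsilon> * norm ?u * G k (w k)"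
          unfolding G1 G2 by (rule growth_next[OF T'])
        also have "\<dots> \<le> K / \<epsilon> * (\<delta> * norm (w k)) * G k (w k)"
          unfolding G1 using near[OF that] eps K
            by (intro mult_right_mono mult_left_mono growth_bounds[OF T']) auto
        finally have "G (Suc k) ?u * norm (w k) \<le> (K / \<epsilon> * \<delta> * G k (w k)) * norm (w k)"
          by (simp add: mult_ac)
        then show ?thesis by (rule mult_right_le_imp_le) (use False in simp)
      qed
      ultimately have "G (Suc k) (w (Suc k)) \<le> (1 / (1 + \<epsilon>) + K / \<epsilon> * \<delta>) * G k (w k)"
        by (simp add: distrib_right)
      also have "\<dots> \<le> \<sigma> * G k (w k)" unfolding G1 by (intro mult_right_mono \<sigma> growth_bounds[OF T'])
      finally show ?thesis .
    qed
  qed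
  have Gl: "G k (w k) \<le> \<sigma> ^ k * G 0 (w 0)" if "k \<le> l" for k
    using that
  proof (induction k)
    case (Suc k)
    have "G (Suc k) (w (Suc k)) \<le> \<sigma> * G k (w k)" using Gs Suc.prems by simp
    also have "\<dots> \<le> \<sigma> * (\<sigma> ^ k * G 0 (w 0))" using Suc s0 by (intro mult_left_mono) auto
    finally show ?case by (simp add: mult_ac)
  qed simp
  have e0: "e \<noteq> 0" using e by auto
  have Tl: "cocycle K (\<lambda>j. T (l + j))" and T0: "cocycle K (\<lambda>j. T (0 + j))" by (rule cocycle_shift[OF T])+
  have pos: "0 < G l e" unfolding G_def by (rule growth_pos[OF Tl e0])
  have "G l e * norm (w l) \<le> distortion * G l (w l)"
    using growth_eccentricity[OF Tl, of "m - l" e "w l"] e by (simp add: G_def)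
  also have "\<dots> \<le> distortion * (\<sigma> ^ l * G 0 (w 0))"
    using Gl[of l] distortion by (intro mult_left_mono) auto
  also have "\<dots> \<le> distortion * (\<sigma> ^ l * (distortion * norm (w 0) * G 0 e))"
    using growth_eccentricity[OF T0, of m "w 0" e] e distortion s0
    by (intro mult_left_mono) (auto simp: G_def)
  also have "\<dots> \<le> distortion * (\<sigma> ^ l * (distortion * norm (w 0) * (G l e * \<theta> ^ l)))"
    using hyp[OF l] distortion s0 by (intro mult_left_mono) (auto simp: G_def)
  also have "\<dots> = G l e * (distortion\<^sup>2 * (\<sigma> * \<theta>) ^ l * norm (w 0))"
    by (simp add: power2_eq_square power_mult_distrib mult_ac)
  finally show ?thesis by (rule mult_left_le_imp_le[OF _ pos])
qed

end

text \<open>The order of quantifiers matters: \<delta>, Q and \<kappa> depend on \<epsilon> and K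
  only, while b and L enter through N. This later gives discs of one radius at all selected
  times.\<close>

lemma robustly_bounded_cocycle:
  fixes \<epsilon> K :: real
  assumes "0 < \<epsilon>" "\<epsilon> \<le> 1" "1 \<le> K"
  obtains \<delta> Q \<kappa> :: real where "0 < \<delta>" "1 \<le> Q" "0 < \<kappa>" "\<kappa> < 1"
    "\<And>b L. \<exists>N. \<forall>(T :: nat \<Rightarrow> 'b::euclidean_space \<Rightarrow>\<^sub>L 'b) n. cocycle K T \<and> robustly_bounded \<epsilon> T n b \<and> N \<le> n \<longrightarrow>
       (\<exists>i\<le>n. L \<le> n - i \<and> contracts_near \<delta> Q \<kappa> (\<lambda>k. T (i + k)) (n - i))"
proof -
  interpret bounded_cocycle \<epsilon> K by unfold_locales (use assms in auto)
  \<comment> \<open>\<sigma> lies strictly between 1 / (1 + \<epsilon>) and 1, \<theta> strictly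
    between 1 and 1 / \<sigma>, and \<delta> spends exactly the gap \<sigma> - 1 / (1 + \<epsilon>)
    on the errors.\<close>
  define \<sigma> \<theta> where "\<sigma> = 1 / (1 + \<epsilon> / 2)" and "\<theta> = 1 + \<epsilon> / 4"
  define \<delta> where "\<delta> = \<epsilon> / K * (\<sigma> - 1 / (1 + \<epsilon>))"
  have "1 / (1 + \<epsilon>) < \<sigma>" using assms by (simp add: \<sigma>_def frac_less2)
  then have d0: "0 < \<delta>" using assms by (simp add: \<delta>_def)
  have sig: "1 / (1 + \<epsilon>) + K / \<epsilon> * \<delta> \<le> \<sigma>" using assms by (simp add: \<delta>_def)
  have lam: "0 < \<sigma> * \<theta>" "\<sigma> * \<theta> < 1" using assms by (auto simp: \<sigma>_def \<theta>_def field_simps)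
  have th: "1 < \<theta>" "0 < \<theta>" using assms by (auto simp: \<theta>_def)
  obtain e :: 'b where e: "norm e = 1" using norm_Basis SOME_Basis by blast
  show ?thesis
  proof (rule that[OF d0 _ lam, of "distortion\<^sup>2"])
    show "1 \<le> distortion\<^sup>2" using distortion by simp
    fix b :: real and L :: nat
    obtain N where N:
      "\<And>(T :: nat \<Rightarrow> 'b::euclidean_space \<Rightarrow>\<^sub>L 'b) e n. \<lbrakk>cocycle K T; norm e = 1; growth \<epsilon> T n e \<le> b; N \<le> n\<rbrakk> \<Longrightarrow>
      \<exists>i\<le>n. L \<le> n - i \<and> (\<forall>k\<le>n - i. growth \<epsilon> (\<lambda>j. T (i + j)) (n - i) e
       \<le> growth \<epsilon> (\<lambda>j. T (i + k + j)) (n - i - k) e * \<theta> ^ k)"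
      using hyperbolic_time[OF th(1), of b L] by metis
    have "\<exists>i\<le>n. L \<le> n - i \<and> contracts_near \<delta> (distortion\<^sup>2) (\<sigma> * \<theta>) (\<lambda>k. T (i + k)) (n - i)"
      if coc: "cocycle K T" and P: "robustly_bounded \<epsilon> T n b" and n: "N \<le> n" for T ::
        "nat \<Rightarrow> 'b \<Rightarrow>\<^sub>L 'b" and n
    proof -
      have "growth \<epsilon> T n e \<le> b"
      proof (rule growth_le_pert_prod)
        fix P :: "nat \<Rightarrow> 'b \<Rightarrow>\<^sub>L 'b" assume "\<And>j. P j \<in> cball id_blinfun \<epsilon>"
        then have "norm (pert_prod P T n) \<le> b" using P unfolding robustly_bounded_def by blast
        then show "norm (pert_prod P T n e) \<le> b" using norm_blinfun[of "pert_prod P T n" e] e by simp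
      qed
      from N[OF coc e this n] obtain i where i: "i \<le> n" "L \<le> n - i"
        "\<And>k. k \<le> n - i \<Longrightarrow> growth \<epsilon> (\<lambda>j. T (i + j)) (n - i) e \<le> growth \<epsilon> (\<lambda>j. T (i + k + j)) (n - i - k) e * \<theta> ^ k"
        by blast
      have "norm (w l) \<le> distortion\<^sup>2 * (\<sigma> * \<theta>) ^ l * norm (w 0)"
        if "l \<le> n - i" "\<forall>k<l. norm (w (Suc k) - blinfun_apply (T (i + k)) (w k)) \<le> \<delta> * norm (w k)"
          for w l
        by (rule nonlinear_contraction[OF cocycle_shift[OF coc, of i] e th(2) less_imp_le[OF d0] sig, of
          "n - i"])
           (use i that in \<open>auto simp: add.assoc\<close>)
      then show ?thesis using i unfolding contracts_near_def by blast
    qed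
    then show "\<exists>N. \<forall>(T :: nat \<Rightarrow> 'b \<Rightarrow>\<^sub>L 'b) n. cocycle K T \<and> robustly_bounded \<epsilon> T n b \<and> N \<le> n \<longrightarrow>
       (\<exists>i\<le>n. L \<le> n - i \<and> contracts_near \<delta> (distortion\<^sup>2) (\<sigma> * \<theta>) (\<lambda>k. T (i + k)) (n - i))" by blast
  qed
qed

subsection \<open>Nonwandering points in shrinking open sets\<close>

lemma nonwandering_returns:
  assumes "x \<in> nonwandering_set f" "open U" "x \<in> U"
  obtains n y where "1 \<le> n" "y \<in> U" "(f ^^ n) y \<in> U"
proof -
  have "U \<inter> (\<Union>n\<in>{1::nat..}. (f ^^ n) ` U) \<noteq> {}"
    using assms unfolding nonwandering_set_def wandering_def by (auto simp: interior_open)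
  then show ?thesis using that by fastforce
qed

lemma continuous_funpow:
  fixes f :: "'a::topological_space \<Rightarrow> 'a"
  assumes "continuous_on UNIV f" shows "continuous_on UNIV (f ^^ n)"
proof (induction n)
  case (Suc n)
  then show ?case using continuous_on_compose[of UNIV "f ^^ n" f] assms continuous_on_subset by auto
qed (simp add: id_def)

lemma nonwandering_funpow:
  fixes f :: "'a::topological_space \<Rightarrow> 'a"
  assumes cont: "continuous_on UNIV f" and x: "x \<in> nonwandering_set f"
  shows "(f ^^ m) x \<in> nonwandering_set f"
proof (rule ccontr)
  assume "(f ^^ m) x \<notin> nonwandering_set f"
  then obtain U where U: "(f ^^ m) x \<in> interior U" "U \<inter> (\<Union>n\<in>{1::nat..}. (f ^^ n) ` U) = {}"
    unfolding nonwandering_set_def wandering_def by auto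
  have "open ((f ^^ m) -` interior U)"
    using continuous_funpow[OF cont, of m] by (simp add: continuous_on_open_vimage)
  then obtain n y where y: "1 \<le> n" "(f ^^ m) y \<in> interior U" "(f ^^ m) ((f ^^ n) y) \<in> interior U"
    using nonwandering_returns[OF x, of "(f ^^ m) -` interior U"] U(1) by auto
  have "(f ^^ n) ((f ^^ m) y) = (f ^^ m) ((f ^^ n) y)"
    by (metis add.commute comp_apply funpow_add)
  then have "(f ^^ n) ((f ^^ m) y) \<in> U" "(f ^^ m) y \<in> U" using y interior_subset by auto
  then show False using U(2) y(1) by (auto simp: disjoint_iff)
qed

text \<open>A point returning to arbitrarily small neighbourhoods only within bounded time is periodic.\<close>

lemma nonwandering_late_returns:
  fixes f :: "'a::t2_space \<Rightarrow> 'a"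
  assumes cont: "continuous_on UNIV f" and x: "x \<in> nonwandering_set f" and U: "open U" "x \<in> U"
  obtains n y where "N \<le> n" "y \<in> U" "(f ^^ n) y \<in> U"
proof (cases "\<exists>m\<ge>1. (f ^^ m) x = x")
  case True
  then obtain m where m: "1 \<le> m" "(f ^^ m) x = x" by blast
  have "((f ^^ m) ^^ N) x = x" using m(2) by (induction N) auto
  then have "(f ^^ (m * N)) x = x" by (simp add: funpow_mult)
  moreover have "N \<le> m * N" using m(1) by simp
  ultimately show ?thesis using that[of "m * N" x] U(2) by simp
next
  case False
  have "\<exists>V. open V \<and> x \<in> V \<and> (\<forall>y\<in>V. (f ^^ m) y \<notin> V)" if "1 \<le> m" for m
  proof -
    have "(f ^^ m) x \<noteq> x" using False that by blast
    then obtain V W where VW: "open V" "open W" "(f ^^ m) x \<in> V" "x \<in> W" "V \<inter> W = {}"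
      by (meson hausdorff)
    have "open ((f ^^ m) -` V)"
      using continuous_funpow[OF cont, of m] VW(1) by (simp add: continuous_on_open_vimage)
    then show ?thesis using VW by (intro exI[of _ "W \<inter> (f ^^ m) -` V"]) auto
  qed
  then obtain V where V: "\<And>m. 1 \<le> m \<Longrightarrow> open (V m) \<and> x \<in> V m \<and> (\<forall>y\<in>V m. (f ^^ m) y \<notin> V m)" by metis
  \<comment> \<open>Only the finitely many times below N have to be excluded, so the intersection is
    open.\<close>
  let ?W = "U \<inter> (\<Inter>m\<in>{1..<N}. V m)"
  have "open ?W" "x \<in> ?W" using U V by (auto intro!: open_INT)
  then obtain n y where y: "1 \<le> n" "y \<in> ?W" "(f ^^ n) y \<in> ?W" using nonwandering_returns[OF x] by metis
  have "N \<le> n"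
  proof (rule ccontr)
    assume "\<not> N \<le> n"
    then have "n \<in> {1..<N}" using y(1) by simp
    then show False using y V[OF y(1)] by blast
  qed
  then show ?thesis using that y by blast
qed

text \<open>Expresses that the sets f^k(W) shrink, uniformly over the space. Open covers replace
  diameters because the type carries a topology and no metric; below, the property is tested on
  covers by two open sets.\<close>

definition eventually_small :: "('a::topological_space \<Rightarrow> 'a) \<Rightarrow> 'a set \<Rightarrow> bool" where
  "eventually_small f W \<longleftrightarrow>
     (\<forall>\<C>. (\<forall>U\<in>\<C>. open U) \<and> \<Union>\<C> = UNIV \<longrightarrow> (\<exists>N. \<forall>k\<ge>N. \<exists>U\<in>\<C>. (f ^^ k) ` W \<subseteq> U))"

lemma normal_t2_points:
  fixes x :: "'a::t2_space"
  assumes comp: "compact (UNIV :: 'a set)" and "open V" "x \<in> V"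
  obtains U where "open U" "x \<in> U" "closure U \<subseteq> V"
proof -
  have "compact (- V)" using compact_Int_closed[OF comp, of "- V"] assms(2) by (simp add: closed_Compl)
  moreover have "Hausdorff_space (euclidean :: 'a topology)"
    unfolding Hausdorff_space_def disjnt_def using hausdorff by fastforce
  moreover have "disjnt {x} (- V)" using assms(3) by (simp add: disjnt_def)
  ultimately obtain U W where "openin euclidean U" "openin euclidean W" "{x} \<subseteq> U" "- V \<subseteq> W" "disjnt U W"
    using Hausdorff_space_compact_separation[of euclidean "{x}" "- V"]
      by (metis compactin_euclidean_iff finite.emptyI finite_imp_compact finite_insert)
  then have U: "open U" "open W" "x \<in> U" "- V \<subseteq> W" "U \<inter> W = {}"
    by (auto simp: disjnt_def)
  have "closure U \<subseteq> - W" using U by (intro closure_minimal) (auto simp: closed_Compl)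
  then show ?thesis using that[OF U(1,3)] U(4) by blast
qed

text \<open>The test cover consists of V and the complement of a smaller closed neighbourhood of x.
  A late return puts a point of f^n(W) into the smaller neighbourhood, which leaves only V.\<close>

lemma eventually_small_nonwandering:
  fixes f :: "'a::t2_space \<Rightarrow> 'a"
  assumes comp: "compact (UNIV :: 'a set)" and cont: "continuous_on UNIV f"
    and W: "open W" "eventually_small f W" and x: "x \<in> W" "x \<in> nonwandering_set f" and V: "open V"
      "x \<in> V"
  obtains n where "N \<le> n" "(f ^^ n) ` W \<subseteq> V"
proof -
  obtain U where U: "open U" "x \<in> U" "closure U \<subseteq> V \<inter> W"
    using normal_t2_points[OF comp, of "V \<inter> W" x] V W x by auto
  have "\<exists>N. \<forall>k\<ge>N. \<exists>U'\<in>{V, - closure U}. (f ^^ k) ` W \<subseteq> U'"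
    using W(2) unfolding eventually_small_def
    by (elim allE[of _ "{V, - closure U}"]) (use V U in auto)
  then obtain M where M: "\<And>k. M \<le> k \<Longrightarrow> (f ^^ k) ` W \<subseteq> V \<or> (f ^^ k) ` W \<subseteq> - closure U" by auto
  obtain n y where y: "max N M \<le> n" "y \<in> U" "(f ^^ n) y \<in> U"
    using nonwandering_late_returns[OF cont x(2) U(1,2)] by metis
  have "y \<in> W" using y U closure_subset by blast
  moreover have "(f ^^ n) y \<in> closure U" using y closure_subset by blast
  ultimately have "(f ^^ n) ` W \<subseteq> V" using M[of n] y(1) by auto
  moreover have "N \<le> n" using y(1) by simp
  ultimately show ?thesis using that by blast
qed

text \<open>Distinct points have disjoint closed neighbourhoods, whose complements cover the space;
  a set with both points in its closure lies in neither complement.\<close>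

lemma eventually_small_closure:
  fixes f :: "'a::t2_space \<Rightarrow> 'a"
  assumes comp: "compact (UNIV :: 'a set)" and W: "eventually_small f W"
    and x: "\<And>N. \<exists>k\<ge>N. x \<in> closure ((f ^^ k) ` W) \<and> y \<in> closure ((f ^^ k) ` W)"
  shows "x = y"
proof (rule ccontr)
  assume "x \<noteq> y"
  then obtain U0 V0 where 0: "open U0" "open V0" "x \<in> U0" "y \<in> V0" "U0 \<inter> V0 = {}" by (meson hausdorff)
  obtain U where U: "open U" "x \<in> U" "closure U \<subseteq> U0" using normal_t2_points[OF comp 0(1,3)] .
  obtain V where V: "open V" "y \<in> V" "closure V \<subseteq> V0" using normal_t2_points[OF comp 0(2,4)] .
  have "\<exists>N. \<forall>k\<ge>N. \<exists>U'\<in>{- closure U, - closure V}. (f ^^ k) ` W \<subseteq> U'"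
    using W unfolding eventually_small_def
    by (elim allE[of _ "{- closure U, - closure V}"]) (use 0 U V in auto)
  then obtain N where N: "\<And>k. N \<le> k \<Longrightarrow> (f ^^ k) ` W \<subseteq> - closure U \<or> (f ^^ k) ` W \<subseteq> - closure V" by auto
  obtain k where k: "N \<le> k" "x \<in> closure ((f ^^ k) ` W)" "y \<in> closure ((f ^^ k) ` W)" using x by blast
  have "U \<inter> closure ((f ^^ k) ` W) \<noteq> {}" "V \<inter> closure ((f ^^ k) ` W) \<noteq> {}"
    using k(2,3) U(2) V(2) by blast+
  then have "U \<inter> (f ^^ k) ` W \<noteq> {}" "V \<inter> (f ^^ k) ` W \<noteq> {}"
    using open_Int_closure_eq_empty[OF U(1)] open_Int_closure_eq_empty[OF V(1)] by simp_all
  then show False using N[OF k(1)] closure_subset[of U] closure_subset[of V] by blast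
qed

text \<open>If \<open>f\<^sup>n(W) \<subseteq> W\<close>, then for each residue \<open>r\<close> modulo \<open>n\<close> the sets \<open>f\<^sup>k\<^sup>n\<^sup>+\<^sup>r(W)\<close> decrease to at most
  one point, and every nonwandering point of \<open>W\<close> arises in this way.\<close>

lemma eventually_small_finite:
  fixes f :: "'a::t2_space \<Rightarrow> 'a"
  assumes comp: "compact (UNIV :: 'a set)" and cont: "continuous_on UNIV f"
    and W: "open W" "eventually_small f W"
  shows "finite (W \<inter> nonwandering_set f)"
    and "x \<in> W \<inter> nonwandering_set f \<Longrightarrow> \<exists>n\<ge>1. (f ^^ n) ` W \<subseteq> W"
proof -
  show self: "\<exists>n\<ge>1. (f ^^ n) ` W \<subseteq> W" if "x \<in> W \<inter> nonwandering_set f" for x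
    using eventually_small_nonwandering[OF comp cont W, of x W 1] that W(1) by (metis IntD1 IntD2)
  show "finite (W \<inter> nonwandering_set f)"
  proof (cases "W \<inter> nonwandering_set f = {}")
    case False
    then obtain n where n: "1 \<le> n" "(f ^^ n) ` W \<subseteq> W" using self by blast
    have dec: "(f ^^ (r + n * l)) ` W \<subseteq> (f ^^ (r + n * k)) ` W" if "k \<le> l" for r k l
      using that
    proof (induction l rule: dec_induct)
      case (step l)
      have "f ^^ (r + n * Suc l) = f ^^ (r + n * l) \<circ> f ^^ n" by (simp add: funpow_add[symmetric] add_ac)
      then have "(f ^^ (r + n * Suc l)) ` W \<subseteq> (f ^^ (r + n * l)) ` W" using n(2)
        by (auto simp: image_comp[symmetric])
      then show ?case using step.IH by blast
    qed simp
    define Z where "Z r = (\<Inter>k. closure ((f ^^ (r + n * k)) ` W))" for r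
    have Z1: "x = y" if "x \<in> Z r" "y \<in> Z r" for x y r
    proof (rule eventually_small_closure[OF comp W(2)])
      fix N
      have "N \<le> r + n * N" using n(1) by (simp add: trans_le_add2)
      then show "\<exists>k\<ge>N. x \<in> closure ((f ^^ k) ` W) \<and> y \<in> closure ((f ^^ k) ` W)"
        using that unfolding Z_def by blast
    qed
    have "W \<inter> nonwandering_set f \<subseteq> (\<Union>r<n. Z r)"
    proof
      fix x assume x: "x \<in> W \<inter> nonwandering_set f"
      show "x \<in> (\<Union>r<n. Z r)"
      proof (rule ccontr)
        assume "x \<notin> (\<Union>r<n. Z r)"
        then have "\<forall>r. \<exists>k. r < n \<longrightarrow> x \<notin> closure ((f ^^ (r + n * k)) ` W)" unfolding Z_def by blast
        then obtain \<kappa> where \<kappa>: "\<And>r. r < n \<Longrightarrow> x \<notin> closure ((f ^^ (r + n * \<kappa> r)) ` W)" by metis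
        \<comment> \<open>From time n * (M + 1) on, the quotient by n exceeds every \<kappa> r at
          once, whatever the residue.\<close>
        define M where "M = Max (\<kappa> ` {..<n})"
        have M: "\<kappa> r \<le> M" if "r < n" for r using that by (simp add: M_def)
        define V where "V = (\<Inter>r\<in>{..<n}. - closure ((f ^^ (r + n * \<kappa> r)) ` W))"
        have "open V" "x \<in> V" unfolding V_def using \<kappa> by (auto intro!: open_INT)
        then obtain m where m: "n * (M + 1) \<le> m" "(f ^^ m) ` W \<subseteq> V"
          using eventually_small_nonwandering[OF comp cont W, of x V "n * (M + 1)"] x by blast
        let ?r = "m mod n"
        have r: "?r < n" using n(1) by simp
        have "M + 1 \<le> m div n" using m(1) n(1) by (simp add: less_eq_div_iff_mult_less_eq mult.commute)
        then have "\<kappa> ?r \<le> m div n" using M[OF r] by simp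
        then have "(f ^^ (?r + n * (m div n))) ` W \<subseteq> (f ^^ (?r + n * \<kappa> ?r)) ` W" by (rule dec)
        moreover have "?r + n * (m div n) = m" by simp
        ultimately have "(f ^^ m) ` W \<subseteq> closure ((f ^^ (?r + n * \<kappa> ?r)) ` W)" using closure_subset
          by fastforce
        moreover have "(f ^^ m) ` W \<subseteq> - closure ((f ^^ (?r + n * \<kappa> ?r)) ` W)" using m(2) r
          unfolding V_def by blast
        \<comment> \<open>The set f^m(W) is nonempty because x lies in W.\<close>
        ultimately show False using x by blast
      qed
    qed
    moreover have "finite (Z r)" for r
    proof (cases "Z r = {}")
      case False
      then obtain z where "z \<in> Z r" by blast
      then have "Z r \<subseteq> {z}" using Z1 by blast
      then show ?thesis by (rule finite_subset) simp
    qed simp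
    ultimately show ?thesis by (meson finite_UN finite_lessThan finite_subset)
  qed simp
qed

text \<open>Multiples of a return time of W keep x among the finitely many nonwandering points of W,
  so two iterates agree, and injectivity cancels their common part.\<close>

lemma eventually_small_periodic:
  fixes f :: "'a::t2_space \<Rightarrow> 'a"
  assumes comp: "compact (UNIV :: 'a set)" and cont: "continuous_on UNIV f" and inj: "inj f"
    and W: "open W" "eventually_small f W" and x: "x \<in> W \<inter> nonwandering_set f"
  shows "\<exists>m\<ge>1. (f ^^ m) x = x"
proof -
  let ?F = "W \<inter> nonwandering_set f"
  obtain n where n: "1 \<le> n" "(f ^^ n) ` W \<subseteq> W" using eventually_small_finite(2)[OF comp cont W x]
    by blast
  have maps: "(f ^^ (n * k)) x \<in> ?F" for k
  proof (induction k)
    case (Suc k)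
    have "(f ^^ (n * Suc k)) x = (f ^^ n) ((f ^^ (n * k)) x)" by (simp add: funpow_add)
    then show ?case using Suc n(2) nonwandering_funpow[OF cont] by auto
  qed (use x in simp)
  have "\<not> inj (\<lambda>k. (f ^^ (n * k)) x)"
  proof
    assume "inj (\<lambda>k. (f ^^ (n * k)) x)"
    then have "infinite (range (\<lambda>k. (f ^^ (n * k)) x))" using range_inj_infinite by blast
    moreover have "range (\<lambda>k. (f ^^ (n * k)) x) \<subseteq> ?F" using maps by blast
    ultimately show False using eventually_small_finite(1)[OF comp cont W] finite_subset by blast
  qed
  then obtain k l where "(f ^^ (n * k)) x = (f ^^ (n * l)) x" "k \<noteq> l" unfolding inj_def by blast
  then obtain k l where kl: "(f ^^ (n * k)) x = (f ^^ (n * l)) x" "k < l" by (metis linorder_neqE_nat)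
  have "n * l = n * k + n * (l - k)" using kl(2) by (simp add: distrib_left[symmetric])
  then have "(f ^^ (n * k)) ((f ^^ (n * (l - k))) x) = (f ^^ (n * k)) x"
    using kl(1) by (simp add: funpow_add)
  then have "(f ^^ (n * (l - k))) x = x" using inj_fn[OF inj, of "n * k"] by (simp add: inj_eq)
  moreover have "1 \<le> n * (l - k)" using n(1) kl(2) by simp
  ultimately show ?thesis by blast
qed

text \<open>Both p and the forward iterate of x by m * i - i are mapped to x by f^i, so injectivity
  identifies them; reducing the exponent modulo m leaves m candidates.\<close>

lemma periodic_backward_orbit_finite:
  assumes inj: "inj f" and "1 \<le> m" "(f ^^ m) x = x"
  shows "finite {p. \<exists>i. (f ^^ i) p = x}"
proof (rule finite_subset)
  show "{p. \<exists>i. (f ^^ i) p = x} \<subseteq> (\<lambda>k. (f ^^ k) x) ` {..<m}"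
  proof
    fix p assume "p \<in> {p. \<exists>i. (f ^^ i) p = x}"
    then obtain i where i: "(f ^^ i) p = x" by blast
    have per: "(f ^^ (m * k)) x = x" for k
    proof (induction k)
      case (Suc k)
      then show ?case using assms(3) by (simp add: funpow_add)
    qed simp
    have "i \<le> m * i" using assms(2) by simp
    then have "(f ^^ i) ((f ^^ (m * i - i)) x) = (f ^^ (m * i)) x"
      by (metis comp_apply funpow_add le_add_diff_inverse)
    then have "(f ^^ i) ((f ^^ (m * i - i)) x) = (f ^^ i) p" using per i by simp
    then have p: "p = (f ^^ (m * i - i)) x" using inj_fn[OF inj, of i] by (simp add: inj_eq)
    let ?q = "m * i - i"
    have "(f ^^ ?q) x = (f ^^ (?q mod m)) ((f ^^ (m * (?q div m))) x)"
      by (metis comp_apply funpow_add mod_mult_div_eq)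
    then have "p = (f ^^ (?q mod m)) x" using p per by simp
    then show "p \<in> (\<lambda>k. (f ^^ k) x) ` {..<m}" using assms(2) by auto
  qed
qed simp

lemma eventually_small_finite_orbits:
  fixes f :: "'a::t2_space \<Rightarrow> 'a"
  assumes comp: "compact (UNIV :: 'a set)" and cont: "continuous_on UNIV f" and inj: "inj f"
    and W: "open W" "eventually_small f W" and S: "S \<subseteq> nonwandering_set f"
    and hit: "\<And>p. p \<in> S \<Longrightarrow> \<exists>i. (f ^^ i) p \<in> W"
  shows "finite S"
proof (rule finite_subset)
  show "S \<subseteq> (\<Union>x \<in> W \<inter> nonwandering_set f. {p. \<exists>i. (f ^^ i) p = x})"
    using hit S nonwandering_funpow[OF cont] by blast
  show "finite (\<Union>x \<in> W \<inter> nonwandering_set f. {p. \<exists>i. (f ^^ i) p = x})"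
    using eventually_small_finite(1)[OF comp cont W] eventually_small_periodic[OF comp cont inj W]
      periodic_backward_orbit_finite[OF inj] by (intro finite_UN_I) blast+
qed

subsection \<open>Composition with diffeomorphisms close to the identity\<close>

context closed_mfd
begin

text \<open>Pointwise version of the conditions in \<open>C1_subbasic\<close>, with weak
  inequalities so that the bounds for bumps fit directly.\<close>

definition C1_close ::
  "real \<Rightarrow> ('a, 'b) chart \<Rightarrow> ('a, 'b) chart \<Rightarrow> ('a \<Rightarrow> 'a) \<Rightarrow> ('a \<Rightarrow> 'a) \<Rightarrow> 'a \<Rightarrow> bool" where
  "C1_close e c d f h x \<longleftrightarrow> h x \<in> fst d \<and> norm (snd d (h x) - snd d (f x)) \<le> e
     \<and> norm (chart_deriv c h d x - chart_deriv c f d x) \<le> e"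

lemma C1_close_mono: "C1_close e c d f h x \<Longrightarrow> e \<le> e' \<Longrightarrow> C1_close e' c d f h x"
  unfolding C1_close_def by auto

lemma C1_close_id_iff:
  assumes "c \<in> A" "x \<in> fst c"
  shows "C1_close e c c id h x \<longleftrightarrow>
    h x \<in> fst c \<and> norm (snd c (h x) - snd c x) \<le> e \<and> norm (chart_deriv c h c x - id_blinfun) \<le> e"
  using chart_deriv_id[OF assms] by (simp add: C1_close_def)

text \<open>Three charts occur because \<phi> is known to be near the identity only in
  \<open>c'\<close>, whereas the target neighbourhood measures in \<open>d\<close>. The change of
  coordinates from \<open>c'\<close> to \<open>d\<close> is C1, hence uniformly controlled near the
  compact image of \<open>K\<close>.\<close>

lemma compose_estimate:
  assumes f: "C1_map A f" and c: "c \<in> A" "c' \<in> A" "d \<in> A"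
    and K: "compact K" "K \<subseteq> fst c" "f ` K \<subseteq> fst c'" "f ` K \<subseteq> fst d" and e: "0 < e"
  obtains \<delta> where "0 < \<delta>"
    "\<And>h \<phi> x. \<lbrakk>C1_map A h; C1_map A \<phi>; x \<in> K; C1_close \<delta> c c' f h x; C1_close \<delta> c' c' id \<phi> (h x)\<rbrakk>
      \<Longrightarrow> C1_close e c d f (\<phi> \<circ> h) x"
proof -
  let ?\<Omega> = "snd c' ` (fst c' \<inter> id -` fst d)" and ?\<tau> = "local_rep c' id d"
  have o\<Omega>: "open ?\<Omega>" and C\<tau>: "C1_on ?\<Omega> ?\<tau>"
    using C1_map_domain_open[OF C1_map_id c(2,3)] C1_map_local_rep[OF C1_map_id c(2,3)] by auto
  have cont_f: "continuous_on K f" using C1_map_continuous[OF f] continuous_on_subset by blast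
  have K': "compact (snd c' ` f ` K)" "snd c' ` f ` K \<subseteq> ?\<Omega>"
    using chart_image_compact[OF c(2) compact_continuous_image[OF cont_f K(1)] K(3)] K(3,4) by auto
  have "compact (chart_deriv c f c' ` K)"
    using compact_continuous_image[OF continuous_on_subset[OF chart_deriv_continuous_on[OF f c(1,2)]] K(1)] K(2,3) by blast
  then obtain M2 where M2: "0 < M2" "\<And>x. x \<in> K \<Longrightarrow> norm (chart_deriv c f c' x) \<le> M2"
    using compact_imp_bounded bounded_pos by (metis imageI)
  have "compact (fderiv ?\<tau> ` snd c' ` f ` K)"
    using compact_continuous_image[OF continuous_on_subset[of ?\<Omega> "fderiv ?\<tau>"] K'(1)] C\<tau> K'(2)
      unfolding C1_on_def by blast
  then obtain M1 where M1: "0 < M1" "\<And>x. x \<in> K \<Longrightarrow> norm (fderiv ?\<tau> (snd c' (f x))) \<le> M1"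
    using compact_imp_bounded bounded_pos by (metis imageI)
  \<comment> \<open>The derivative error is split as e/2 + e/4 + e/4. As the perturbed factor has
    norm at most 2 * (M2 + 1), e1 accounts for e/2; the last entry of \<delta> below gives the two
    quarters.\<close>
  define e1 where "e1 = min e (e / (4 * (M2 + 1)))"
  have e1: "0 < e1" "e1 \<le> e" "e1 \<le> e / (4 * (M2 + 1))" using e M2(1) by (auto simp: e1_def)
  obtain r where r: "0 < r" "\<And>a. a \<in> snd c' ` f ` K \<Longrightarrow> cball a r \<subseteq> ?\<Omega>"
    "\<And>a u. a \<in> snd c' ` f ` K \<Longrightarrow> u \<in> cball a r \<Longrightarrow> norm (?\<tau> u - ?\<tau> a) \<le> e1"
    "\<And>a u. a \<in> snd c' ` f ` K \<Longrightarrow> u \<in> cball a r \<Longrightarrow> norm (fderiv ?\<tau> u - fderiv ?\<tau> a) \<le> e1"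
    using C1_uniform[OF o\<Omega> C\<tau> K' e1(1)] by metis
  \<comment> \<open>r / 2, because the displacements by h and by \<phi> add up.\<close>
  define \<delta> where "\<delta> = Min {1, r / 2, e / (4 * (M1 * (M2 + 1)))}"
  have d: "0 < \<delta>" "\<delta> \<le> 1" "\<delta> \<le> r / 2" "\<delta> \<le> e / (4 * (M1 * (M2 + 1)))"
    using r(1) e M1(1) M2(1) by (auto simp: \<delta>_def)
  show ?thesis
  proof (rule that[OF d(1)])
    fix h \<phi> x
    assume h: "C1_map A h" and \<phi>: "C1_map A \<phi>" and x: "x \<in> K"
      and close: "C1_close \<delta> c c' f h x" "C1_close \<delta> c' c' id \<phi> (h x)"
    have hx: "h x \<in> fst c'" and n1: "norm (snd c' (h x) - snd c' (f x)) \<le> \<delta>"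
      and n2: "norm (chart_deriv c h c' x - chart_deriv c f c' x) \<le> \<delta>"
      using close(1) by (auto simp: C1_close_def)
    have px: "\<phi> (h x) \<in> fst c'" and n3: "norm (snd c' (\<phi> (h x)) - snd c' (h x)) \<le> \<delta>"
      and n4: "norm (chart_deriv c' \<phi> c' (h x) - id_blinfun) \<le> \<delta>"
      using close(2) C1_close_id_iff[OF c(2) hx] by auto
    let ?y = "snd c' (f x)" and ?y2 = "snd c' (\<phi> (h x))"
    have y: "?y \<in> snd c' ` f ` K" using x by blast
    have fx: "f x \<in> fst c'" "f x \<in> fst d" "x \<in> fst c" using x K by auto
    have "norm (?y2 - ?y) \<le> norm (?y2 - snd c' (h x)) + norm (snd c' (h x) - ?y)" by norm
    also have "\<dots> \<le> r" using n1 n3 d(3) by linarith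
    finally have y2: "?y2 \<in> cball ?y r" by (simp add: dist_norm norm_minus_commute)
    have "?y2 \<in> ?\<Omega>" by (rule subsetD[OF r(2)[OF y] y2])
    then obtain z where z_eq: "?y2 = snd c' z" and z_in: "z \<in> fst c' \<inter> id -` fst d" by (rule imageE)
    from z_in have z: "z \<in> fst c'" "z \<in> fst d" by simp_all
    have "\<phi> (h x) = cinv c' ?y2" by (rule cinv_chart[OF c(2) px, symmetric])
    also have "\<dots> = z" unfolding z_eq by (rule cinv_chart[OF c(2) z(1)])
    finally have "\<phi> (h x) = z" .
    then have pd: "\<phi> (h x) \<in> fst d" using z by simp
    have "?\<tau> ?y2 = snd d (\<phi> (h x))" "?\<tau> ?y = snd d (f x)" using c px fx
      by (simp_all add: local_rep_apply)
    then have E1: "norm (snd d (\<phi> (h x)) - snd d (f x)) \<le> e" using r(3)[OF y y2] e1(2) by simp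
    define T T' P B B' where "T = chart_deriv c' id d (f x)" and "T' = chart_deriv c' id d (\<phi> (h x))"
      and "P = chart_deriv c' \<phi> c' (h x)" and "B = chart_deriv c f c' x" and "B' = chart_deriv c h c' x"
    have "chart_deriv c (\<phi> \<circ> h) c' x = P o\<^sub>L B'"
      unfolding P_def B'_def by (rule chart_deriv_compose[OF h \<phi>]) (use c fx hx px in auto)
    moreover have "chart_deriv c (id \<circ> (\<phi> \<circ> h)) d x = T' o\<^sub>L chart_deriv c (\<phi> \<circ> h) c' x"
      unfolding T'_def comp_apply[symmetric, of \<phi> h x]
      by (rule chart_deriv_compose[OF C1_map_compose[OF h \<phi>] C1_map_id]) (use c fx px pd in auto)
    ultimately have D1: "chart_deriv c (\<phi> \<circ> h) d x = T' o\<^sub>L (P o\<^sub>L B')" by simp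
    have "chart_deriv c (id \<circ> f) d x = T o\<^sub>L B"
      unfolding T_def B_def by (rule chart_deriv_compose[OF f C1_map_id]) (use c fx in auto)
    then have D2: "chart_deriv c f d x = T o\<^sub>L B" by simp
    \<comment> \<open>Telescoping: one factor is changed at a time.\<close>
    have "(T' o\<^sub>L (P o\<^sub>L B')) - (T o\<^sub>L B) = ((T' - T) o\<^sub>L (P o\<^sub>L B')) + (T o\<^sub>L ((P - id_blinfun) o\<^sub>L B')) + (T o\<^sub>L (B' - B))"
      by (rule blinfun_eqI) (simp add: blinfun.bilinear_simps)
    moreover have NT: "norm (T' - T) \<le> e1" using r(4)[OF y y2]
      by (simp add: T_def T'_def chart_deriv_def)
    moreover have nT: "norm T \<le> M1" using M1(2)[OF x] by (simp add: T_def chart_deriv_def)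
    moreover have nB: "norm B' \<le> M2 + 1"
    proof -
      have "norm B' \<le> norm B + norm (B' - B)" by norm
      then show ?thesis using M2(2)[OF x] n2 d(2) by (simp add: B_def B'_def)
    qed
    moreover have nP: "norm P \<le> 2"
    proof -
      have "norm P \<le> norm (id_blinfun :: 'b \<Rightarrow>\<^sub>L 'b) + norm (P - id_blinfun)" by norm
      then show ?thesis using n4 d(2) norm_blinfun_id_le[where 'a='b] by (simp add: P_def)
    qed
    have a1: "norm ((T' - T) o\<^sub>L (P o\<^sub>L B')) \<le> e / 2"
    proof -
      have "norm ((T' - T) o\<^sub>L (P o\<^sub>L B')) \<le> norm (T' - T) * norm (P o\<^sub>L B')"
        by (rule norm_blinfun_compose)
      also have "\<dots> \<le> norm (T' - T) * (norm P * norm B')"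
        by (intro mult_left_mono norm_blinfun_compose) auto
      also have "\<dots> \<le> (e / (4 * (M2 + 1))) * (2 * (M2 + 1))"
        using NT e1 nP nB e M2(1) by (intro mult_mono) auto
      also have "\<dots> = e / 2" using M2(1) by (simp add: field_simps)
      finally show ?thesis .
    qed
    have dd: "M1 * (\<delta> * (M2 + 1)) \<le> e / 4"
    proof -
      have "M1 * (\<delta> * (M2 + 1)) = \<delta> * (M1 * (M2 + 1))" by (simp add: mult_ac)
      also have "\<dots> \<le> e / (4 * (M1 * (M2 + 1))) * (M1 * (M2 + 1))"
        using d M1(1) M2(1) by (intro mult_right_mono) auto
      also have "\<dots> = e / 4" using M1(1) M2(1) by simp
      finally show ?thesis .
    qed
    have a2: "norm (T o\<^sub>L ((P - id_blinfun) o\<^sub>L B')) \<le> e / 4"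
    proof -
      have "norm (T o\<^sub>L ((P - id_blinfun) o\<^sub>L B')) \<le> norm T * norm ((P - id_blinfun) o\<^sub>L B')"
        by (rule norm_blinfun_compose)
      also have "\<dots> \<le> norm T * (norm (P - id_blinfun) * norm B')"
        by (intro mult_left_mono norm_blinfun_compose) auto
      also have "\<dots> \<le> M1 * (\<delta> * (M2 + 1))"
        using nT n4 nB d M1(1) M2(1) by (intro mult_mono) (auto simp: P_def)
      finally show ?thesis using dd by simp
    qed
    have a3: "norm (T o\<^sub>L (B' - B)) \<le> e / 4"
    proof -
      have "norm (T o\<^sub>L (B' - B)) \<le> norm T * norm (B' - B)" by (rule norm_blinfun_compose)
      also have "\<dots> \<le> M1 * \<delta>" using nT n2 M1(1) by (intro mult_mono) (auto simp: B_def B'_def)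
      also have "\<dots> \<le> M1 * (\<delta> * (M2 + 1))" using M1(1) M2(1) d(1) by (simp add: distrib_left)
      finally show ?thesis using dd by simp
    qed
    have "norm (((T' - T) o\<^sub>L (P o\<^sub>L B')) + (T o\<^sub>L ((P - id_blinfun) o\<^sub>L B')) + (T o\<^sub>L (B' - B))) \<le> e/2 + e/4 + e/4"
      by (intro norm_triangle_mono a1 a2 a3)
    ultimately have "norm ((T' o\<^sub>L (P o\<^sub>L B')) - (T o\<^sub>L B)) \<le> e" by simp
    then show "C1_close e c d f (\<phi> \<circ> h) x" unfolding C1_close_def using pd E1 D1 D2 by simp
  qed
qed

lemma C1_subbasic_iff:
  assumes f: "f \<in> Diff1 A" and c: "c \<in> A" "d \<in> A" and K: "K \<subseteq> fst c" "f ` K \<subseteq> fst d"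
  shows "h \<in> C1_subbasic A f c d K e \<longleftrightarrow> h \<in> Diff1 A \<and> h ` K \<subseteq> fst d \<and>
    (\<forall>x\<in>K. norm (snd d (h x) - snd d (f x)) < e \<and> norm (chart_deriv c h d x - chart_deriv c f d x) < e)"
proof -
  have *: "onorm (\<lambda>v. frechet_derivative (local_rep c h d) (at (snd c x)) v - frechet_derivative (local_rep c f d) (at (snd c x)) v)
     = norm (chart_deriv c h d x - chart_deriv c f d x)" if "h \<in> Diff1 A" "h ` K \<subseteq> fst d" "x \<in> K" for x
  proof -
    have "x \<in> fst c" "h x \<in> fst d" "f x \<in> fst d" using that K by auto
    then have "(\<lambda>v. frechet_derivative (local_rep c h d) (at (snd c x)) v - frechet_derivative (local_rep c f d) (at (snd c x)) v)
      = blinfun_apply (chart_deriv c h d x - chart_deriv c f d x)"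
      using chart_deriv_apply[OF Diff1_C1[OF that(1)] c] chart_deriv_apply[OF Diff1_C1[OF f] c]
      by (auto simp: fun_eq_iff blinfun.diff_left)
    then show ?thesis by (simp add: norm_blinfun.rep_eq)
  qed
  have **: "local_rep c h d (snd c x) - local_rep c f d (snd c x) = snd d (h x) - snd d (f x)" if "x \<in> K"
    for x
    using that K c by (simp add: local_rep_apply subset_eq)
  show ?thesis unfolding C1_subbasic_def by (auto simp: * **)
qed

abbreviation C1_open :: "('a \<Rightarrow> 'a) set \<Rightarrow> bool" where
  "C1_open \<equiv> openin (C1_topology A)"

lemma C1_subbasic_open:
  assumes "f \<in> Diff1 A" "c \<in> A" "d \<in> A" "compact K" "K \<subseteq> fst c" "f ` K \<subseteq> fst d" "0 < e"
  shows "C1_open (C1_subbasic A f c d K e)" "f \<in> C1_subbasic A f c d K e"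
proof -
  show "C1_open (C1_subbasic A f c d K e)"
    unfolding C1_topology_def by (rule topology_generated_by_Basis) (use assms in blast)
  show "f \<in> C1_subbasic A f c d K e"
    using assms by (simp add: C1_subbasic_iff)
qed

lemma C1_open_subset: "C1_open W \<Longrightarrow> W \<subseteq> Diff1 A"
proof -
  assume "C1_open W"
  then have "W \<subseteq> topspace (C1_topology A)" by (rule openin_subset)
  also have "\<dots> \<subseteq> Diff1 A" unfolding C1_topology_def by (auto simp: C1_subbasic_def)
  finally show ?thesis .
qed

text \<open>The distance of f from the centre f0 is bounded by some s < e on the compact set K; half
  of the remaining room turns the weak inequalities of \<open>C1_close\<close> into strict
  ones.\<close>

lemma C1_subbasic_slack:
  assumes f0: "f0 \<in> Diff1 A" and c: "c \<in> A" "d \<in> A" and K: "compact K" "K \<subseteq> fst c" "f0 ` K \<subseteq> fst d"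
    and f: "f \<in> C1_subbasic A f0 c d K e" and e: "0 < e"
  obtains e' where "0 < e'"
    "\<And>h. \<lbrakk>h \<in> Diff1 A; \<And>x. x \<in> K \<Longrightarrow> C1_close e' c d f h x\<rbrakk> \<Longrightarrow> h \<in> C1_subbasic A f0 c d K e"
proof -
  note iff = C1_subbasic_iff[OF f0 c K(2,3)]
  have fD: "f \<in> Diff1 A" "f ` K \<subseteq> fst d" and fe: "\<And>x. x \<in> K \<Longrightarrow> norm (snd d (f x) - snd d (f0 x)) < e"
      "\<And>x. x \<in> K \<Longrightarrow> norm (chart_deriv c f d x - chart_deriv c f0 d x) < e" using f iff by auto
  define m where "m x = max (norm (snd d (f x) - snd d (f0 x))) (norm (chart_deriv c f d x - chart_deriv c f0 d x))" for x
  have c1: "continuous_on K (\<lambda>x. snd d (h x))" if "h \<in> Diff1 A" "h ` K \<subseteq> fst d" for h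
    using continuous_on_compose2[OF chart_continuous[OF c(2)] continuous_on_subset[OF Diff1_continuous[OF that(1)]] that(2)] by simp
  have c2: "continuous_on K (chart_deriv c h d)" if "h \<in> Diff1 A" "h ` K \<subseteq> fst d" for h
    using continuous_on_subset[OF chart_deriv_continuous_on[OF Diff1_C1[OF that(1)] c]] that(2) K(2)
      by blast
  have "continuous_on K m"
    unfolding m_def by (intro continuous_intros c1 c2 f0 K fD)
  then obtain s where s: "s < e" "\<And>x. x \<in> K \<Longrightarrow> m x \<le> s"
  proof (cases "K = {}")
    case False
    then obtain x0 where "x0 \<in> K" "\<forall>x\<in>K. m x \<le> m x0"
      using continuous_attains_sup[OF K(1) False \<open>continuous_on K m\<close>] by blast
    then show ?thesis using that[of "m x0"] fe by (auto simp: m_def)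
  qed (use that[of 0] e in auto)
  show ?thesis
  proof (rule that[of "(e - s) / 2"])
    show "0 < (e - s) / 2" using s by simp
    fix h assume h: "h \<in> Diff1 A" and close: "\<And>x. x \<in> K \<Longrightarrow> C1_close ((e - s) / 2) c d f h x"
    note h2 = close[unfolded C1_close_def]
    have "norm (snd d (h x) - snd d (f0 x)) < e \<and> norm (chart_deriv c h d x - chart_deriv c f0 d x) < e"
      if x: "x \<in> K" for x
    proof -
      have "norm (snd d (h x) - snd d (f0 x)) \<le> norm (snd d (h x) - snd d (f x)) + norm (snd d (f x) - snd d (f0 x))"
        "norm (chart_deriv c h d x - chart_deriv c f0 d x)
          \<le> norm (chart_deriv c h d x - chart_deriv c f d x) + norm (chart_deriv c f d x - chart_deriv c f0 d x)"
        by norm+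
      moreover have "norm (snd d (f x) - snd d (f0 x)) \<le> s"
        "norm (chart_deriv c f d x - chart_deriv c f0 d x) \<le> s"
        using s(2)[OF x] by (auto simp: m_def)
      moreover have "(e - s) / 2 + s < e" using s(1) by (simp add: field_simps)
      ultimately show ?thesis using h2[OF x] by linarith
    qed
    then show "h \<in> C1_subbasic A f0 c d K e" using iff h h2 by blast
  qed
qed

text \<open>Each chart is indexed by the point at the centre of its coordinate ball. Three radii
  leave room for points that small perturbations move out of the covering balls: they stay in discs
  of twice the radius, which are compact.\<close>

lemma finite_cover_exists:
  obtains I C R where "finite I" "\<And>i. i \<in> I \<Longrightarrow> C i \<in> A" "\<And>i. i \<in> I \<Longrightarrow> 0 < R i"
    "\<And>i. i \<in> I \<Longrightarrow> cball (snd (C i) i) (3 * R i) \<subseteq> snd (C i) ` fst (C i)"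
    "\<And>x. \<exists>i\<in>I. x \<in> fst (C i) \<and> snd (C i) x \<in> ball (snd (C i) i) (R i)"
proof -
  obtain C where C: "\<And>x. C x \<in> A" "\<And>x. x \<in> fst (C x)" using chart_exists by metis
  have "\<exists>r>0. cball (snd (C x) x) (3 * r) \<subseteq> snd (C x) ` fst (C x)" for x
  proof -
    obtain r where "0 < r" "cball (snd (C x) x) r \<subseteq> snd (C x) ` fst (C x)"
      using chart_open_range[OF C(1)] C(2) by (meson imageI open_contains_cball)
    then show ?thesis by (intro exI[of _ "r/3"]) auto
  qed
  then obtain R where R: "\<And>x. 0 < R x" "\<And>x. cball (snd (C x) x) (3 * R x) \<subseteq> snd (C x) ` fst (C x)"
    by metis
  define U where "U i = {x \<in> fst (C i). snd (C i) x \<in> ball (snd (C i) i) (R i)}" for i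
  have "open (U i)" for i unfolding U_def by (intro chart_preimage_open C open_ball)
  moreover have "i \<in> U i" for i unfolding U_def using C R by auto
  ultimately obtain I where I: "finite I" "UNIV \<subseteq> (\<Union>i\<in>I. U i)"
    using compactE_image[OF compact_UNIV, of UNIV U] by (metis UNIV_I UN_I subsetI)
  show ?thesis
  proof (rule that[OF I(1), of C R])
    fix x show "\<exists>i\<in>I. x \<in> fst (C i) \<and> snd (C i) x \<in> ball (snd (C i) i) (R i)"
      using I(2) unfolding U_def by auto
  qed (use C R in auto)
qed

end

text \<open>Asking for all smaller \<open>s\<close> lets the property pass to the minimum of the
  radii; the inserted 1 covers an empty \<open>J\<close>.\<close>

lemma finite_uniform_pos:
  assumes "finite J" "\<And>j. j \<in> J \<Longrightarrow> \<exists>r>0::real. \<forall>s. 0 < s \<longrightarrow> s \<le> r \<longrightarrow> P j s"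
  shows "\<exists>r>0. \<forall>j\<in>J. P j r"
proof -
  obtain r where r: "\<And>j. j \<in> J \<Longrightarrow> 0 < r j \<and> (\<forall>s. 0 < s \<longrightarrow> s \<le> r j \<longrightarrow> P j s)" using assms(2) by metis
  have "0 < Min (insert 1 (r ` J))" "\<And>j. j \<in> J \<Longrightarrow> Min (insert 1 (r ` J)) \<le> r j" using r assms(1) by auto
  then show ?thesis using r by blast
qed

section \<open>C1 distance to the identity measured in finitely many charts\<close>

locale finite_cover = closed_mfd A for A :: "('a::t2_space, 'b::euclidean_space) chart set" +
  fixes I :: "'a set" and C :: "'a \<Rightarrow> ('a, 'b) chart" and R :: "'a \<Rightarrow> real"
  assumes finite_I: "finite I" and C: "i \<in> I \<Longrightarrow> C i \<in> A" and R: "i \<in> I \<Longrightarrow> 0 < R i"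
    and big: "i \<in> I \<Longrightarrow> cball (snd (C i) i) (3 * R i) \<subseteq> snd (C i) ` fst (C i)"
    and cover: "\<exists>i\<in>I. x \<in> fst (C i) \<and> snd (C i) x \<in> ball (snd (C i) i) (R i)"
begin

definition disc :: "'a \<Rightarrow> real \<Rightarrow> 'a set" where
  "disc i s = {x \<in> fst (C i). snd (C i) x \<in> cball (snd (C i) i) (s * R i)}"

lemma disc_compact:
  assumes "i \<in> I" "s \<le> 3" shows "compact (disc i s)"
proof -
  have "cball (snd (C i) i) (s * R i) \<subseteq> snd (C i) ` fst (C i)"
    using big[OF assms(1)] R[OF assms(1)] assms(2)
      by (meson less_imp_le mult_right_mono order_trans subset_cball)
  then show ?thesis unfolding disc_def by (intro chart_preimage_compact C assms) auto
qed

lemma disc_subset: "disc i s \<subseteq> fst (C i)"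
  by (auto simp: disc_def)

lemma I_nonempty: "I \<noteq> {}"
  using cover by blast

definition near_id :: "real \<Rightarrow> ('a \<Rightarrow> 'a) \<Rightarrow> bool" where
  "near_id \<epsilon> \<phi> \<longleftrightarrow> \<phi> \<in> Diff1 A \<and> (\<forall>i\<in>I. \<forall>x\<in>disc i 2. C1_close \<epsilon> (C i) (C i) id \<phi> x)"

text \<open>Tests one chart per point. A bump passes this test in the chart where it is built, and
  maps with disjoint supports can be composed without loss; \<open>near_id\<close>, which tests all
  charts, is what the composition estimates consume.\<close>

definition locally_near_id :: "real \<Rightarrow> ('a \<Rightarrow> 'a) \<Rightarrow> bool" where
  "locally_near_id \<epsilon> \<phi> \<longleftrightarrow> \<phi> \<in> Diff1 A \<and> (\<forall>x. \<exists>i\<in>I. x \<in> disc i 1 \<and> C1_close \<epsilon> (C i) (C i) id \<phi> x)"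

lemma near_id_mono: "near_id \<epsilon> \<phi> \<Longrightarrow> \<epsilon> \<le> \<epsilon>' \<Longrightarrow> near_id \<epsilon>' \<phi>"
  unfolding near_id_def using C1_close_mono by blast

lemma locally_near_id_mono: "locally_near_id \<epsilon> \<phi> \<Longrightarrow> \<epsilon> \<le> \<epsilon>' \<Longrightarrow> locally_near_id \<epsilon>' \<phi>"
  unfolding locally_near_id_def using C1_close_mono by blast

text \<open>On the overlap of two discs this is \<open>compose_estimate\<close> for a composition
  with the identity; uniformity holds because there are finitely many overlaps, all compact.\<close>

lemma locally_near_id_imp:
  assumes "0 < \<epsilon>" obtains \<delta> where "0 < \<delta>" "\<And>\<phi>. locally_near_id \<delta> \<phi> \<Longrightarrow> near_id \<epsilon> \<phi>"
proof -
  define P where "P ij s \<longleftrightarrow> (\<forall>\<phi> x. C1_map A \<phi> \<and> x \<in> disc (fst ij) 2 \<inter> disc (snd ij) 1 \<and>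
      C1_close s (C (snd ij)) (C (snd ij)) id \<phi> x \<longrightarrow> C1_close \<epsilon> (C (fst ij)) (C (fst ij)) id \<phi> x)"
    for ij :: "'a \<times> 'a" and s
  have "\<exists>r>0. \<forall>ij\<in>I \<times> I. P ij r"
  proof (rule finite_uniform_pos)
    show "finite (I \<times> I)" using finite_I by simp
    fix ij assume "ij \<in> I \<times> I"
    then obtain i j where ij: "ij = (i, j)" "i \<in> I" "j \<in> I" by auto
    have comp: "compact (disc i 2 \<inter> disc j 1)"
      using disc_compact[of i 2] disc_compact[of j 1] ij compact_Int_closed compact_imp_closed by auto
    have sub: "disc i 2 \<inter> disc j 1 \<subseteq> fst (C i)" "id ` (disc i 2 \<inter> disc j 1) \<subseteq> fst (C j)"
      "id ` (disc i 2 \<inter> disc j 1) \<subseteq> fst (C i)"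
      using disc_subset by auto
    obtain r where r: "0 < r" "\<And>h \<phi> x. \<lbrakk>C1_map A h; C1_map A \<phi>; x \<in> disc i 2 \<inter> disc j 1;
        C1_close r (C i) (C j) id h x; C1_close r (C j) (C j) id \<phi> (h x)\<rbrakk> \<Longrightarrow> C1_close \<epsilon> (C i) (C i) id (\<phi> \<circ> h) x"
      by (rule compose_estimate[OF C1_map_id C[OF ij(2)] C[OF ij(3)] C[OF ij(2)] comp sub assms]) (rule that)
    have "P ij s" if s: "0 < s" "s \<le> r" for s
      unfolding P_def ij fst_conv snd_conv
    proof (intro allI impI, elim conjE)
      fix \<phi> x assume a: "C1_map A \<phi>" "x \<in> disc i 2 \<inter> disc j 1" "C1_close s (C j) (C j) id \<phi> x"
      have "x \<in> fst (C j)" using a(2) disc_subset by blast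
      then have "C1_close r (C i) (C j) id id x" using r(1) by (simp add: C1_close_def)
      moreover have "C1_close r (C j) (C j) id \<phi> (id x)" using C1_close_mono[OF a(3) s(2)] by simp
      ultimately have "C1_close \<epsilon> (C i) (C i) id (\<phi> \<circ> id) x" by (rule r(2)[OF C1_map_id a(1,2)])
      then show "C1_close \<epsilon> (C i) (C i) id \<phi> x" by simp
    qed
    then show "\<exists>r>0. \<forall>s. 0 < s \<longrightarrow> s \<le> r \<longrightarrow> P ij s" using r(1) by blast
  qed
  then obtain r where r: "0 < r" "\<And>i j. i \<in> I \<Longrightarrow> j \<in> I \<Longrightarrow> P (i, j) r" by blast
  show ?thesis
  proof (rule that[OF r(1)])
    fix \<phi> assume \<phi>: "locally_near_id r \<phi>"
    then have D: "\<phi> \<in> Diff1 A" "C1_map A \<phi>" using Diff1_C1 by (auto simp: locally_near_id_def)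
    show "near_id \<epsilon> \<phi>" unfolding near_id_def
    proof (intro conjI ballI D)
      fix i x assume i: "i \<in> I" and x: "x \<in> disc i 2"
      obtain j where j: "j \<in> I" "x \<in> disc j 1" "C1_close r (C j) (C j) id \<phi> x"
        using \<phi> unfolding locally_near_id_def by blast
      then show "C1_close \<epsilon> (C i) (C i) id \<phi> x"
        using r(2)[OF i j(1)] D(2) x unfolding P_def fst_conv snd_conv by blast
    qed
  qed
qed

text \<open>\<open>K\<close> is cut into the compact pieces that \<open>f\<close> sends into one
  covering disc. As r \<le> R i, a nearby h sends such a piece into the disc of twice the radius,
  where \<phi> is known to be near the identity.\<close>

lemma compose_subbasic:
  assumes f0: "f0 \<in> Diff1 A" and c: "c \<in> A" "d \<in> A" and K: "compact K" "K \<subseteq> fst c" "f0 ` K \<subseteq> fst d"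
    and e: "0 < e"
    and f: "f \<in> C1_subbasic A f0 c d K e"
  shows "\<exists>U \<epsilon>. C1_open U \<and> f \<in> U \<and> 0 < \<epsilon> \<and> (\<forall>h\<in>U. \<forall>\<phi>. near_id \<epsilon> \<phi> \<longrightarrow> \<phi> \<circ> h \<in> C1_subbasic A f0 c d K e)"
proof -
  have fD: "f \<in> Diff1 A" "C1_map A f" "f ` K \<subseteq> fst d" using f Diff1_C1 by (auto simp: C1_subbasic_def)
  obtain e' where e': "0 < e'"
    "\<And>h. \<lbrakk>h \<in> Diff1 A; \<And>x. x \<in> K \<Longrightarrow> C1_close e' c d f h x\<rbrakk> \<Longrightarrow> h \<in> C1_subbasic A f0 c d K e"
    using C1_subbasic_slack[OF f0 c K f e] by metis
  define Ki where "Ki i = K \<inter> f -` disc i 1" for i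
  have Ki: "compact (Ki i)" "Ki i \<subseteq> fst c" "f ` Ki i \<subseteq> fst (C i)" "f ` Ki i \<subseteq> fst d" if "i \<in> I" for i
  proof -
    have "closed (f -` disc i 1)"
      using Diff1_continuous[OF fD(1)] disc_compact[OF that, of 1]
      by (simp add: continuous_on_closed_vimage compact_imp_closed)
    then show "compact (Ki i)" unfolding Ki_def using K(1) compact_Int_closed by blast
    show "Ki i \<subseteq> fst c" "f ` Ki i \<subseteq> fst (C i)" "f ` Ki i \<subseteq> fst d"
      using K fD(3) disc_subset[of i 1] by (auto simp: Ki_def)
  qed
  define P where "P i s \<longleftrightarrow> s \<le> R i \<and> (\<forall>h \<phi> x. C1_map A h \<and> C1_map A \<phi> \<and> x \<in> Ki i \<and>
      C1_close s c (C i) f h x \<and> C1_close s (C i) (C i) id \<phi> (h x) \<longrightarrow> C1_close e' c d f (\<phi> \<circ> h) x)" for i s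
  have "\<exists>r>0. \<forall>i\<in>I. P i r"
  proof (rule finite_uniform_pos[OF finite_I])
    fix i assume i: "i \<in> I"
    obtain r where r: "0 < r" "\<And>h \<phi> x. \<lbrakk>C1_map A h; C1_map A \<phi>; x \<in> Ki i;
        C1_close r c (C i) f h x; C1_close r (C i) (C i) id \<phi> (h x)\<rbrakk> \<Longrightarrow> C1_close e' c d f (\<phi> \<circ> h) x"
      by (rule compose_estimate[OF fD(2) c(1) C[OF i] c(2) Ki[OF i] e'(1)]) (rule that)
    have "P i s" if "s \<le> min r (R i)" for s
      unfolding P_def using that r(2) C1_close_mono[of s _ _ _ _ _ r] by (smt (verit) min.bounded_iff)
    moreover have "0 < min r (R i)" using r(1) R[OF i] by simp
    ultimately show "\<exists>r>0. \<forall>s. 0 < s \<longrightarrow> s \<le> r \<longrightarrow> P i s" by blast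
  qed
  then obtain r where r: "0 < r" "\<And>i. i \<in> I \<Longrightarrow> P i r" by blast
  let ?U = "\<Inter>i\<in>I. C1_subbasic A f c (C i) (Ki i) r"
  have sub: "C1_open (C1_subbasic A f c (C i) (Ki i) r)" "f \<in> C1_subbasic A f c (C i) (Ki i) r" if
    "i \<in> I" for i
    using C1_subbasic_open[OF fD(1) c(1) C[OF that] Ki(1-3)[OF that] r(1)] by auto
  have "C1_open ?U" using sub(1) finite_I I_nonempty by (intro openin_INT2) auto
  moreover have "f \<in> ?U" using sub(2) by blast
  moreover have "\<phi> \<circ> h \<in> C1_subbasic A f0 c d K e" if h: "h \<in> ?U" and \<phi>: "near_id r \<phi>" for h \<phi>
  proof -
    have \<phi>D: "\<phi> \<in> Diff1 A" "C1_map A \<phi>" using \<phi> Diff1_C1 by (auto simp: near_id_def)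
    have hD: "h \<in> Diff1 A" "C1_map A h" using h I_nonempty Diff1_C1 by (auto simp: C1_subbasic_def)
    show ?thesis
    proof (rule e'(2)[OF Diff1_compose[OF hD(1) \<phi>D(1)]])
      fix x assume x: "x \<in> K"
      obtain i where i: "i \<in> I" "f x \<in> fst (C i)" "snd (C i) (f x) \<in> ball (snd (C i) i) (R i)"
        using cover by blast
      then have xi: "x \<in> Ki i" using x ball_subset_cball by (auto simp: Ki_def disc_def)
      have "h \<in> C1_subbasic A f c (C i) (Ki i) r" using h i(1) by blast
      then have hx: "C1_close r c (C i) f h x"
        using xi C1_subbasic_iff[OF fD(1) c(1) C[OF i(1)] Ki(2,3)[OF i(1)]]
          by (auto simp: C1_close_def less_imp_le)
      have rR: "r \<le> R i" using r(2)[OF i(1)] by (simp add: P_def)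
      have "dist (snd (C i) i) (snd (C i) (h x)) \<le> dist (snd (C i) i) (snd (C i) (f x)) + dist (snd (C i) (f x)) (snd (C i) (h x))"
        by (rule dist_triangle)
      also have "\<dots> \<le> 2 * R i" using i(3) hx rR by (simp add: C1_close_def dist_norm norm_minus_commute)
      finally have "h x \<in> disc i 2" using hx by (simp add: disc_def C1_close_def)
      then have "C1_close r (C i) (C i) id \<phi> (h x)" using \<phi> i(1) unfolding near_id_def by blast
      then show "C1_close e' c d f (\<phi> \<circ> h) x" using r(2)[OF i(1)] hD(2) \<phi>D(2) xi hx unfolding P_def
        by blast
    qed
  qed
  ultimately show ?thesis using r(1) by blast
qed

text \<open>The point is one \<epsilon> for all h in U: later h is chosen first, inside U, and only
  then composed with a \<phi> that depends on its orbit.\<close>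

lemma compose_open:
  assumes "C1_open W" "f \<in> W"
  shows "\<exists>U \<epsilon>. C1_open U \<and> f \<in> U \<and> 0 < \<epsilon> \<and> (\<forall>h\<in>U. \<forall>\<phi>. near_id \<epsilon> \<phi> \<longrightarrow> \<phi> \<circ> h \<in> W)"
proof -
  let ?B = "{C1_subbasic A f c d K e | f c d K e.
        f \<in> Diff1 A \<and> c \<in> A \<and> d \<in> A \<and> compact K \<and> K \<subseteq> fst c \<and> f ` K \<subseteq> fst d \<and> 0 < e}"
  have "generate_topology_on ?B W" using assms(1) unfolding C1_topology_def
    by (rule openin_topology_generated_by)
  then show ?thesis using assms(2)
  proof (induction W)
    case (Int V W)
    obtain U \<epsilon> where U: "C1_open U" "f \<in> U" "0 < \<epsilon>" "\<forall>h\<in>U. \<forall>\<phi>. near_id \<epsilon> \<phi> \<longrightarrow> \<phi> \<circ> h \<in> V"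
      using Int.IH(1) Int.prems by blast
    obtain U' \<epsilon>' where U': "C1_open U'" "f \<in> U'" "0 < \<epsilon>'" "\<forall>h\<in>U'. \<forall>\<phi>. near_id \<epsilon>' \<phi> \<longrightarrow> \<phi> \<circ> h \<in> W"
      using Int.IH(2) Int.prems by blast
    have "\<forall>h\<in>U \<inter> U'. \<forall>\<phi>. near_id (min \<epsilon> \<epsilon>') \<phi> \<longrightarrow> \<phi> \<circ> h \<in> V \<inter> W"
      using U(4) U'(4) near_id_mono[of "min \<epsilon> \<epsilon>'"]
        by (metis IntD1 IntD2 IntI min.cobounded1 min.cobounded2)
    moreover have "C1_open (U \<inter> U')" "f \<in> U \<inter> U'" "0 < min \<epsilon> \<epsilon>'" using U(1-3) U'(1-3) by auto
    ultimately show ?case by blast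
  next
    case (UN \<K>)
    then obtain V where V: "V \<in> \<K>" "f \<in> V" by blast
    from UN.IH[OF V] show ?case using V(1) by (meson UnionI)
  next
    case (Basis V)
    then obtain f0 c d K e where V: "V = C1_subbasic A f0 c d K e" "f0 \<in> Diff1 A" "c \<in> A" "d \<in> A"
      "compact K" "K \<subseteq> fst c" "f0 ` K \<subseteq> fst d" "0 < e"
      by blast
    show ?case using compose_subbasic[OF V(2-8)] Basis.prems unfolding V(1) by blast
  qed simp
qed

end

subsection \<open>Riemannian norms in charts\<close>

context closed_mfd
begin

lemma charts_at_iff: "d \<in> charts_at A p \<longleftrightarrow> d \<in> A \<and> p \<in> fst d"
  by (simp add: charts_at_def)

lemma coord_vector_apply:
  assumes "c \<in> A" "p \<in> fst c" "d \<in> A" "p \<in> fst d"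
  shows "coord_vector A c p u d = chart_deriv c id d p u"
  using assms chart_deriv_apply[OF C1_map_id, of c d p] by (simp add: coord_vector_def charts_at_iff)

lemma coord_vector_self: "c \<in> A \<Longrightarrow> p \<in> fst c \<Longrightarrow> coord_vector A c p u c = u"
  by (simp add: coord_vector_apply chart_deriv_id)

lemma chart_deriv_id_trans:
  assumes "c \<in> A" "p \<in> fst c" "d \<in> A" "p \<in> fst d" "e \<in> A" "p \<in> fst e"
  shows "chart_deriv d id e p (chart_deriv c id d p u) = chart_deriv c id e p u"
  using chart_deriv_compose[OF C1_map_id C1_map_id, of c d e p] assms by simp

lemma coord_vector_tangent:
  assumes "c \<in> A" "p \<in> fst c" shows "coord_vector A c p u \<in> tangent_space A p"
  unfolding tangent_space_def
proof (intro CollectI conjI allI impI ballI)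
  fix d e assume "d \<in> charts_at A p" "e \<in> charts_at A p"
  then have de: "d \<in> A" "p \<in> fst d" "e \<in> A" "p \<in> fst e" by (auto simp: charts_at_iff)
  then show "coord_vector A c p u e = frechet_derivative (local_rep d id e) (at (snd d p)) (coord_vector A c p u d)"
    using assms chart_deriv_apply[OF C1_map_id, of d e p]
      by (simp add: coord_vector_apply chart_deriv_id_trans)
qed (simp add: coord_vector_def)

lemma tangent_vector_coord:
  assumes "c \<in> A" "p \<in> fst c" "\<xi> \<in> tangent_space A p" shows "\<xi> = coord_vector A c p (\<xi> c)"
proof
  fix d
  show "\<xi> d = coord_vector A c p (\<xi> c) d"
  proof (cases "d \<in> charts_at A p")
    case True
    have "c \<in> charts_at A p" using assms by (simp add: charts_at_iff)
    then have "\<xi> d = frechet_derivative (local_rep c id d) (at (snd c p)) (\<xi> c)"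
      using assms(3) True unfolding tangent_space_def by blast
    then show ?thesis using True by (simp add: coord_vector_def)
  next
    case False
    then have "\<xi> d = 0" using assms(3) unfolding tangent_space_def by blast
    then show ?thesis using False by (simp add: coord_vector_def)
  qed
qed

lemma coord_vector_linear:
  assumes "c \<in> A" "p \<in> fst c"
  shows "coord_vector A c p (u + v) = (\<lambda>d. coord_vector A c p u d + coord_vector A c p v d)"
    and "coord_vector A c p (r *\<^sub>R u) = (\<lambda>d. r *\<^sub>R coord_vector A c p u d)"
proof -
  have *: "coord_vector A c p w d = (if d \<in> charts_at A p then chart_deriv c id d p w else 0)" for w d
  proof (cases "d \<in> charts_at A p")
    case True
    then show ?thesis using assms coord_vector_apply by (simp add: charts_at_iff)
  qed (simp add: coord_vector_def)
  show "coord_vector A c p (u + v) = (\<lambda>d. coord_vector A c p u d + coord_vector A c p v d)"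
    "coord_vector A c p (r *\<^sub>R u) = (\<lambda>d. r *\<^sub>R coord_vector A c p u d)"
    by (auto simp: * fun_eq_iff blinfun.bilinear_simps)
qed

text \<open>By the chain rule the result does not depend on the chart that
  \<open>differential\<close> selects with \<open>SOME\<close>.\<close>

lemma differential_coord_vector:
  assumes f: "C1_map A f" and c: "c \<in> A" "p \<in> fst c" and d: "d \<in> A" "f p \<in> fst d"
  shows "differential A f p (coord_vector A c p u) = coord_vector A d (f p) (chart_deriv c f d p u)"
proof
  fix e
  show "differential A f p (coord_vector A c p u) e = coord_vector A d (f p) (chart_deriv c f d p u) e"
  proof (cases "e \<in> charts_at A (f p)")
    case True
    then have e: "e \<in> A" "f p \<in> fst e" by (auto simp: charts_at_iff)
    define b where "b = (SOME b. b \<in> charts_at A p)"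
    have "b \<in> charts_at A p" unfolding b_def by (rule someI[of _ c]) (simp add: c charts_at_iff)
    then have b: "b \<in> A" "p \<in> fst b" by (auto simp: charts_at_iff)
    have "differential A f p (coord_vector A c p u) e = chart_deriv b f e p (chart_deriv c id b p u)"
      using True c b e chart_deriv_apply[OF f, of b e p]
      by (simp add: differential_def b_def[symmetric] coord_vector_apply Let_def)
    also have "\<dots> = chart_deriv c f e p u"
      using chart_deriv_compose[OF C1_map_id f, of c b e p] c b e by simp
    also have "\<dots> = chart_deriv d id e (f p) (chart_deriv c f d p u)"
      using chart_deriv_compose[OF f C1_map_id, of c d e p] c d e by simp
    also have "\<dots> = coord_vector A d (f p) (chart_deriv c f d p u) e"
      using d e by (simp add: coord_vector_apply)
    finally show ?thesis .
  next
    case False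
    then show ?thesis by (simp add: differential_def coord_vector_def)
  qed
qed

end

section \<open>Comparison of Riemannian and Euclidean norms\<close>

locale riemannian_mfd = closed_mfd A for A :: "('a::t2_space, 'b::euclidean_space) chart set" +
  fixes g :: "'a \<Rightarrow> ('a, 'b) tvec \<Rightarrow> ('a, 'b) tvec \<Rightarrow> real"
  assumes metric: "riemannian_metric A g"
begin

abbreviation gram :: "('a, 'b) chart \<Rightarrow> 'a \<Rightarrow> 'b \<Rightarrow> 'b \<Rightarrow> real" where
  "gram c p u v \<equiv> g p (coord_vector A c p u) (coord_vector A c p v)"

lemma gram:
  assumes "c \<in> A" "p \<in> fst c"
  shows "gram c p u v = gram c p v u"
    and "gram c p (u + w) v = gram c p u v + gram c p w v"
    and "gram c p (r *\<^sub>R u) v = r * gram c p u v"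
    and "u \<noteq> 0 \<Longrightarrow> 0 < gram c p u u"
proof -
  have G: "inner_product_on_tangent_space A p (g p)" using metric by (simp add: riemannian_metric_def)
  note T = coord_vector_tangent[OF assms]
  show "gram c p u v = gram c p v u" "gram c p (u + w) v = gram c p u v + gram c p w v"
    "gram c p (r *\<^sub>R u) v = r * gram c p u v"
    using G T unfolding inner_product_on_tangent_space_def
      by (simp_all add: coord_vector_linear[OF assms])
  show "0 < gram c p u u" if "u \<noteq> 0"
  proof -
    have "coord_vector A c p u \<noteq> (\<lambda>c. 0)" using coord_vector_self[OF assms, of u] that by metis
    then show ?thesis using G T unfolding inner_product_on_tangent_space_def by blast
  qed
qed

text \<open>Smoothness of the metric is given for fixed coordinate vectors; the expansion in the
  basis yields continuity jointly in point and vector.\<close>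

lemma gram_expand:
  assumes "c \<in> A" "p \<in> fst c"
  shows "gram c p u u = (\<Sum>i\<in>Basis. \<Sum>j\<in>Basis. (u \<bullet> i) * (u \<bullet> j) * gram c p i j)"
proof -
  note G = gram[OF assms]
  have lin: "linear (\<lambda>u. gram c p u v)" for v by (rule linearI) (simp_all add: G(2,3))
  have lin': "linear (\<lambda>v. gram c p u v)" for u using lin[of u] G(1)[of u] by simp
  have "gram c p u u = (\<lambda>w. gram c p w u) (\<Sum>i\<in>Basis. (u \<bullet> i) *\<^sub>R i)"
    by (simp add: euclidean_representation)
  also have "\<dots> = (\<Sum>i\<in>Basis. (u \<bullet> i) * gram c p i u)"
    unfolding linear_sum[OF lin] by (simp add: G(3))
  also have "\<dots> = (\<Sum>i\<in>Basis. \<Sum>j\<in>Basis. (u \<bullet> i) * (u \<bullet> j) * gram c p i j)"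
  proof (rule sum.cong[OF refl])
    fix i :: 'b
    have "gram c p i u = (\<lambda>w. gram c p i w) (\<Sum>j\<in>Basis. (u \<bullet> j) *\<^sub>R j)"
      by (simp add: euclidean_representation)
    also have "\<dots> = (\<Sum>j\<in>Basis. (u \<bullet> j) * gram c p i j)"
      unfolding linear_sum[OF lin'] using linear_scale[OF lin', of i] by simp
    finally show "(u \<bullet> i) * gram c p i u = (\<Sum>j\<in>Basis. (u \<bullet> i) * (u \<bullet> j) * gram c p i j)"
      by (simp add: sum_distrib_left mult.assoc)
  qed
  finally show ?thesis .
qed

lemma gram_continuous:
  assumes "c \<in> A" shows "continuous_on (snd c ` fst c) (\<lambda>x. gram c (cinv c x) u v)"
proof -
  have "smooth_on (snd c ` fst c) (\<lambda>x. let p = inv_into (fst c) (snd c) x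
              in g p (coord_vector A c p u) (coord_vector A c p v))"
    using metric assms by (simp add: riemannian_metric_def)
  then have "Ck_on 0 (snd c ` fst c) (\<lambda>x. let p = inv_into (fst c) (snd c) x
              in g p (coord_vector A c p u) (coord_vector A c p v))"
    unfolding smooth_on_def by blast
  then show ?thesis by (simp add: Let_def cinv_def)
qed

abbreviation coord_norm :: "('a, 'b) chart \<Rightarrow> 'a \<Rightarrow> 'b \<Rightarrow> real" where
  "coord_norm c p u \<equiv> tangent_norm g p (coord_vector A c p u)"

abbreviation deriv_norm :: "('a \<Rightarrow> 'a) \<Rightarrow> 'a \<Rightarrow> real" where
  "deriv_norm h p \<equiv> tangent_onorm A g p (h p) (differential A h p)"

lemma tangent_norm_scale:
  assumes "c \<in> A" "p \<in> fst c"
  shows "coord_norm c p (r *\<^sub>R u) = \<bar>r\<bar> * coord_norm c p u"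
proof -
  have "gram c p (r *\<^sub>R u) (r *\<^sub>R u) = r\<^sup>2 * gram c p u u"
    using gram(1,3)[OF assms] by (simp add: power2_eq_square)
  then show ?thesis by (simp add: tangent_norm_def real_sqrt_mult)
qed

text \<open>The extreme values of the quadratic form over \<open>K\<close> times the unit sphere are
  positive by compactness and give the constants by homogeneity.\<close>

lemma norm_equivalence:
  assumes c: "c \<in> A" and K: "compact K" "K \<subseteq> fst c"
  obtains a b where "0 < a" "0 < b"
    "\<And>p u. p \<in> K \<Longrightarrow> a * norm u \<le> coord_norm c p u"
    "\<And>p u. p \<in> K \<Longrightarrow> coord_norm c p u \<le> b * norm u"
proof (cases "K = {}")
  case True
  then show ?thesis using that[of 1 1] by simp
next
  case False
  define q where "q z = (\<Sum>i\<in>Basis. \<Sum>j\<in>Basis. (snd z \<bullet> i) * (snd z \<bullet> j) * gram c (cinv c (fst z)) i j)"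
    for z :: "'b \<times> 'b"
  let ?Z = "snd c ` K \<times> sphere (0::'b) 1"
  have "continuous_on ?Z (\<lambda>z. gram c (cinv c (fst z)) i j)" for i j
    by (rule continuous_on_compose2[OF gram_continuous[OF c]]) (use K in \<open>auto intro!: continuous_intros\<close>)
  then have cont: "continuous_on ?Z q" unfolding q_def by (intro continuous_intros)
  have comp: "compact ?Z" by (intro compact_Times chart_image_compact[OF c K] compact_sphere)
  obtain e :: 'b where e: "norm e = 1" using norm_Basis SOME_Basis by blast
  then have ne: "?Z \<noteq> {}" using False by auto
  have q: "q (snd c p, u) = gram c p u u" if "p \<in> K" for p u
    using that K c by (simp add: q_def gram_expand[of c p u] subset_eq)
  obtain z0 where z0: "z0 \<in> ?Z" "\<And>z. z \<in> ?Z \<Longrightarrow> q z0 \<le> q z" using continuous_attains_inf[OF comp ne cont]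
    by blast
  obtain z1 where z1: "z1 \<in> ?Z" "\<And>z. z \<in> ?Z \<Longrightarrow> q z \<le> q z1" using continuous_attains_sup[OF comp ne cont]
    by blast
  have pos: "0 < q z" if "z \<in> ?Z" for z
  proof -
    obtain p u where "z = (snd c p, u)" "p \<in> K" "norm u = 1" using \<open>z \<in> ?Z\<close> by (cases z) auto
    moreover then have "u \<noteq> 0" by auto
    ultimately show ?thesis using q gram(4)[OF c] K by auto
  qed
  have bounds: "sqrt (q z0) * norm u \<le> coord_norm c p u \<and>
     coord_norm c p u \<le> sqrt (q z1) * norm u" if p: "p \<in> K" for p u
  proof (cases "u = 0")
    case True
    have "coord_norm c p (0 *\<^sub>R u) = 0"
      using tangent_norm_scale[OF c, of p 0 u] p K by auto
    then show ?thesis using True by simp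
  next
    case False
    let ?v = "(1 / norm u) *\<^sub>R u"
    have v: "norm ?v = 1" "u = norm u *\<^sub>R ?v" using False by auto
    have "(snd c p, ?v) \<in> ?Z" using p v by auto
    then have b: "q z0 \<le> gram c p ?v ?v" "gram c p ?v ?v \<le> q z1" using z0(2) z1(2) q[OF p] by metis+
    have "coord_norm c p u = norm u * sqrt (gram c p ?v ?v)"
      using tangent_norm_scale[OF c, of p "norm u" ?v] v(2) p K by (auto simp: tangent_norm_def)
    then show ?thesis using b by (simp add: mult.commute mult_left_mono)
  qed
  show ?thesis by (rule that[of "sqrt (q z0)" "sqrt (q z1)"]) (use pos z0(1) z1(1) bounds in auto)
qed

text \<open>The operator norm is a supremum of reals, meaningful only over a bounded set; the
  estimate behind the first claim supplies this boundedness for the second.\<close>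

lemma tangent_onorm_estimates:
  assumes f: "C1_map A f" and c: "c \<in> A" "p \<in> fst c" and d: "d \<in> A" "f p \<in> fst d"
    and ab: "0 < a1" "0 < b1" "0 < a2" "0 < b2"
    and p: "\<And>u. a1 * norm u \<le> coord_norm c p u"
      "\<And>u. coord_norm c p u \<le> b1 * norm u"
    and q: "\<And>u. a2 * norm u \<le> coord_norm d (f p) u"
      "\<And>u. coord_norm d (f p) u \<le> b2 * norm u"
  shows "deriv_norm f p \<le> b2 / a1 * norm (chart_deriv c f d p)"
    and "norm (chart_deriv c f d p) \<le> b1 / a2 * deriv_norm f p"
proof -
  let ?D = "chart_deriv c f d p" and ?U = "{\<xi> \<in> tangent_space A p. tangent_norm g p \<xi> \<le> 1}"
  let ?n = "\<lambda>\<xi>. tangent_norm g (f p) (differential A f p \<xi>)"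
  note diff = differential_coord_vector[OF f c d]
  have up: "?n \<xi> \<le> b2 / a1 * norm ?D" if \<xi>: "\<xi> \<in> ?U" for \<xi>
  proof -
    let ?u = "\<xi> c"
    have x: "\<xi> = coord_vector A c p ?u" using tangent_vector_coord[OF c] \<xi> by blast
    have "coord_norm c p ?u \<le> 1" using \<xi> x by simp
    then have "a1 * norm ?u \<le> 1" using p(1)[of ?u] by linarith
    then have u: "norm ?u \<le> 1 / a1" using ab(1) by (simp add: field_simps)
    have "differential A f p \<xi> = coord_vector A d (f p) (?D ?u)" using diff[of ?u] x by simp
    then have "?n \<xi> \<le> b2 * norm (?D ?u)" using q(2) by simp
    also have "\<dots> \<le> b2 * (norm ?D * (1 / a1))"
      using ab norm_blinfun[of ?D ?u] mult_left_mono[OF u norm_ge_zero[of ?D]]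
        by (intro mult_left_mono) auto
    finally show ?thesis by (simp add: field_simps)
  qed
  have bdd: "bdd_above (?n ` ?U)" using up by (intro bdd_aboveI2) auto
  have zero: "coord_vector A c p 0 \<in> ?U"
    using p(2)[of 0] coord_vector_tangent[OF c, of 0] by simp
  show "deriv_norm f p \<le> b2 / a1 * norm ?D"
    unfolding tangent_onorm_def by (rule cSUP_least) (use zero up in auto)
  let ?N = "deriv_norm f p"
  have low: "?n \<xi> \<le> ?N" if "\<xi> \<in> ?U" for \<xi>
    unfolding tangent_onorm_def by (rule cSUP_upper[OF that bdd])
  have N: "0 \<le> ?N"
  proof -
    have "a2 * norm (?D 0) \<le> ?n (coord_vector A c p 0)" using q(1)[of "?D 0"] diff[of 0] by simp
    then show ?thesis using low[OF zero] by (simp add: blinfun.zero_right)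
  qed
  show "norm ?D \<le> b1 / a2 * ?N"
  proof (rule norm_blinfun_bound)
    show "0 \<le> b1 / a2 * ?N" using ab N by simp
    fix u
    show "norm (?D u) \<le> b1 / a2 * ?N * norm u"
    proof (cases "u = 0")
      case False
      let ?v = "(1 / (b1 * norm u)) *\<^sub>R u"
      have "coord_norm c p ?v \<le> b1 * norm ?v" by (rule p(2))
      also have "\<dots> = 1" using False ab by simp
      finally have "coord_vector A c p ?v \<in> ?U" using coord_vector_tangent[OF c] by blast
      then have "?n (coord_vector A c p ?v) \<le> ?N" by (rule low)
      moreover have "a2 * norm (?D ?v) \<le> ?n (coord_vector A c p ?v)" using q(1)[of "?D ?v"] diff[of ?v]
        by simp
      moreover have "norm (?D ?v) = norm (?D u) / (b1 * norm u)"
        using ab by (simp add: blinfun.scaleR_right)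
      ultimately have "a2 * (norm (?D u) / (b1 * norm u)) \<le> ?N" by simp
      then show ?thesis using False ab by (simp add: field_simps)
    qed (simp add: blinfun.zero_right)
  qed
qed

end

section \<open>Finite sets: local boundedness of the differential\<close>

context riemannian_mfd
begin

lemma C1_topspace: "Diff1 A \<subseteq> topspace (C1_topology A)"
proof
  fix f assume f: "f \<in> Diff1 A"
  obtain c where c: "c \<in> A" using chart_exists by blast
  \<comment> \<open>With an empty compact set the conditions are vacuous and the subbasic set is all
    of \<open>Diff1 A\<close>.\<close>
  have "C1_open (C1_subbasic A f c c {} 1)" "f \<in> C1_subbasic A f c c {} 1"
    by (rule C1_subbasic_open; use f c in simp)+
  then show "f \<in> topspace (C1_topology A)" using openin_subset by blast
qed

text \<open>A subbasic set over the single point \<open>p\<close> controls value and derivative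
  there; its radius keeps \<open>h p\<close> in a compact coordinate ball on which the two norms are
  equivalent.\<close>

lemma locally_bounded_differential:
  assumes f: "f \<in> Diff1 A"
  obtains V B where "C1_open V" "f \<in> V"
    "\<And>h. h \<in> V \<Longrightarrow> deriv_norm h p \<le> B"
proof -
  obtain c d where cd: "c \<in> A" "p \<in> fst c" "d \<in> A" "f p \<in> fst d" using chart_exists by metis
  obtain e where e: "0 < e" "cball (snd d (f p)) e \<subseteq> snd d ` fst d"
    using chart_open_range[OF cd(3)] cd(4) by (meson imageI open_contains_cball)
  let ?K = "{x \<in> fst d. snd d x \<in> cball (snd d (f p)) e}"
  have K: "compact ?K" "?K \<subseteq> fst d" using chart_preimage_compact[OF cd(3) compact_cball e(2)] by auto
  obtain a2 b2 where 2: "0 < a2" "0 < b2" "\<And>q u. q \<in> ?K \<Longrightarrow> a2 * norm u \<le> coord_norm d q u"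
    "\<And>q u. q \<in> ?K \<Longrightarrow> coord_norm d q u \<le> b2 * norm u"
    by (rule norm_equivalence[OF cd(3) K]) (rule that)
  have p: "compact {p}" "{p} \<subseteq> fst c" "f ` {p} \<subseteq> fst d" using cd by auto
  obtain a1 b1 where 1: "0 < a1" "0 < b1" "\<And>q u. q \<in> {p} \<Longrightarrow> a1 * norm u \<le> coord_norm c q u"
    "\<And>q u. q \<in> {p} \<Longrightarrow> coord_norm c q u \<le> b1 * norm u"
    using norm_equivalence[OF cd(1) p(1,2)] by metis
  show ?thesis
  proof (rule that[OF C1_subbasic_open[OF f cd(1,3) p e(1)]])
    fix h assume "h \<in> C1_subbasic A f c d {p} e"
    then have h: "h \<in> Diff1 A" "h p \<in> fst d" "norm (snd d (h p) - snd d (f p)) < e"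
      "norm (chart_deriv c h d p - chart_deriv c f d p) < e"
      using C1_subbasic_iff[OF f cd(1,3) p(2,3)] by auto
    then have hK: "h p \<in> ?K" by (simp add: dist_norm norm_minus_commute)
    have "deriv_norm h p \<le> b2 / a1 * norm (chart_deriv c h d p)"
      by (rule tangent_onorm_estimates(1)[OF Diff1_C1[OF h(1)] cd(1-3) h(2) 1(1,2) 2(1,2)])
         (use 1(3,4) 2(3,4)[OF hK] in auto)
    also have "\<dots> \<le> b2 / a1 * (norm (chart_deriv c f d p) + e)"
    proof (rule mult_left_mono)
      have "norm (chart_deriv c h d p) \<le> norm (chart_deriv c f d p) + norm (chart_deriv c h d p - chart_deriv c f d p)" by norm
      then show "norm (chart_deriv c h d p) \<le> norm (chart_deriv c f d p) + e" using h(4) by linarith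
    qed (use 1 2 in auto)
    finally show "deriv_norm h p \<le> b2 / a1 * (norm (chart_deriv c f d p) + e)" .
  qed
qed

lemma finite_imp_bounded:
  assumes f: "f \<in> Diff1 A" and S: "finite S"
  shows "\<exists>\<U>. neighbourhood_in (C1_topology A) f \<U> \<and>
       (SUP (h, p)\<in>\<U> \<times> S. ereal (deriv_norm h p)) < \<infinity>"
proof -
  have "\<exists>V B. C1_open V \<and> f \<in> V \<and> (\<forall>h\<in>V. deriv_norm h p \<le> B)" for p
    using locally_bounded_differential[OF f] by metis
  then obtain V B where V: "\<And>p. C1_open (V p)" "\<And>p. f \<in> V p"
    "\<And>p h. h \<in> V p \<Longrightarrow> deriv_norm h p \<le> B p" by metis
  \<comment> \<open>For empty S the first intersection is \<open>UNIV\<close>, which need not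
    consist of diffeomorphisms.\<close>
  let ?U = "(\<Inter>p\<in>S. V p) \<inter> topspace (C1_topology A)"
  have op: "C1_open ?U" using openin_INT[OF S] V(1) by auto
  then have "neighbourhood_in (C1_topology A) f ?U"
    using V(2) f C1_topspace unfolding neighbourhood_in_def by blast
  moreover have "(SUP (h, p)\<in>?U \<times> S. ereal (deriv_norm h p)) \<le> ereal (\<Sum>p\<in>S. \<bar>B p\<bar>)"
  proof (rule SUP_least, clarify)
    fix h p assume "h \<in> (\<Inter>p\<in>S. V p)" "p \<in> S"
    then have "deriv_norm h p \<le> B p" using V(3) by blast
    also have "B p \<le> \<bar>B p\<bar>" by simp
    also have "\<bar>B p\<bar> \<le> (\<Sum>p\<in>S. \<bar>B p\<bar>)" using S \<open>p \<in> S\<close> by (intro member_le_sum) auto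
    finally show "ereal (deriv_norm h p) \<le> ereal (\<Sum>p\<in>S. \<bar>B p\<bar>)" by simp
  qed
  then have "(SUP (h, p)\<in>?U \<times> S. ereal (deriv_norm h p)) < \<infinity>"
    using order_le_less_trans by fastforce
  ultimately show ?thesis by blast
qed

end

subsection \<open>Prescribing the derivative along an orbit\<close>

lemma separate_finite:
  fixes y :: "'a::t2_space" assumes "finite F" "y \<notin> F"
  obtains U V where "open U" "open V" "y \<in> U" "F \<subseteq> V" "U \<inter> V = {}"
proof -
  have "\<exists>U V. open U \<and> open V \<and> y \<in> U \<and> F \<subseteq> V \<and> U \<inter> V = {}"
    using assms
  proof (induction F)
    case empty
    then show ?case by (intro exI[of _ UNIV] exI[of _ "{}"]) auto
  next
    case (insert x F)
    then obtain U V where UV: "open U" "open V" "y \<in> U" "F \<subseteq> V" "U \<inter> V = {}" by auto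
    obtain U' V' where UV': "open U'" "open V'" "y \<in> U'" "x \<in> V'" "U' \<inter> V' = {}"
      using insert.prems by (metis hausdorff insertI1)
    show ?case by (intro exI[of _ "U \<inter> U'"] exI[of _ "V \<union> V'"]) (use UV UV' in auto)
  qed
  then show ?thesis using that by blast
qed

context finite_cover
begin

text \<open>No continuity is expected of this choice; later estimates are uniform over the finitely
  many pairs of charts instead.\<close>

definition kap :: "'a \<Rightarrow> 'a" where
  "kap x = (SOME i. i \<in> I \<and> x \<in> fst (C i) \<and> snd (C i) x \<in> ball (snd (C i) i) (R i))"

abbreviation dom_at :: "'a \<Rightarrow> 'a set" where
  "dom_at x \<equiv> fst (C (kap x))"

abbreviation disp :: "'a \<Rightarrow> 'a \<Rightarrow> 'b" where
  "disp x y \<equiv> snd (C (kap x)) y - snd (C (kap x)) x"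

lemma kap: "kap x \<in> I" "x \<in> dom_at x" "snd (C (kap x)) x \<in> ball (snd (C (kap x)) (kap x)) (R (kap x))"
proof -
  have "kap x \<in> I \<and> x \<in> dom_at x \<and> snd (C (kap x)) x \<in> ball (snd (C (kap x)) (kap x)) (R (kap x))"
    unfolding kap_def by (rule someI_ex) (use cover[of x] in blast)
  then show "kap x \<in> I" "x \<in> dom_at x" "snd (C (kap x)) x \<in> ball (snd (C (kap x)) (kap x)) (R (kap x))"
    by auto
qed

lemma kap_disc: "x \<in> disc (kap x) 1"
  using kap[of x] ball_subset_cball by (auto simp: disc_def)

lemma chart_deriv_id_cong:
  assumes "c \<in> A" "x \<in> fst c" "open V" "x \<in> V" "\<And>y. y \<in> V \<Longrightarrow> \<phi> y = y"
  shows "chart_deriv c \<phi> c x = id_blinfun"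
  using chart_deriv_cong[OF assms(1-4), of \<phi> id c] chart_deriv_id[OF assms(1,2)] assms(5) by simp

text \<open>\<open>B\<close> contains the support, and its invariance lets bumps with disjoint
  supports be composed independently. Bumps with a = 0 prescribe a derivative at \<open>y\<close>; a
  nonzero \<open>a\<close> serves to break a return to \<open>y\<close>.\<close>

definition bump :: "real \<Rightarrow> 'a \<Rightarrow> 'a \<Rightarrow> 'a set \<Rightarrow> ('b \<Rightarrow>\<^sub>L 'b) \<Rightarrow> 'b \<Rightarrow> ('a \<Rightarrow> 'a) \<Rightarrow> bool" where
  "bump \<epsilon> i y B L a b \<longleftrightarrow> locally_near_id \<epsilon> b \<and> (\<forall>x. x \<notin> B \<longrightarrow> b x = x) \<and> (\<forall>x\<in>B. b x \<in> B) \<and>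
     b y \<in> fst (C i) \<and> snd (C i) (b y) = snd (C i) y + a \<and>
     (a = 0 \<longrightarrow> b y = y \<and> chart_deriv (C i) b (C i) y = id_blinfun + L)"

text \<open>For a = 0 the size condition does not involve \<rho>, so the support fits into any V
  without restricting the admissible linear parts further.\<close>

lemma bump_diffeo:
  assumes i: "i \<in> I" and y: "y \<in> fst (C i)" "snd (C i) y \<in> ball (snd (C i) i) (R i)"
    and V: "open V" "y \<in> V" and \<epsilon>: "0 < \<epsilon>" "\<epsilon> \<le> 1 / 2"
  obtains \<rho> B where "0 < \<rho>" "compact B" "B \<subseteq> V" "y \<in> B"
    "\<And>L a. 5 * norm L + 5 * norm a / \<rho> \<le> \<epsilon> \<Longrightarrow> \<exists>b. bump \<epsilon> i y B L a b"
proof -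
  let ?c = "C i" and ?z = "snd (C i) y"
  note c = C[OF i]
  have "open (snd ?c ` (fst ?c \<inter> V) \<inter> ball (snd ?c i) (R i))"
    using chart_image_open[OF c, of "fst ?c \<inter> V"] chart_open[OF c] V(1) by auto
  moreover have "?z \<in> snd ?c ` (fst ?c \<inter> V) \<inter> ball (snd ?c i) (R i)" using y V(2) by auto
  ultimately obtain \<rho>0 where r0: "0 < \<rho>0" "cball ?z \<rho>0 \<subseteq> snd ?c ` (fst ?c \<inter> V) \<inter> ball (snd ?c i) (R i)"
    by (meson open_contains_cball)
  \<comment> \<open>\<rho> \<le> 1 turns the displacement bound \<epsilon> * \<rho> of the bump into
    \<epsilon>.\<close>
  define \<rho> where "\<rho> = min \<rho>0 1"
  have \<rho>: "0 < \<rho>" "\<rho> \<le> 1" "cball ?z \<rho> \<subseteq> snd ?c ` (fst ?c \<inter> V) \<inter> ball (snd ?c i) (R i)"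
    using r0 by (auto simp: \<rho>_def)
  then have sub: "cball ?z \<rho> \<subseteq> snd ?c ` fst ?c" by blast
  define B where "B = {x \<in> fst ?c. snd ?c x \<in> cball ?z \<rho>}"
  have BV: "B \<subseteq> V"
  proof
    fix x assume x: "x \<in> B"
    then obtain x' where "x' \<in> fst ?c" "x' \<in> V" "snd ?c x = snd ?c x'" using \<rho>(3) unfolding B_def
      by blast
    then have "x = x'" using cinv_chart[OF c] x unfolding B_def
      by (metis (no_types, lifting) mem_Collect_eq)
    then show "x \<in> V" using \<open>x' \<in> V\<close> by simp
  qed
  have Bc: "compact B" unfolding B_def by (rule chart_preimage_compact[OF c compact_cball sub])
  have Bd: "B \<subseteq> disc i 1" using \<rho>(3) ball_subset_cball unfolding B_def disc_def by fastforce
  have yB: "y \<in> B" using y \<rho>(1) by (simp add: B_def)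
  show ?thesis
  proof (rule that[OF \<rho>(1) Bc BV yB])
    fix L :: "'b \<Rightarrow>\<^sub>L 'b" and a :: 'b assume La: "5 * norm L + 5 * norm a / \<rho> \<le> \<epsilon>"
    obtain \<beta> where \<beta>: "bij \<beta>" "C1_on UNIV \<beta>" "C1_on UNIV (inv \<beta>)"
      "\<And>w. w \<notin> ball ?z \<rho> \<Longrightarrow> \<beta> w = w" "\<beta> ?z = ?z + a" "a = 0 \<Longrightarrow> fderiv \<beta> ?z = id_blinfun + L"
      "\<And>w. norm (\<beta> w - w) \<le> \<epsilon> * \<rho>" "\<And>w. norm (fderiv \<beta> w - id_blinfun) \<le> \<epsilon>"
      using bump_exists[OF \<rho>(1) La \<epsilon>(2), of ?z] by metis
    let ?b = "transplant ?c \<beta>"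
    have fix_out: "\<forall>w. w \<notin> ball ?z \<rho> \<longrightarrow> \<beta> w = w" using \<beta>(4) by blast
    note T = transplant[OF c sub \<beta>(1,2) fix_out]
    have bD: "?b \<in> Diff1 A" by (rule transplant_Diff1[OF c sub \<beta>(1-3) fix_out])
    have out: "?b x = x" if "x \<notin> B" for x
      using that ball_subset_cball by (intro T(2)) (auto simp: B_def)
    have inB: "?b x \<in> B" if "x \<in> B" for x
    proof (cases "snd ?c x \<in> ball ?z \<rho>")
      case True
      have "\<beta> (snd ?c x) \<in> ball ?z \<rho>" using \<beta>(4)[of "\<beta> (snd ?c x)"] True \<beta>(1) by (metis bij_def injD)
      then show ?thesis using T(1)[of x] that ball_subset_cball by (auto simp: B_def)
    next
      case False
      then show ?thesis using T(2)[of x] that by simp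
    qed
    have lni: "locally_near_id \<epsilon> ?b"
      unfolding locally_near_id_def
    proof (intro conjI allI bD)
      fix x
      show "\<exists>j\<in>I. x \<in> disc j 1 \<and> C1_close \<epsilon> (C j) (C j) id ?b x"
      proof (cases "x \<in> B")
        case True
        then have x: "x \<in> fst ?c" by (simp add: B_def)
        have "\<epsilon> * \<rho> \<le> \<epsilon>" using \<epsilon> \<rho>(1,2) by (simp add: mult_le_cancel_left1)
        then have "norm (snd ?c (?b x) - snd ?c x) \<le> \<epsilon>" using T(1)[OF x] \<beta>(7)[of "snd ?c x"] by simp
        moreover have "norm (chart_deriv ?c ?b ?c x - id_blinfun) \<le> \<epsilon>" using T(4)[OF x] \<beta>(8) by simp
        ultimately show ?thesis using i True Bd T(1)[OF x] C1_close_id_iff[OF c x] by blast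
      next
        case False
        have "open (- B)" using Bc by (simp add: compact_imp_closed open_Compl)
        then have "chart_deriv (C (kap x)) ?b (C (kap x)) x = id_blinfun"
          by (intro chart_deriv_id_cong[OF C[OF kap(1)] kap(2)]) (use False out in auto)
        then show ?thesis using kap[of x] kap_disc[of x] out[OF False] \<epsilon>(1)
          by (intro bexI[of _ "kap x"]) (auto simp: C1_close_id_iff[OF C])
      qed
    qed
    have b_y: "?b y \<in> fst ?c" "snd ?c (?b y) = ?z + a" using T(1)[OF y(1)] \<beta>(5) by auto
    have "?b y = y" if "a = 0" using b_y that cinv_chart[OF c] y(1) by (metis add.right_neutral)
    moreover have "chart_deriv ?c ?b ?c y = id_blinfun + L" if "a = 0" using T(4)[OF y(1)] \<beta>(6) that
      by simp
    ultimately show "\<exists>b. bump \<epsilon> i y B L a b"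
      unfolding bump_def using out inB lni b_y by (intro exI[of _ ?b]) auto
  qed
qed

text \<open>At each point at most one bump acts and \<open>locally_near_id\<close> is a pointwise
  condition, so \<epsilon> does not deteriorate with the number of points. V varies in the induction
  to keep the new support away from the old ones.\<close>

lemma multi_bump:
  fixes y :: "nat \<Rightarrow> 'a" and i :: "nat \<Rightarrow> 'a" and L :: "nat \<Rightarrow> 'b \<Rightarrow>\<^sub>L 'b"
  assumes "finite J" "inj_on y J" and \<epsilon>: "0 < \<epsilon>" "\<epsilon> \<le> 1 / 2"
    and "\<And>j. j \<in> J \<Longrightarrow> i j \<in> I \<and> y j \<in> fst (C (i j)) \<and> snd (C (i j)) (y j) \<in> ball (snd (C (i j)) (i j)) (R (i j))"
    and "\<And>j. j \<in> J \<Longrightarrow> 5 * norm (L j) \<le> \<epsilon>" and "open V" "y ` J \<subseteq> V"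
  shows "\<exists>\<phi> B. locally_near_id \<epsilon> \<phi> \<and> compact B \<and> B \<subseteq> V \<and> (\<forall>x. x \<notin> B \<longrightarrow> \<phi> x = x) \<and>
     (\<forall>j\<in>J. \<phi> (y j) = y j \<and> chart_deriv (C (i j)) \<phi> (C (i j)) (y j) = id_blinfun + L j)"
  using assms(1,2,5-8)
proof (induction J arbitrary: V)
  case empty
  have "locally_near_id \<epsilon> id" unfolding locally_near_id_def
  proof (intro conjI allI Diff1_id)
    fix x
    show "\<exists>i\<in>I. x \<in> disc i 1 \<and> C1_close \<epsilon> (C i) (C i) id id x"
      using kap[of x] kap_disc[of x] \<epsilon> by (intro bexI[of _ "kap x"]) (auto simp: C1_close_def)
  qed
  moreover have "\<forall>x. x \<notin> {} \<longrightarrow> id x = x" by simp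
  ultimately show ?case using compact_empty by blast
next
  case (insert j J)
  have yJ: "y j \<notin> y ` J" "inj_on y J" using insert.hyps(2) insert.prems(1)
    by (simp_all add: inj_on_insert)
  then obtain U U' where U: "open U" "open U'" "y j \<in> U" "y ` J \<subseteq> U'" "U \<inter> U' = {}"
    using separate_finite[of "y ` J" "y j"] insert.hyps(1) yJ(1) by (metis finite_imageI)
  have VU': "open (V \<inter> U')" "y ` J \<subseteq> V \<inter> U'" using insert.prems(4,5) U(2,4) by (auto intro: open_Int)
  then obtain \<phi> B where \<phi>: "locally_near_id \<epsilon> \<phi>" "compact B" "B \<subseteq> V \<inter> U'" "\<And>x. x \<notin> B \<Longrightarrow> \<phi> x = x"
     "\<And>k. k \<in> J \<Longrightarrow> \<phi> (y k) = y k \<and> chart_deriv (C (i k)) \<phi> (C (i k)) (y k) = id_blinfun + L k"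
    using insert.IH[OF yJ(2) _ _ VU'] insert.prems(2,3) by (metis insertCI)
  have ij: "i j \<in> I" "y j \<in> fst (C (i j))" "snd (C (i j)) (y j) \<in> ball (snd (C (i j)) (i j)) (R (i j))"
    using insert.prems(2) by auto
  have oV: "open (V \<inter> U)" "y j \<in> V \<inter> U" using insert.prems(4,5) U by auto
  obtain \<rho> B' where B': "0 < \<rho>" "compact B'" "B' \<subseteq> V \<inter> U" "y j \<in> B'"
    "\<And>L a. 5 * norm L + 5 * norm a / \<rho> \<le> \<epsilon> \<Longrightarrow> \<exists>b. bump \<epsilon> (i j) (y j) B' L a b"
    by (rule bump_diffeo[OF ij oV \<epsilon>]) (rule that)
  have "5 * norm (L j) + 5 * norm (0::'b) / \<rho> \<le> \<epsilon>" using insert.prems(3)[of j] by simp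
  from B'(5)[OF this] obtain b where b: "\<And>x. x \<notin> B' \<Longrightarrow> b x = x" "\<And>x. x \<in> B' \<Longrightarrow> b x \<in> B'"
    "locally_near_id \<epsilon> b" "b (y j) = y j" "chart_deriv (C (i j)) b (C (i j)) (y j) = id_blinfun + L j"
    unfolding bump_def by blast
  have bD: "b \<in> Diff1 A" using b(3) by (simp add: locally_near_id_def)
  have \<phi>D: "\<phi> \<in> Diff1 A" using \<phi>(1) by (simp add: locally_near_id_def)
  let ?\<psi> = "\<phi> \<circ> b"
  \<comment> \<open>b maps U to itself, and \<phi> moves only points of U', which is disjoint from
    U.\<close>
  have on_U: "?\<psi> x = b x" if "x \<in> U" for x
  proof -
    have "b x \<in> U" using b(1,2) B'(3) that by (cases "x \<in> B'") auto
    then show ?thesis using \<phi>(3,4) U(5) by auto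
  qed
  have off: "?\<psi> x = \<phi> x" if "x \<in> - B'" for x using b(1) that by simp
  have oB': "open (- B')" using B'(2) by (simp add: compact_imp_closed open_Compl)
  have cong: "chart_deriv c ?\<psi> c x = chart_deriv c b c x" if "c \<in> A" "x \<in> fst c" "x \<in> U" for c x
    by (rule chart_deriv_cong[OF that(1,2) U(1) that(3)]) (use on_U in auto)
  have cong': "chart_deriv c ?\<psi> c x = chart_deriv c \<phi> c x" if "c \<in> A" "x \<in> fst c" "x \<in> - B'" for c x
    by (rule chart_deriv_cong[OF that(1,2) oB' that(3)]) (use off in auto)
  have lni: "locally_near_id \<epsilon> ?\<psi>" unfolding locally_near_id_def
  proof (intro conjI allI Diff1_compose bD \<phi>D)
    fix x
    show "\<exists>i\<in>I. x \<in> disc i 1 \<and> C1_close \<epsilon> (C i) (C i) id ?\<psi> x"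
    proof (cases "x \<in> B'")
      case True
      then have xU: "x \<in> U" using B'(3) by auto
      obtain k where k: "k \<in> I" "x \<in> disc k 1" "C1_close \<epsilon> (C k) (C k) id b x"
        using b(3) unfolding locally_near_id_def by blast
      then show ?thesis unfolding C1_close_def
        using cong[OF C[OF k(1)] subsetD[OF disc_subset k(2)] xU] on_U[OF xU] by metis
    next
      case False
      then have xB: "x \<in> - B'" by simp
      obtain k where k: "k \<in> I" "x \<in> disc k 1" "C1_close \<epsilon> (C k) (C k) id \<phi> x"
        using \<phi>(1) unfolding locally_near_id_def by blast
      then show ?thesis unfolding C1_close_def
        using cong'[OF C[OF k(1)] subsetD[OF disc_subset k(2)] xB] off[OF xB] by metis
    qed
  qed
  moreover have "compact (B \<union> B')" "B \<union> B' \<subseteq> V" using \<phi>(2,3) B'(2,3) by auto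
  moreover have "?\<psi> x = x" if "x \<notin> B \<union> B'" for x using that \<phi>(4) b(1) by auto
  moreover have "?\<psi> (y k) = y k \<and> chart_deriv (C (i k)) ?\<psi> (C (i k)) (y k) = id_blinfun + L k" if
    "k \<in> insert j J" for k
  proof (cases "k = j")
    case True
    then show ?thesis using cong[OF C[OF ij(1)] ij(2) U(3)] on_U[OF U(3)] b(4,5) by simp
  next
    case False
    then have k: "k \<in> J" using that by simp
    then have "y k \<in> - B'" using U(4,5) B'(3) by auto
    moreover have "i k \<in> I" "y k \<in> fst (C (i k))" using insert.prems(2) that by auto
    ultimately show ?thesis using cong'[OF C] off \<phi>(5)[OF k] by simp
  qed
  ultimately show ?case by blast
qed

text \<open>Whenever the orbit of \<open>p\<close> closes up for the first time, a small bump at \<open>p\<close> destroys this return.\<close>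

lemma avoid_return:
  assumes W: "C1_open W" "f \<in> W"
  shows "\<exists>h\<in>W. \<forall>j\<in>{1..n}. (h ^^ j) p \<noteq> p"
proof (induction n)
  case 0
  then show ?case using W(2) by auto
next
  case (Suc n)
  then obtain h where h: "h \<in> W" "\<And>j. j \<in> {1..n} \<Longrightarrow> (h ^^ j) p \<noteq> p" by blast
  show ?case
  proof (cases "(h ^^ Suc n) p = p")
    case False
    then show ?thesis using h by (intro bexI[of _ h] ballI) (metis atLeastAtMost_iff le_SucE)
  next
    case True
    obtain U \<epsilon>0 where "h \<in> U" "0 < \<epsilon>0" "\<forall>h\<in>U. \<forall>\<phi>. near_id \<epsilon>0 \<phi> \<longrightarrow> \<phi> \<circ> h \<in> W"
      using compose_open[OF W(1) h(1)] by blast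
    then have e0: "0 < \<epsilon>0" "\<And>\<phi>. near_id \<epsilon>0 \<phi> \<Longrightarrow> \<phi> \<circ> h \<in> W" by auto
    obtain \<delta> where \<delta>: "0 < \<delta>" "\<And>\<phi>. locally_near_id \<delta> \<phi> \<Longrightarrow> near_id \<epsilon>0 \<phi>"
      using locally_near_id_imp[OF e0(1)] by blast
    define \<epsilon> where "\<epsilon> = min \<delta> (1/2)"
    have \<epsilon>: "0 < \<epsilon>" "\<epsilon> \<le> 1/2" "\<epsilon> \<le> \<delta>" using \<delta>(1) by (auto simp: \<epsilon>_def)
    \<comment> \<open>A support avoiding the points h^j(p) with 1 \<le> j \<le> n leaves the orbit
      unchanged up to time n; at time n + 1 it would be back at p and is sent to b p
      instead.\<close>
    let ?V = "- ((\<lambda>j. (h ^^ j) p) ` {1..n})"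
    have V: "open ?V" by (simp add: finite_imp_closed open_Compl)
    have pV: "p \<in> ?V"
    proof
      assume "p \<in> (\<lambda>j. (h ^^ j) p) ` {1..n}"
      then obtain j where j: "p = (h ^^ j) p" "j \<in> {1..n}" by (rule imageE)
      from h(2)[OF j(2)] j(1)[symmetric] show False by (rule notE)
    qed
    obtain \<rho> B where B: "0 < \<rho>" "B \<subseteq> ?V"
      "\<And>L a. 5 * norm L + 5 * norm a / \<rho> \<le> \<epsilon> \<Longrightarrow> \<exists>b. bump \<epsilon> (kap p) p B L a b"
      by (rule bump_diffeo[OF kap(1,2,3) V pV \<epsilon>(1,2)]) (rule that)
    obtain e :: 'b where e: "norm e = 1" using norm_Basis SOME_Basis by blast
    \<comment> \<open>The longest shift allowed: 5 * norm a / \<rho> equals \<epsilon>.\<close>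
    define a where "a = (\<epsilon> * \<rho> / 5) *\<^sub>R e"
    have a: "a \<noteq> 0" using e \<epsilon>(1) B(1) by (auto simp: a_def)
    have "5 * norm (0 :: 'b \<Rightarrow>\<^sub>L 'b) + 5 * norm a / \<rho> \<le> \<epsilon>" using e \<epsilon>(1) B(1) by (simp add: a_def)
    from B(3)[OF this] obtain b where b: "\<And>x. x \<notin> B \<Longrightarrow> b x = x" "locally_near_id \<epsilon> b"
      "snd (C (kap p)) (b p) = snd (C (kap p)) p + a" unfolding bump_def by blast
    have "locally_near_id \<delta> b" by (rule locally_near_id_mono[OF b(2) \<epsilon>(3)])
    then have bW: "b \<circ> h \<in> W" using \<delta>(2) e0(2) by blast
    have eq: "((b \<circ> h) ^^ j) p = (h ^^ j) p" if "j \<le> n" for j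
      using that
    proof (induction j)
      case (Suc j)
      have "(h ^^ Suc j) p \<notin> B" using B(2) Suc.prems
        by (metis ComplD atLeastAtMost_iff imageI le_add1 plus_1_eq_Suc subsetD)
      then show ?case using Suc b(1) by simp
    qed simp
    have "((b \<circ> h) ^^ Suc n) p = b p" using eq[of n] True by simp
    moreover have "b p \<noteq> p" using b(3) a by auto
    ultimately have "((b \<circ> h) ^^ j) p \<noteq> p" if "j \<in> {1..Suc n}" for j
      using that eq[of j] h(2)[of j] by (cases "j = Suc n") auto
    then show ?thesis using bW by blast
  qed
qed

end

section \<open>Dependence of finite orbit segments on the diffeomorphism\<close>

context closed_mfd
begin

text \<open>A subbasic set controls h only on a compact coordinate ball about f^n(p). The induction
  hypothesis is therefore used with min \<eta> r, which brings h^n(p) into that ball; one \<eta> / 2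
  pays for the distance of h to f, the other for the variation of f over the ball.\<close>

lemma nearby_orbits:
  assumes f: "f \<in> Diff1 A" and c: "\<And>j. c j \<in> A" "\<And>j. (f ^^ j) p \<in> fst (c j)" and \<eta>: "0 < \<eta>"
  shows "\<exists>W. C1_open W \<and> f \<in> W \<and> (\<forall>h\<in>W.
     (\<forall>j\<le>n. (h ^^ j) p \<in> fst (c j) \<and> norm (snd (c j) ((h ^^ j) p) - snd (c j) ((f ^^ j) p)) < \<eta>) \<and>
     (\<forall>j<n. norm (chart_deriv (c j) h (c (Suc j)) ((h ^^ j) p) - chart_deriv (c j) f (c (Suc j)) ((f ^^ j) p)) < \<eta>))"
  using \<eta>
proof (induction n arbitrary: \<eta>)
  case 0
  have "C1_open (C1_subbasic A f (c 0) (c 0) {} 1)" "f \<in> C1_subbasic A f (c 0) (c 0) {} 1"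
    by (rule C1_subbasic_open; use f c in simp)+
  then show ?case using c(2)[of 0] 0 by (intro exI[of _ "C1_subbasic A f (c 0) (c 0) {} 1"]) auto
next
  case (Suc n)
  let ?x = "(f ^^ n) p" and ?c = "c n" and ?d = "c (Suc n)"
  let ?\<Omega> = "snd ?c ` (fst ?c \<inter> f -` fst ?d)"
  note f' = Diff1_C1[OF f]
  have x: "?x \<in> fst ?c" "f ?x \<in> fst ?d" using c(2)[of n] c(2)[of "Suc n"] by auto
  have sx: "compact {snd ?c ?x}" "{snd ?c ?x} \<subseteq> ?\<Omega>" using x by auto
  have \<eta>2: "0 < \<eta> / 2" using Suc.prems by simp
  obtain r where r: "0 < r" "cball (snd ?c ?x) r \<subseteq> ?\<Omega>"
    "\<And>u. u \<in> cball (snd ?c ?x) r \<Longrightarrow> norm (local_rep ?c f ?d u - local_rep ?c f ?d (snd ?c ?x)) \<le> \<eta> / 2"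
    "\<And>u. u \<in> cball (snd ?c ?x) r \<Longrightarrow> norm (fderiv (local_rep ?c f ?d) u - fderiv (local_rep ?c f ?d) (snd ?c ?x)) \<le> \<eta> / 2"
    using C1_uniform[OF C1_map_domain_open(2)[OF f' c(1) c(1)] C1_map_local_rep[OF f' c(1) c(1)] sx \<eta>2]
      by (metis singletonI)
  let ?K = "{y \<in> fst ?c. snd ?c y \<in> cball (snd ?c ?x) r}"
  have sub: "cball (snd ?c ?x) r \<subseteq> snd ?c ` fst ?c" using r(2) by blast
  have K: "compact ?K" "?K \<subseteq> fst ?c" using chart_preimage_compact[OF c(1) compact_cball sub] by auto
  have Kd: "f ` ?K \<subseteq> fst ?d"
  proof
    fix z assume "z \<in> f ` ?K"
    then obtain y where y: "y \<in> fst ?c" "snd ?c y \<in> cball (snd ?c ?x) r" "z = f y" by blast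
    then obtain y' where y': "y' \<in> fst ?c" "f y' \<in> fst ?d" "snd ?c y = snd ?c y'" using r(2) by blast
    then have "y = y'" using cinv_chart[OF c(1)] y(1) by metis
    then show "z \<in> fst ?d" using y' y(3) by simp
  qed
  let ?W = "C1_subbasic A f ?c ?d ?K (\<eta> / 2)"
  have W: "C1_open ?W" "f \<in> ?W" using C1_subbasic_open[OF f c(1) c(1) K Kd \<eta>2] by auto
  have "0 < min \<eta> r" using Suc.prems r(1) by simp
  from Suc.IH[OF this] obtain V where V: "C1_open V" "f \<in> V" "\<And>h. h \<in> V \<Longrightarrow>
     (\<forall>j\<le>n. (h ^^ j) p \<in> fst (c j) \<and> norm (snd (c j) ((h ^^ j) p) - snd (c j) ((f ^^ j) p)) < min \<eta> r) \<and>
     (\<forall>j<n. norm (chart_deriv (c j) h (c (Suc j)) ((h ^^ j) p) - chart_deriv (c j) f (c (Suc j)) ((f ^^ j) p)) < min \<eta> r)"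
    by blast
  have main: "(h ^^ Suc n) p \<in> fst ?d \<and> norm (snd ?d ((h ^^ Suc n) p) - snd ?d ((f ^^ Suc n) p)) < \<eta> \<and>
     norm (chart_deriv ?c h ?d ((h ^^ n) p) - chart_deriv ?c f ?d ?x) < \<eta>" if h: "h \<in> V \<inter> ?W" for h
  proof -
    let ?y = "(h ^^ n) p"
    have "?y \<in> fst ?c" "norm (snd ?c ?y - snd ?c ?x) < r" using V(3)[of h] h by auto
    then have y: "?y \<in> ?K" by (simp add: dist_norm norm_minus_commute)
    then have hy: "h ?y \<in> fst ?d" "norm (snd ?d (h ?y) - snd ?d (f ?y)) < \<eta> / 2"
        "norm (chart_deriv ?c h ?d ?y - chart_deriv ?c f ?d ?y) < \<eta> / 2"
      using h C1_subbasic_iff[OF f c(1) c(1) K(2) Kd] by blast+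
    have y1: "norm (snd ?d (f ?y) - snd ?d (f ?x)) \<le> \<eta> / 2"
      using r(3)[of "snd ?c ?y"] y x(1) by (simp add: local_rep_apply[OF c(1)])
    have y2: "norm (chart_deriv ?c f ?d ?y - chart_deriv ?c f ?d ?x) \<le> \<eta> / 2"
      using r(4)[of "snd ?c ?y"] y by (simp add: chart_deriv_def)
    have "norm (snd ?d (h ?y) - snd ?d (f ?x)) \<le> norm (snd ?d (h ?y) - snd ?d (f ?y)) + norm (snd ?d (f ?y) - snd ?d (f ?x))"
      "norm (chart_deriv ?c h ?d ?y - chart_deriv ?c f ?d ?x)
        \<le> norm (chart_deriv ?c h ?d ?y - chart_deriv ?c f ?d ?y) + norm (chart_deriv ?c f ?d ?y - chart_deriv ?c f ?d ?x)"
      by norm+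
    then show ?thesis using hy y1 y2 by simp
  qed
  show ?case
  proof (intro exI[of _ "V \<inter> ?W"] conjI ballI allI impI)
    fix h j assume h: "h \<in> V \<inter> ?W"
    { assume "j \<le> Suc n"
      then show "(h ^^ j) p \<in> fst (c j)" "norm (snd (c j) ((h ^^ j) p) - snd (c j) ((f ^^ j) p)) < \<eta>"
        using main[OF h] V(3)[of h] h by (cases "j = Suc n"; auto)+ }
    { assume "j < Suc n"
      then show "norm (chart_deriv (c j) h (c (Suc j)) ((h ^^ j) p) - chart_deriv (c j) f (c (Suc j)) ((f ^^ j) p)) < \<eta>"
        using main[OF h] V(3)[of h] h by (cases "j = n") auto }
  qed (use V(1,2) W in auto)
qed

lemma chart_deriv_funpow:
  assumes "h \<in> Diff1 A" "\<And>j. c j \<in> A" "\<And>j. j \<le> n \<Longrightarrow> (h ^^ j) p \<in> fst (c j)"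
    and "\<And>j. j < n \<Longrightarrow> chart_deriv (c j) h (c (Suc j)) ((h ^^ j) p) = P j o\<^sub>L T j"
  shows "chart_deriv (c 0) (h ^^ n) (c n) p = pert_prod P T n"
  using assms(2-4)
proof (induction n arbitrary: c p P T)
  case 0
  then show ?case using chart_deriv_id[of "c 0" p] by (simp add: id_def)
next
  case (Suc n)
  have IH: "chart_deriv (c (Suc 0)) (h ^^ n) (c (Suc n)) (h p) = pert_prod (\<lambda>j. P (Suc j)) (\<lambda>j. T (Suc j)) n"
  proof (rule Suc.IH)
    fix j assume "j \<le> n" then show "(h ^^ j) (h p) \<in> fst (c (Suc j))" using Suc.prems(2)[of "Suc j"]
      by (simp add: funpow_swap1)
  next
    fix j assume "j < n"
    then show "chart_deriv (c (Suc j)) h (c (Suc (Suc j))) ((h ^^ j) (h p)) = P (Suc j) o\<^sub>L T (Suc j)"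
      using Suc.prems(3)[of "Suc j"] by (simp add: funpow_swap1)
  qed (rule Suc.prems(1))
  have "h ^^ Suc n = (h ^^ n) \<circ> h" by (simp add: funpow_swap1 fun_eq_iff)
  then have A: "chart_deriv (c 0) (h ^^ Suc n) (c (Suc n)) p
     = chart_deriv (c (Suc 0)) (h ^^ n) (c (Suc n)) (h p) o\<^sub>L chart_deriv (c 0) h (c (Suc 0)) p"
    using chart_deriv_compose[OF Diff1_C1[OF assms(1)] Diff1_C1[OF Diff1_funpow[OF assms(1)]] Suc.prems(1) Suc.prems(1) Suc.prems(1), of p 0 "Suc 0" n "Suc n"]
      Suc.prems(2)[of 0] Suc.prems(2)[of "Suc 0"] Suc.prems(2)[of "Suc n"] by (simp add: funpow_swap1)
  have "chart_deriv (c 0) h (c (Suc 0)) p = P 0 o\<^sub>L T 0" using Suc.prems(3)[of 0] by simp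
  then show ?case unfolding A IH pert_prod.simps by simp
qed

end

text \<open>Transfers bounds from orbits without repetitions to the orbit of \<open>f\<close>
  itself.\<close>

lemma tendsto_pert_prod:
  assumes "\<And>j. j < n \<Longrightarrow> ((\<lambda>m. T m j) \<longlongrightarrow> T' j) F"
  shows "((\<lambda>m. pert_prod P (T m) n) \<longlongrightarrow> pert_prod P T' n) F"
  using assms
proof (induction n arbitrary: P T T')
  case (Suc n)
  have "((\<lambda>m. pert_prod (\<lambda>j. P (Suc j)) (\<lambda>j. T m (Suc j)) n) \<longlongrightarrow> pert_prod (\<lambda>j. P (Suc j)) (\<lambda>j. T' (Suc j)) n) F"
    by (rule Suc.IH) (use Suc.prems in auto)
  then show ?case
    unfolding pert_prod.simps
    by (intro bounded_bilinear.tendsto[OF bounded_bilinear_blinfun_compose] tendsto_const) (use Suc.prems in auto)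
qed simp

section \<open>Robust boundedness of the derivative products\<close>

context finite_cover
begin

abbreviation orbit_deriv :: "('a \<Rightarrow> 'a) \<Rightarrow> 'a \<Rightarrow> nat \<Rightarrow> 'b \<Rightarrow>\<^sub>L 'b" where
  "orbit_deriv f p j \<equiv> chart_deriv (C (kap ((f ^^ j) p))) f (C (kap ((f ^^ Suc j) p))) ((f ^^ j) p)"

text \<open>\<epsilon> is fixed from W and f, before p, n, b and the perturbations P. For given P
  the products along the orbit of a repetition-free h are realised exactly by bumps, hence bounded
  by b; then h tends to f. The hypothesis ranges over all charts around h^n(p) because the one in
  use is selected for f^n(p).\<close>

lemma perturbed_products_bounded:
  assumes W: "C1_open W" "f \<in> W"
  obtains \<epsilon> where "0 < \<epsilon>" "\<epsilon> \<le> 1"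
    "\<forall>p n b. (\<forall>h\<in>W. \<forall>i\<in>I. (h ^^ n) p \<in> disc i 2 \<longrightarrow> norm (chart_deriv (C (kap p)) (h ^^ n) (C i) p) \<le> b)
      \<longrightarrow> robustly_bounded \<epsilon> (orbit_deriv f p) n b"
proof -
  obtain U \<epsilon>0 where U: "C1_open U" "f \<in> U" "0 < \<epsilon>0" "\<And>h \<phi>. h \<in> U \<Longrightarrow> near_id \<epsilon>0 \<phi> \<Longrightarrow> \<phi> \<circ> h \<in> W"
    using compose_open[OF W] by blast
  have f: "f \<in> Diff1 A" using W C1_open_subset by blast
  obtain \<delta>0 where \<delta>0: "0 < \<delta>0" "\<And>\<phi>. locally_near_id \<delta>0 \<phi> \<Longrightarrow> near_id \<epsilon>0 \<phi>"
    using locally_near_id_imp[OF U(3)] by blast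
  define \<delta> where "\<delta> = min \<delta>0 (1/2)"
  have \<delta>: "0 < \<delta>" "\<delta> \<le> 1/2" "\<delta> \<le> \<delta>0" using \<delta>0(1) by (auto simp: \<delta>_def)
  have lni: "near_id \<epsilon>0 \<phi>" if "locally_near_id \<delta> \<phi>" for \<phi>
    by (rule \<delta>0(2)[OF locally_near_id_mono[OF that \<delta>(3)]])
  show ?thesis
  \<comment> \<open>5 is the constant in the size condition of \<open>multi_bump\<close>.\<close>
  proof (rule that[of "\<delta> / 5"], goal_cases)
    case 3
    show ?case unfolding robustly_bounded_def
    proof (intro allI impI)
      fix p n b and P :: "nat \<Rightarrow> 'b \<Rightarrow>\<^sub>L 'b"
      assume bound': "\<forall>h\<in>W. \<forall>i\<in>I. (h ^^ n) p \<in> disc i 2 \<longrightarrow> norm (chart_deriv (C (kap p)) (h ^^ n) (C i) p) \<le> b"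
        and P': "\<forall>j. P j \<in> cball id_blinfun (\<delta> / 5)"
      note bound = bound'[THEN bspec, THEN bspec, THEN mp] and P = P'[THEN spec]
      define i where "i j = kap ((f ^^ j) p)" for j
      define c where "c j = C (i j)" for j
      have i: "i j \<in> I" "(f ^^ j) p \<in> fst (C (i j))"
        "snd (C (i j)) ((f ^^ j) p) \<in> ball (snd (C (i j)) (i j)) (R (i j))" for j
        unfolding i_def using kap by blast+
      have c: "c j \<in> A" "(f ^^ j) p \<in> fst (c j)" for j unfolding c_def using C i by blast+
      \<comment> \<open>Slack that keeps h^j(p) in the covering ball of f^j(p), so that the charts
        chosen along the orbit of f serve for h as well.\<close>
      define s where "s = Min ((\<lambda>j. R (i j) - dist (snd (c j) (i j)) (snd (c j) ((f ^^ j) p))) ` {..n})"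
      have s: "0 < s" "\<And>j. j \<le> n \<Longrightarrow> s \<le> R (i j) - dist (snd (c j) (i j)) (snd (c j) ((f ^^ j) p))"
        unfolding s_def using i(3) by (auto simp: c_def)
      have "\<exists>T. (\<forall>j<n. norm (T j - orbit_deriv f p j) < 1 / real (Suc m)) \<and> norm (pert_prod P T n) \<le> b"
        for m
      proof -
        have "0 < min s (1 / real (Suc m))" using s(1) by simp
        from nearby_orbits[OF f c this, of n] obtain V where V: "C1_open V" "f \<in> V" "\<And>h. h \<in> V \<Longrightarrow>
           (\<forall>j\<le>n. (h ^^ j) p \<in> fst (c j) \<and> norm (snd (c j) ((h ^^ j) p) - snd (c j) ((f ^^ j) p)) < min s (1 / real (Suc m))) \<and>
           (\<forall>j<n. norm (chart_deriv (c j) h (c (Suc j)) ((h ^^ j) p) - chart_deriv (c j) f (c (Suc j)) ((f ^^ j) p)) < min s (1 / real (Suc m)))"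
          by blast
        have UV: "C1_open (U \<inter> V)" "f \<in> U \<inter> V" using U V by auto
        obtain h where h: "h \<in> U" "h \<in> V" "\<And>j. j \<in> {1..n} \<Longrightarrow> (h ^^ j) p \<noteq> p"
          using avoid_return[OF UV, of n p] by blast
        \<comment> \<open>Membership in V keeps h close to f along the orbit; membership in U makes
          the later composition with \<phi> land in W.\<close>
        have hD: "h \<in> Diff1 A" using h(1) U(1) C1_open_subset by blast
        have near: "(h ^^ j) p \<in> fst (c j)" "norm (snd (c j) ((h ^^ j) p) - snd (c j) ((f ^^ j) p)) < s"
          if "j \<le> n" for j
          using V(3)[OF h(2)] that by auto
        have ball: "snd (c j) ((h ^^ j) p) \<in> ball (snd (c j) (i j)) (R (i j))" if "j \<le> n" for j
        proof -
          have "dist (snd (c j) (i j)) (snd (c j) ((h ^^ j) p)) \<le> dist (snd (c j) (i j)) (snd (c j) ((f ^^ j) p)) + dist (snd (c j) ((f ^^ j) p)) (snd (c j) ((h ^^ j) p))"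
            by (rule dist_triangle)
          also have "\<dots> < R (i j)" using near(2)[OF that] s(2)[OF that]
            by (simp add: dist_norm norm_minus_commute)
          finally show ?thesis by simp
        qed
        \<comment> \<open>It is enough that p does not return: an equality h^k(p) = h^l(p) cancels
          to a return of p.\<close>
        have inj: "inj_on (\<lambda>j. (h ^^ j) p) {1..n}"
        proof (rule linorder_inj_onI)
          fix k l :: nat assume kl: "k < l" "k \<in> {1..n}" "l \<in> {1..n}"
          show "(h ^^ k) p \<noteq> (h ^^ l) p"
          proof
            assume eq: "(h ^^ k) p = (h ^^ l) p"
            have "l = k + (l - k)" using kl by simp
            then have "(h ^^ k) ((h ^^ (l - k)) p) = (h ^^ k) p" using eq
              by (metis comp_apply funpow_add)
            then have "(h ^^ (l - k)) p = p" using Diff1_inj[OF Diff1_funpow[OF hD]] by blast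
            moreover have "l - k \<in> {1..n}" using kl by auto
            ultimately show False using h(3) by blast
          qed
        qed auto
        \<comment> \<open>\<open>P j\<close> acts after \<open>T j\<close>, that is at h^(j+1)(p);
          so the bump at time j carries \<open>P (j - 1)\<close>, and the bumps sit at times 1 to
          n.\<close>
        define L where "L j = P (j - 1) - id_blinfun" for j
        have L: "5 * norm (L j) \<le> \<delta>" for j using P[of "j - 1"]
          by (simp add: L_def dist_norm norm_minus_commute)
        obtain \<phi> where \<phi>: "locally_near_id \<delta> \<phi>" "\<And>j. j \<in> {1..n} \<Longrightarrow> \<phi> ((h ^^ j) p) = (h ^^ j) p \<and>
            chart_deriv (C (i j)) \<phi> (C (i j)) ((h ^^ j) p) = id_blinfun + L j"
          using multi_bump[OF _ inj \<delta>(1,2), of i L UNIV] i(1) near(1) ball L unfolding c_def by fastforce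
        have \<phi>D: "\<phi> \<in> Diff1 A" using \<phi>(1) by (simp add: locally_near_id_def)
        let ?h = "\<phi> \<circ> h"
        have hW: "?h \<in> W" using U(4)[OF h(1) lni[OF \<phi>(1)]] .
        have orb: "(?h ^^ j) p = (h ^^ j) p" if "j \<le> n" for j
          using that
        proof (induction j)
          case (Suc j)
          then show ?case using \<phi>(2)[of "Suc j"] by simp
        qed simp
        let ?T = "\<lambda>j. chart_deriv (c j) h (c (Suc j)) ((h ^^ j) p)"
        have "chart_deriv (c 0) (?h ^^ n) (c n) p = pert_prod P ?T n"
        proof (rule chart_deriv_funpow)
          show "?h \<in> Diff1 A" by (rule Diff1_compose[OF hD \<phi>D])
          show "(?h ^^ j) p \<in> fst (c j)" if "j \<le> n" for j using orb[OF that] near(1)[OF that] by simp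
          fix j assume j: "j < n"
          have "chart_deriv (c j) ?h (c (Suc j)) ((h ^^ j) p) = chart_deriv (c (Suc j)) \<phi> (c (Suc j)) (h ((h ^^ j) p)) o\<^sub>L ?T j"
            by (rule chart_deriv_compose[OF Diff1_C1[OF hD] Diff1_C1[OF \<phi>D] c(1) c(1) c(1)])
               (use near(1)[of j] near(1)[of "Suc j"] j \<phi>(2)[of "Suc j"] in auto)
          also have "chart_deriv (c (Suc j)) \<phi> (c (Suc j)) (h ((h ^^ j) p)) = P j"
            using \<phi>(2)[of "Suc j"] j by (simp add: c_def L_def)
          finally show "chart_deriv (c j) ?h (c (Suc j)) ((?h ^^ j) p) = P j o\<^sub>L ?T j"
            unfolding orb[OF less_imp_le[OF j]] .
        qed (rule c(1))
        moreover have "(?h ^^ n) p \<in> disc (i n) 2"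
        proof -
          have "snd (c n) ((h ^^ n) p) \<in> cball (snd (c n) (i n)) (2 * R (i n))"
            using ball[of n] R[OF i(1)[of n]] by auto
          then show ?thesis using orb[of n] near(1)[of n] by (simp add: disc_def c_def)
        qed
        ultimately have "norm (pert_prod P ?T n) \<le> b" using bound[OF hW i(1)[of n]]
          by (simp add: c_def i_def)
        moreover have "\<forall>j<n. norm (?T j - orbit_deriv f p j) < 1 / real (Suc m)"
          using V(3)[OF h(2)] by (simp add: c_def i_def)
        ultimately show ?thesis by (intro exI[of _ ?T] conjI)
      qed
      from choice[OF allI, OF this] obtain T where T0:
        "\<forall>m. (\<forall>j<n. norm (T m j - orbit_deriv f p j) < 1 / real (Suc m)) \<and>
        norm (pert_prod P (T m) n) \<le> b" by (rule exE)
      note T = T0[THEN spec, THEN conjunct1, THEN spec, THEN mp] T0[THEN spec, THEN conjunct2]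
      have "(\<lambda>m. T m j) \<longlonglongrightarrow> orbit_deriv f p j" if "j < n" for j
      proof -
        have "norm (T m j - orbit_deriv f p j) \<le> inverse (real (Suc m))" for m
          using T(1)[OF that, of m] by (simp add: inverse_eq_divide)
        then have "(\<lambda>m. T m j - orbit_deriv f p j) \<longlonglongrightarrow> 0"
          by (intro Lim_null_comparison[OF always_eventually LIMSEQ_inverse_real_of_nat] allI)
        then show ?thesis by (rule LIM_zero_cancel)
      qed
      then have "(\<lambda>m. norm (pert_prod P (T m) n)) \<longlonglongrightarrow> norm (pert_prod P (orbit_deriv f p) n)"
        by (intro tendsto_norm tendsto_pert_prod)
      then show "norm (pert_prod P (orbit_deriv f p) n) \<le> b"
        by (rule LIMSEQ_le_const2) (use T(2) in auto)
    qed
  qed (use \<delta> in auto)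
qed

end

subsection \<open>Uniformly contracted discs\<close>

context finite_cover
begin

abbreviation step_deriv :: "('a \<Rightarrow> 'a) \<Rightarrow> 'a \<Rightarrow> 'b \<Rightarrow>\<^sub>L 'b" where
  "step_deriv f x \<equiv> chart_deriv (C (kap x)) f (C (kap (f x))) x"

lemma transition_compact:
  assumes "f \<in> Diff1 A" "i \<in> I" "j \<in> I"
  shows "compact (disc i 1 \<inter> f -` disc j 1)" "disc i 1 \<inter> f -` disc j 1 \<subseteq> fst (C i) \<inter> f -` fst (C j)"
proof -
  have "closed (f -` disc j 1)"
    using Diff1_continuous[OF assms(1)] disc_compact[OF assms(3), of 1]
    by (simp add: continuous_on_closed_vimage compact_imp_closed)
  then show "compact (disc i 1 \<inter> f -` disc j 1)" using disc_compact[OF assms(2), of 1] compact_Int_closed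
    by auto
  show "disc i 1 \<inter> f -` disc j 1 \<subseteq> fst (C i) \<inter> f -` fst (C j)" using disc_subset by blast
qed

text \<open>As \<open>kap\<close> is a discontinuous choice, the bound is taken on the compact sets
  belonging to a fixed pair of charts; there are finitely many pairs.\<close>

lemma step_deriv_bounded:
  assumes f: "f \<in> Diff1 A" obtains K where "1 \<le> K" "\<And>x. norm (step_deriv f x) \<le> K"
proof -
  have "\<exists>k. \<forall>x\<in>disc (fst ij) 1 \<inter> f -` disc (snd ij) 1. norm (chart_deriv (C (fst ij)) f (C (snd ij)) x) \<le> k" if "ij \<in> I \<times> I" for ij
  proof -
    have ij: "fst ij \<in> I" "snd ij \<in> I" using that by auto
    note T = transition_compact[OF f ij]
    have "compact (chart_deriv (C (fst ij)) f (C (snd ij)) ` (disc (fst ij) 1 \<inter> f -` disc (snd ij) 1))"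
      using compact_continuous_image[OF continuous_on_subset[OF chart_deriv_continuous_on[OF Diff1_C1[OF f] C[OF ij(1)] C[OF ij(2)]] T(2)] T(1)] .
    then have "bounded (chart_deriv (C (fst ij)) f (C (snd ij)) ` (disc (fst ij) 1 \<inter> f -` disc (snd ij) 1))"
      by (rule compact_imp_bounded)
    then show ?thesis by (simp add: bounded_iff)
  qed
  then obtain k where k: "\<And>ij x. ij \<in> I \<times> I \<Longrightarrow> x \<in> disc (fst ij) 1 \<inter> f -` disc (snd ij) 1 \<Longrightarrow>
     norm (chart_deriv (C (fst ij)) f (C (snd ij)) x) \<le> k ij" by metis
  show ?thesis
  proof (rule that[of "Max (insert 1 (k ` (I \<times> I)))"])
    show "1 \<le> Max (insert 1 (k ` (I \<times> I)))" using finite_I by simp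
    fix x
    have "(kap x, kap (f x)) \<in> I \<times> I" using kap by blast
    moreover have "norm (step_deriv f x) \<le> k (kap x, kap (f x))"
      using k[OF calculation, of x] kap_disc by simp
    moreover have "k (kap x, kap (f x)) \<le> Max (insert 1 (k ` (I \<times> I)))"
      using finite_I calculation(1) by (intro Max_ge) auto
    ultimately show "norm (step_deriv f x) \<le> Max (insert 1 (k ` (I \<times> I)))" by linarith
  qed
qed

text \<open>A lower bound for the derivative of f is an upper bound for that of \<open>inv f\<close>
  at the image point.\<close>

lemma step_deriv_conorm:
  assumes f: "f \<in> Diff1 A"
  obtains K where "1 \<le> K" "\<And>x. norm (step_deriv f x) \<le> K" "\<And>x v. norm v \<le> K * norm (step_deriv f x v)"
proof -
  obtain K1 where K1: "1 \<le> K1" "\<And>x. norm (step_deriv f x) \<le> K1"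
    by (rule step_deriv_bounded[OF f]) (rule that)
  note f' = Diff1_inv[OF f]
  obtain K2 where K2: "1 \<le> K2" "\<And>x. norm (step_deriv (inv f) x) \<le> K2"
    by (rule step_deriv_bounded[OF f']) (rule that)
  have inv: "inv f (f x) = x" "inv f \<circ> f = id" for x using Diff1_bij[OF f] by (simp_all add: bij_is_inj)
  have low: "norm v \<le> K2 * norm (step_deriv f x v)" for x v
  proof -
    have "chart_deriv (C (kap x)) (inv f \<circ> f) (C (kap x)) x = step_deriv (inv f) (f x) o\<^sub>L step_deriv f x"
      using chart_deriv_compose[OF Diff1_C1[OF f] Diff1_C1[OF f'] C[OF kap(1)] C[OF kap(1)] C[OF kap(1)] kap(2) kap(2), of x x] kap(2)[of x]
      by (simp add: inv(1))
    then have "id_blinfun = step_deriv (inv f) (f x) o\<^sub>L step_deriv f x"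
      unfolding inv(2) using chart_deriv_id[OF C[OF kap(1)] kap(2)] by simp
    then have "v = step_deriv (inv f) (f x) (step_deriv f x v)"
      by (metis blinfun_apply_blinfun_compose blinfun_apply_id_blinfun id_apply)
    then have "norm v \<le> norm (step_deriv (inv f) (f x)) * norm (step_deriv f x v)"
      by (metis norm_blinfun)
    also have "\<dots> \<le> K2 * norm (step_deriv f x v)" by (intro mult_right_mono K2) auto
    finally show ?thesis .
  qed
  show ?thesis
  proof (rule that[of "max K1 K2"])
    fix x v
    show "norm (step_deriv f x) \<le> max K1 K2" using K1(2)[of x] by linarith
    have "K2 * norm (step_deriv f x v) \<le> max K1 K2 * norm (step_deriv f x v)"
      by (intro mult_right_mono) auto
    then show "norm v \<le> max K1 K2 * norm (step_deriv f x v)" using low[of v x] by linarith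
  qed (use K1 in auto)
qed

lemma step_linearization:
  assumes f: "f \<in> Diff1 A" and \<delta>: "0 < \<delta>"
  obtains \<rho> where "0 < \<rho>" "\<And>x y. \<lbrakk>y \<in> dom_at x; norm (disp x y) \<le> \<rho>\<rbrakk> \<Longrightarrow>
     f y \<in> dom_at (f x) \<and> norm (disp (f x) (f y)
        - step_deriv f x (disp x y)) \<le> \<delta> * norm (disp x y)"
proof -
  define P where "P ij s \<longleftrightarrow> (\<forall>x\<in>disc (fst ij) 1 \<inter> f -` disc (snd ij) 1. \<forall>y\<in>fst (C (fst ij)).
     norm (snd (C (fst ij)) y - snd (C (fst ij)) x) \<le> s \<longrightarrow>
     f y \<in> fst (C (snd ij)) \<and> norm (snd (C (snd ij)) (f y) - snd (C (snd ij)) (f x)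
        - chart_deriv (C (fst ij)) f (C (snd ij)) x (snd (C (fst ij)) y - snd (C (fst ij)) x)) \<le> \<delta> * norm (snd (C (fst ij)) y - snd (C (fst ij)) x))"
    for ij :: "'a \<times> 'a" and s
  have "\<exists>r>0. \<forall>ij\<in>I \<times> I. P ij r"
  proof (rule finite_uniform_pos)
    show "finite (I \<times> I)" using finite_I by simp
    fix ij assume "ij \<in> I \<times> I"
    then obtain i j where ij: "ij = (i, j)" "i \<in> I" "j \<in> I" by auto
    note Ci = C[OF ij(2)] and Cj = C[OF ij(3)] and T = transition_compact[OF f ij(2,3)]
    let ?K = "disc i 1 \<inter> f -` disc j 1" and ?\<Omega> = "snd (C i) ` (fst (C i) \<inter> f -` fst (C j))" and ?F =
      "local_rep (C i) f (C j)"
    have K: "compact (snd (C i) ` ?K)" using chart_image_compact[OF Ci T(1)] T(2) by blast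
    have K\<Omega>: "snd (C i) ` ?K \<subseteq> ?\<Omega>" by (rule image_mono[OF T(2)])
    obtain r where r: "0 < r" "\<And>a. a \<in> snd (C i) ` ?K \<Longrightarrow> cball a r \<subseteq> ?\<Omega>"
      "\<And>a u. a \<in> snd (C i) ` ?K \<Longrightarrow> u \<in> cball a r \<Longrightarrow> norm (?F u - ?F a - fderiv ?F a (u - a)) \<le> \<delta> * norm (u - a)"
      using C1_uniform[OF C1_map_domain_open(2)[OF Diff1_C1[OF f] Ci Cj] C1_map_local_rep[OF Diff1_C1[OF f] Ci Cj] K K\<Omega> \<delta>] by metis
    show "\<exists>r>0. \<forall>s. 0 < s \<longrightarrow> s \<le> r \<longrightarrow> P ij s"
    proof (intro exI[of _ r] conjI allI impI r(1))
      fix s assume s: "0 < s" "s \<le> r"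
      show "P ij s" unfolding P_def ij fst_conv snd_conv
      proof (intro ballI impI)
        fix x y assume x: "x \<in> ?K" and y: "y \<in> fst (C i)" "norm (snd (C i) y - snd (C i) x) \<le> s"
        have x': "snd (C i) x \<in> snd (C i) ` ?K" "x \<in> fst (C i)" using x T(2) by auto
        have u: "snd (C i) y \<in> cball (snd (C i) x) r" using y s
          by (simp add: dist_norm norm_minus_commute)
        then have "snd (C i) y \<in> ?\<Omega>" by (rule subsetD[OF r(2)[OF x'(1)]])
        then obtain z where z: "snd (C i) y = snd (C i) z" "z \<in> fst (C i) \<inter> f -` fst (C j)"
          by (rule imageE)
        then have "y = z" using cinv_chart[OF Ci] y(1) by (metis IntD1)
        then have "f y \<in> fst (C j)" using z(2) by simp
        moreover have "norm (snd (C j) (f y) - snd (C j) (f x) - chart_deriv (C i) f (C j) x (snd (C i) y - snd (C i) x))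
            \<le> \<delta> * norm (snd (C i) y - snd (C i) x)"
          using r(3)[OF x'(1) u] by (simp add: local_rep_apply[OF Ci] y(1) x'(2) chart_deriv_def)
        ultimately show "f y \<in> fst (C j) \<and> norm (snd (C j) (f y) - snd (C j) (f x) - chart_deriv (C i) f (C j) x (snd (C i) y - snd (C i) x))
            \<le> \<delta> * norm (snd (C i) y - snd (C i) x)" ..
      qed
    qed
  qed
  then obtain r where r: "0 < r" "\<And>i j. i \<in> I \<Longrightarrow> j \<in> I \<Longrightarrow> P (i, j) r" by blast
  show ?thesis
  proof (rule that[OF r(1)])
    fix x y assume y: "y \<in> dom_at x" "norm (disp x y) \<le> r"
    have x: "x \<in> disc (kap x) 1 \<inter> f -` disc (kap (f x)) 1" using kap_disc by simp
    have "P (kap x, kap (f x)) r" by (rule r(2)[OF kap(1) kap(1)])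
    from this[unfolded P_def fst_conv snd_conv, THEN bspec, OF x, THEN bspec, OF y(1), THEN mp, OF y(2)]
    show "f y \<in> dom_at (f x) \<and> norm (disp (f x) (f y)
        - step_deriv f x (disp x y)) \<le> \<delta> * norm (disp x y)" .
  qed
qed

text \<open>Stands in for a metric on the manifold: smallness is measured in the selected chart of
  each point, uniformly since the charts are finitely many.\<close>

lemma cover_lebesgue_number:
  assumes op: "\<forall>U\<in>\<C>. open U" and cov: "\<Union>\<C> = (UNIV :: 'a set)"
  obtains \<delta> where "0 < \<delta>" "\<And>x. \<exists>U\<in>\<C>. \<forall>y\<in>dom_at x. norm (disp x y) < \<delta> \<longrightarrow> y \<in> U"
proof -
  define P where "P i s \<longleftrightarrow> (\<forall>x\<in>disc i 1. \<exists>U\<in>\<C>. \<forall>y\<in>fst (C i). norm (snd (C i) y - snd (C i) x) < s \<longrightarrow> y \<in> U)" for i s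
  have "\<exists>r>0. \<forall>i\<in>I. P i r"
  proof (rule finite_uniform_pos[OF finite_I])
    fix i assume i: "i \<in> I"
    note Ci = C[OF i]
    let ?\<D> = "(\<lambda>U. snd (C i) ` (U \<inter> fst (C i))) ` \<C>"
    have comp: "compact (snd (C i) ` disc i 1)"
      using chart_image_compact[OF Ci disc_compact[OF i] disc_subset] by simp
    have sub: "snd (C i) ` disc i 1 \<subseteq> \<Union>?\<D>"
    proof
      fix u assume "u \<in> snd (C i) ` disc i 1"
      then obtain x where x: "u = snd (C i) x" "x \<in> fst (C i)" using disc_subset by blast
      have "x \<in> \<Union>\<C>" using cov by simp
      then obtain U where U: "x \<in> U" "U \<in> \<C>" by (rule UnionE)
      have "u \<in> snd (C i) ` (U \<inter> fst (C i))" unfolding x(1) by (rule imageI) (use x U in simp)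
      then show "u \<in> \<Union>?\<D>" by (rule UnionI[OF imageI[OF U(2)]])
    qed
    have opD: "open G" if G: "G \<in> ?\<D>" for G
    proof -
      obtain U where U: "U \<in> \<C>" "G = snd (C i) ` (U \<inter> fst (C i))" using G by blast
      have "open (U \<inter> fst (C i))" using op U(1) chart_open[OF Ci] by blast
      then show ?thesis unfolding U(2) by (rule chart_image_open[OF Ci]) blast
    qed
    obtain e where e: "0 < e" "\<And>u. u \<in> snd (C i) ` disc i 1 \<Longrightarrow> \<exists>G\<in>?\<D>. ball u e \<subseteq> G"
      using Heine_Borel_lemma[OF comp sub opD] by blast
    show "\<exists>r>0. \<forall>s. 0 < s \<longrightarrow> s \<le> r \<longrightarrow> P i s"
    proof (intro exI[of _ e] conjI allI impI e(1))
      fix s assume s: "0 < s" "s \<le> e"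
      show "P i s" unfolding P_def
      proof
        fix x assume x: "x \<in> disc i 1"
        obtain G where G: "ball (snd (C i) x) e \<subseteq> G" "G \<in> ?\<D>" using e(2)[OF imageI[OF x]] by (rule bexE)
        from G(2) obtain U where U: "G = snd (C i) ` (U \<inter> fst (C i))" "U \<in> \<C>" by (rule imageE)
        have "y \<in> U" if y: "y \<in> fst (C i)" "norm (snd (C i) y - snd (C i) x) < s" for y
        proof -
          have "snd (C i) y \<in> ball (snd (C i) x) e" using y s by (simp add: dist_norm norm_minus_commute)
          then have "snd (C i) y \<in> snd (C i) ` (U \<inter> fst (C i))" unfolding U(1)[symmetric]
            by (rule subsetD[OF G(1)])
          then obtain z where z: "snd (C i) y = snd (C i) z" "z \<in> U \<inter> fst (C i)" by (rule imageE)
          then have "y = z" using cinv_chart[OF Ci] y(1) by (metis IntD2)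
          then show ?thesis using z by blast
        qed
        then show "\<exists>U\<in>\<C>. \<forall>y\<in>fst (C i). norm (snd (C i) y - snd (C i) x) < s \<longrightarrow> y \<in> U" using U(2) by blast
      qed
    qed
  qed
  then obtain r where r: "0 < r" "\<And>i. i \<in> I \<Longrightarrow> P i r" by blast
  show ?thesis
  proof (rule that[OF r(1)])
    fix x show "\<exists>U\<in>\<C>. \<forall>y\<in>dom_at x. norm (disp x y) < r \<longrightarrow> y \<in> U"
      using r(2)[OF kap(1)[of x]] kap_disc[of x] unfolding P_def by blast
  qed
qed

definition contracted :: "('a \<Rightarrow> 'a) \<Rightarrow> real \<Rightarrow> real \<Rightarrow> nat \<Rightarrow> 'a \<Rightarrow> bool" where
  "contracted f r \<kappa> m x \<longleftrightarrow> (\<forall>l\<le>m. \<forall>y\<in>dom_at x. norm (disp x y) \<le> r \<longrightarrow>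
     (f ^^ l) y \<in> dom_at ((f ^^ l) x) \<and>
     norm (disp ((f ^^ l) x) ((f ^^ l) y)) \<le> \<kappa> ^ l)"

text \<open>The number L of contracted steps is arbitrary, whereas r and \<kappa> are fixed before
  it.\<close>

lemma contracted_times:
  assumes f: "f \<in> Diff1 A" and \<epsilon>: "0 < \<epsilon>" "\<epsilon> \<le> 1"
  obtains r \<kappa> where "0 < r" "0 < \<kappa>" "\<kappa> < 1"
    "\<And>b L. \<exists>N. \<forall>p n. N \<le> n \<and> robustly_bounded \<epsilon> (orbit_deriv f p) n b
        \<longrightarrow> (\<exists>i. contracted f r \<kappa> L ((f ^^ i) p))"
proof -
  obtain K where K: "1 \<le> K" "\<And>x. norm (step_deriv f x) \<le> K" "\<And>x v. norm v \<le> K * norm (step_deriv f x v)"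
    by (rule step_deriv_conorm[OF f]) (rule that)
  obtain \<delta> Q \<kappa> :: real where d: "0 < \<delta>" "1 \<le> Q" "0 < \<kappa>" "\<kappa> < 1"
    and main: "\<And>b L. \<exists>N. \<forall>(T :: nat \<Rightarrow> 'b \<Rightarrow>\<^sub>L 'b) n. cocycle K T \<and> robustly_bounded \<epsilon> T n b \<and> N \<le> n \<longrightarrow>
       (\<exists>i\<le>n. L \<le> n - i \<and> contracts_near \<delta> Q \<kappa> (\<lambda>k. T (i + k)) (n - i))"
    by (rule robustly_bounded_cocycle[OF \<epsilon> K(1)]) (rule that)
  obtain \<rho> where \<rho>: "0 < \<rho>" "\<And>x y. \<lbrakk>y \<in> dom_at x; norm (disp x y) \<le> \<rho>\<rbrakk> \<Longrightarrow>
     f y \<in> dom_at (f x) \<and> norm (disp (f x) (f y)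
        - step_deriv f x (disp x y)) \<le> \<delta> * norm (disp x y)"
    by (rule step_linearization[OF f d(1)]) (rule that)
  \<comment> \<open>Q * r \<le> \<rho> keeps the displacements in the range of the linearisation,
    and Q * r \<le> 1 absorbs the constant Q.\<close>
  define r where "r = min \<rho> 1 / Q"
  have r: "0 < r" "Q * r \<le> \<rho>" "Q * r \<le> 1" using \<rho>(1) d(2) by (auto simp: r_def)
  show ?thesis
  proof (rule that[OF r(1) d(3,4)])
    fix b :: real and L :: nat
    obtain N where N: "\<forall>(T :: nat \<Rightarrow> 'b \<Rightarrow>\<^sub>L 'b) n. cocycle K T \<and> robustly_bounded \<epsilon> T n b \<and> N \<le> n \<longrightarrow>
       (\<exists>i\<le>n. L \<le> n - i \<and> contracts_near \<delta> Q \<kappa> (\<lambda>k. T (i + k)) (n - i))"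
      using main[of b L] by blast
    have "\<exists>i. contracted f r \<kappa> L ((f ^^ i) p)"
      if n: "N \<le> n" and P: "robustly_bounded \<epsilon> (orbit_deriv f p) n b" for p n
    proof -
      have "cocycle K (orbit_deriv f p)" using K(2,3) by (simp add: cocycle_def)
      then obtain i where i: "i \<le> n" "L \<le> n - i" and
        "contracts_near \<delta> Q \<kappa> (\<lambda>k. orbit_deriv f p (i + k)) (n - i)"
        using N[rule_format, of "orbit_deriv f p" n] n P by blast
      then have con: "\<And>w l. l \<le> n - i \<Longrightarrow>
          (\<forall>k<l. norm (w (Suc k) - orbit_deriv f p (i + k) (w k)) \<le> \<delta> * norm (w k)) \<Longrightarrow> norm (w l) \<le> Q * \<kappa> ^ l * norm (w 0)"
        unfolding contracts_near_def by blast
      define x where "x = (f ^^ i) p"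
      have od: "orbit_deriv f p (i + k) = step_deriv f ((f ^^ k) x)" for k
      proof -
        have "(f ^^ (i + k)) p = (f ^^ k) x" unfolding x_def by (metis add.commute comp_apply funpow_add)
        then show ?thesis by simp
      qed
      have "contracted f r \<kappa> L x" unfolding contracted_def
      proof (intro allI ballI impI)
        fix l y assume l: "l \<le> L" and y: "y \<in> dom_at x" "norm (disp x y) \<le> r"
        define w where "w k = disp ((f ^^ k) x) ((f ^^ k) y)" for k
        have bound: "Q * \<kappa> ^ k * norm (w 0) \<le> \<kappa> ^ k * (Q * r)" for k
        proof -
          have "Q * \<kappa> ^ k * norm (w 0) \<le> Q * \<kappa> ^ k * r" using y(2) d
            by (intro mult_left_mono) (auto simp: w_def)
          then show ?thesis by (simp add: mult_ac)
        qed
        \<comment> \<open>Two facts feed each other: the bound up to time k makes the linearisation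
          valid there, so w is a pseudo-orbit up to time k + 1, which yields the next bound.\<close>
        have ind: "(\<forall>j\<le>k. (f ^^ j) y \<in> dom_at ((f ^^ j) x) \<and> norm (w j) \<le> Q * \<kappa> ^ j * norm (w 0))" if
          "k \<le> n - i" for k
          using that
        proof (induction k)
          case 0
          then show ?case using y(1) d(2) mult_right_mono[of 1 Q "norm (w 0)"] by simp
        next
          case (Suc k)
          then have IH: "(f ^^ j) y \<in> dom_at ((f ^^ j) x)" "norm (w j) \<le> Q * \<kappa> ^ j * norm (w 0)" if
            "j \<le> k" for j
            using that by auto
          have small: "norm (w j) \<le> \<rho>" if "j \<le> k" for j
          proof -
            have "\<kappa> ^ j * (Q * r) \<le> 1 * (Q * r)" using d r(1)
              by (intro mult_right_mono power_le_one) auto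
            then show ?thesis using IH(2)[OF that] bound[of j] r(2) by linarith
          qed
          have st: "f ((f ^^ j) y) \<in> dom_at (f ((f ^^ j) x)) \<and> norm (w (Suc j) - orbit_deriv f p (i + j) (w j)) \<le> \<delta> * norm (w j)" if "j \<le> k" for j
            unfolding od using \<rho>(2)[OF IH(1)[OF that]] small[OF that] unfolding w_def by simp
          have "norm (w (Suc k)) \<le> Q * \<kappa> ^ Suc k * norm (w 0)"
            by (rule con[OF Suc.prems]) (use st in \<open>auto simp: less_Suc_eq_le\<close>)
          then show ?case using IH st[of k] by (auto simp: le_Suc_eq)
        qed
        have lw: "(f ^^ l) y \<in> dom_at ((f ^^ l) x)" "norm (w l) \<le> Q * \<kappa> ^ l * norm (w 0)"
          using ind[of l] l i(2) by auto
        have "\<kappa> ^ l * (Q * r) \<le> \<kappa> ^ l * 1" using d r(3) by (intro mult_left_mono) auto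
        then have "norm (w l) \<le> \<kappa> ^ l" using lw(2) bound[of l] by linarith
        then show "(f ^^ l) y \<in> dom_at ((f ^^ l) x) \<and>
           norm (disp ((f ^^ l) x) ((f ^^ l) y)) \<le> \<kappa> ^ l"
          using lw(1) by (simp add: w_def)
      qed
      then show ?thesis unfolding x_def by blast
    qed
    then show "\<exists>N. \<forall>p n. N \<le> n \<and> robustly_bounded \<epsilon> (orbit_deriv f p) n b
        \<longrightarrow> (\<exists>i. contracted f r \<kappa> L ((f ^^ i) p))" by blast
  qed
qed

lemma contracted_mono: "contracted f r \<kappa> m x \<Longrightarrow> l \<le> m \<Longrightarrow> contracted f r \<kappa> l x"
  unfolding contracted_def by (meson order_trans)

text \<open>Two applications of the pigeonhole principle, to charts and to balls of radius r / 2,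
  put infinitely many z p into one W. Points of W are less than r apart in the chart, so W lies in
  the contracted disc of each of these z p, and \<open>m\<close> is unbounded on them.\<close>

lemma eventually_small_disc:
  assumes S: "infinite S" and r: "0 < r" and \<kappa>: "0 < \<kappa>" "\<kappa> < 1"
    and con: "\<And>p. p \<in> S \<Longrightarrow> contracted f r \<kappa> (m p) (z p)" and m: "\<And>l. finite {p \<in> S. m p < l}"
  obtains W where "open W" "eventually_small f W" "infinite {p \<in> S. z p \<in> W}"
proof -
  have "finite ((\<lambda>p. kap (z p)) ` S)" by (rule finite_subset[OF _ finite_I]) (use kap in blast)
  then obtain p0 where p0: "p0 \<in> S" "infinite {p \<in> S. kap (z p) = kap (z p0)}"
    using pigeonhole_infinite[OF S] by blast
  define i where "i = kap (z p0)"
  define S1 where "S1 = {p \<in> S. kap (z p) = i}"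
  have i: "i \<in> I" and S1: "infinite S1" using kap p0 by (auto simp: i_def S1_def)
  obtain Z where Z: "finite Z" "cball (snd (C i) i) (R i) \<subseteq> (\<Union>u\<in>Z. ball u (r / 2))"
  proof (rule compactE_image[OF compact_cball])
    show "cball (snd (C i) i) (R i) \<subseteq> (\<Union>u\<in>UNIV. ball u (r / 2))"
    proof
      fix u have "u \<in> ball u (r / 2)" using r by simp
      then show "u \<in> (\<Union>u\<in>UNIV. ball u (r / 2))" by blast
    qed
  qed (auto intro: that)
  have "\<exists>u\<in>Z. snd (C i) (z p) \<in> ball u (r / 2)" if "p \<in> S1" for p
  proof -
    have "snd (C i) (z p) \<in> cball (snd (C i) i) (R i)"
      using kap_disc[of "z p"] that by (simp add: S1_def disc_def)
    then show ?thesis using Z(2) by blast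
  qed
  then obtain c where c: "\<And>p. p \<in> S1 \<Longrightarrow> c p \<in> Z \<and> snd (C i) (z p) \<in> ball (c p) (r / 2)" by metis
  have "finite (c ` S1)" by (rule finite_subset[OF _ Z(1)]) (use c in blast)
  then obtain p1 where p1: "p1 \<in> S1" "infinite {p \<in> S1. c p = c p1}" using pigeonhole_infinite[OF S1]
    by blast
  define S2 where "S2 = {p \<in> S1. c p = c p1}"
  define W where "W = {x \<in> fst (C i). snd (C i) x \<in> ball (c p1) (r / 2)}"
  have S2: "infinite S2" "S2 \<subseteq> S1" "S2 \<subseteq> S" using p1 by (auto simp: S2_def S1_def)
  have "open W" unfolding W_def by (rule chart_preimage_open[OF C[OF i] open_ball])
  moreover have "infinite {p \<in> S. z p \<in> W}"
  proof
    assume fin: "finite {p \<in> S. z p \<in> W}"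
    have "z p \<in> W" if "p \<in> S2" for p
      using c[of p] that kap(2)[of "z p"] by (auto simp: S2_def S1_def W_def)
    then have "S2 \<subseteq> {p \<in> S. z p \<in> W}" using S2(3) by blast
    then show False using fin S2(1) finite_subset by blast
  qed
  moreover have "eventually_small f W" unfolding eventually_small_def
  proof (intro allI impI, elim conjE)
    fix \<C> assume op: "\<forall>U\<in>\<C>. open U" and cov: "\<Union>\<C> = (UNIV :: 'a set)"
    obtain \<delta> where \<delta>: "0 < \<delta>" "\<And>x. \<exists>U\<in>\<C>. \<forall>y\<in>dom_at x. norm (disp x y) < \<delta> \<longrightarrow> y \<in> U"
      using cover_lebesgue_number[OF op cov] by metis
    obtain N where N: "\<kappa> ^ N < \<delta>" using real_arch_pow_inv[OF \<delta>(1) \<kappa>(2)] by blast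
    have "\<exists>U\<in>\<C>. (f ^^ k) ` W \<subseteq> U" if "N \<le> k" for k
    proof -
      have "\<kappa> ^ k \<le> \<kappa> ^ N" using that \<kappa> by (intro power_decreasing) auto
      then have k: "\<kappa> ^ k < \<delta>" using N by linarith
      \<comment> \<open>Some p in the infinite set S2 is contracted for at least k steps; it may
        change with k.\<close>
      have "\<not> S2 \<subseteq> {p \<in> S. m p < k}" using m S2(1) finite_subset by blast
      then obtain p where p: "p \<in> S2" "k \<le> m p" using S2(3) by force
      then have con_p: "contracted f r \<kappa> k (z p)" using con S2(3) contracted_mono by blast
      have kp: "kap (z p) = i" and zp: "snd (C i) (z p) \<in> ball (c p1) (r / 2)"
        using p(1) c[of p] by (auto simp: S2_def S1_def)
      let ?x = "(f ^^ k) (z p)"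
      obtain U where U: "U \<in> \<C>" "\<And>y. y \<in> dom_at ?x \<Longrightarrow> norm (disp ?x y) < \<delta> \<Longrightarrow> y \<in> U"
        using \<delta>(2)[of ?x] by blast
      have "(f ^^ k) y \<in> U" if y: "y \<in> W" for y
      proof -
        have "dist (snd (C i) y) (snd (C i) (z p)) \<le> dist (snd (C i) y) (c p1) + dist (c p1) (snd (C i) (z p))" by (rule dist_triangle)
        also have "\<dots> \<le> r" using y zp by (simp add: W_def dist_commute)
        finally have yr: "norm (disp (z p) y) \<le> r" unfolding kp by (simp add: dist_norm)
        have yc: "y \<in> dom_at (z p)" using y unfolding kp W_def by blast
        have "(f ^^ k) y \<in> dom_at ?x \<and> norm (disp ?x ((f ^^ k) y)) \<le> \<kappa> ^ k"
          using con_p yc yr unfolding contracted_def by blast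
        then show ?thesis using U(2) k by (meson order_le_less_trans)
      qed
      then show ?thesis using U(1) by blast
    qed
    then show "\<exists>N. \<forall>k\<ge>N. \<exists>U\<in>\<C>. (f ^^ k) ` W \<subseteq> U" by blast
  qed
  ultimately show ?thesis using that by blast
qed

lemma bounded_products_imp_finite:
  assumes f: "f \<in> Diff1 A" and \<epsilon>: "0 < \<epsilon>" "\<epsilon> \<le> 1" and S: "S \<subseteq> nonwandering_set f"
    and n: "\<And>k. finite {p \<in> S. n p = k}"
    and bound: "\<And>p. p \<in> S \<Longrightarrow> robustly_bounded \<epsilon> (orbit_deriv f p) (n p) b"
  shows "finite S"
proof (rule ccontr)
  assume inf: "infinite S"
  obtain r \<kappa> where r: "0 < r" "0 < \<kappa>" "\<kappa> < 1" and main: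
    "\<And>b L. \<exists>N. \<forall>p n. N \<le> n \<and> robustly_bounded \<epsilon> (orbit_deriv f p) n b
        \<longrightarrow> (\<exists>i. contracted f r \<kappa> L ((f ^^ i) p))"
    by (rule contracted_times[OF f \<epsilon>]) (rule that)
  obtain N where N: "\<And>L p. p \<in> S \<Longrightarrow> N L \<le> n p \<Longrightarrow> \<exists>i. contracted f r \<kappa> L ((f ^^ i) p)"
  proof -
    from choice[OF allI, OF main[of b]] obtain N where N0: "\<forall>L p n. N L \<le> n \<and>
        robustly_bounded \<epsilon> (orbit_deriv f p) n b
        \<longrightarrow> (\<exists>i. contracted f r \<kappa> L ((f ^^ i) p))" by (rule exE)
    have "\<exists>i. contracted f r \<kappa> L ((f ^^ i) p)" if p: "p \<in> S" and N: "N L \<le> n p" for L p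
      by (rule N0[THEN spec, THEN spec, THEN spec, THEN mp, OF conjI, OF N bound[OF p]])
    then show ?thesis by (rule that)
  qed
  have fin: "finite {p \<in> S. n p < k}" for k
  proof -
    have "{p \<in> S. n p < k} = (\<Union>j<k. {p \<in> S. n p = j})" by auto
    then show ?thesis using n by simp
  qed
  \<comment> \<open>The number of contracted steps guaranteed by n p. The constraint L \<le> n p
    makes the set finite, and on S0 it contains 0.\<close>
  define m where "m p = Max {L. L \<le> n p \<and> N L \<le> n p}" for p
  define S0 where "S0 = {p \<in> S. N 0 \<le> n p}"
  have mem: "L \<le> m p" if "L \<le> n p" "N L \<le> n p" for L p unfolding m_def using that by (intro Max_ge) auto
  have m: "N (m p) \<le> n p" if "p \<in> S0" for p
  proof -
    have "m p \<in> {L. L \<le> n p \<and> N L \<le> n p}" unfolding m_def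
      by (rule Max_in) (use that in \<open>auto simp: S0_def\<close>)
    then show ?thesis by simp
  qed
  have "\<exists>i. contracted f r \<kappa> (m p) ((f ^^ i) p)" if "p \<in> S0" for p
    using N[of p "m p"] m[OF that] that by (auto simp: S0_def)
  then obtain i where i: "\<And>p. p \<in> S0 \<Longrightarrow> contracted f r \<kappa> (m p) ((f ^^ i p) p)" by metis
  have "infinite S0"
  proof
    assume "finite S0"
    moreover have "S \<subseteq> S0 \<union> {p \<in> S. n p < N 0}" by (auto simp: S0_def)
    ultimately show False using inf fin finite_subset by blast
  qed
  moreover have "finite {p \<in> S0. m p < l}" for l
  proof (rule finite_subset)
    \<comment> \<open>\<open>m\<close> tends to infinity along S0 because \<open>n\<close> has
      finite fibres.\<close>
    show "{p \<in> S0. m p < l} \<subseteq> {p \<in> S. n p < max l (N l)}"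
    proof
      fix p assume p: "p \<in> {p \<in> S0. m p < l}"
      then have "\<not> (l \<le> n p \<and> N l \<le> n p)" using mem[of l p] by auto
      then show "p \<in> {p \<in> S. n p < max l (N l)}" using p by (auto simp: S0_def)
    qed
  qed (rule fin)
  ultimately obtain W where W: "open W" "eventually_small f W" "infinite {p \<in> S0. (f ^^ i p) p \<in> W}"
    using eventually_small_disc[of S0 r \<kappa> f m "\<lambda>p. (f ^^ i p) p"] r i by blast
  have "finite {p \<in> S0. (f ^^ i p) p \<in> W}"
    by (rule eventually_small_finite_orbits[OF compact_UNIV Diff1_continuous[OF f] bij_is_inj[OF Diff1_bij[OF f]] W(1,2)])
       (use S in \<open>auto simp: S0_def\<close>)
  then show False using W(3) by blast
qed

end

section \<open>The converse implication\<close>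

locale riemannian_cover = riemannian_mfd A g + finite_cover A I C R
  for A :: "('a::t2_space, 'b::euclidean_space) chart set" and g I C R
begin

lemma chart_deriv_le_tangent_onorm:
  obtains M where "0 \<le> M" "\<And>h p i. h \<in> Diff1 A \<Longrightarrow> i \<in> I \<Longrightarrow> h p \<in> disc i 2 \<Longrightarrow>
     norm (chart_deriv (C (kap p)) h (C i) p) \<le> M * deriv_norm h p"
proof -
  have "\<exists>a b. 0 < a \<and> 0 < b \<and> (\<forall>p\<in>disc i 2. \<forall>u. a * norm u \<le> coord_norm (C i) p u
     \<and> coord_norm (C i) p u \<le> b * norm u)" if i: "i \<in> I" for i
    by (rule norm_equivalence[OF C[OF i] disc_compact[OF i, of 2] disc_subset]) (simp, blast)
  then obtain a b where ab: "\<And>i. i \<in> I \<Longrightarrow> 0 < a i" "\<And>i. i \<in> I \<Longrightarrow> 0 < b i"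
    "\<And>i p u. i \<in> I \<Longrightarrow> p \<in> disc i 2 \<Longrightarrow> a i * norm u \<le> coord_norm (C i) p u"
    "\<And>i p u. i \<in> I \<Longrightarrow> p \<in> disc i 2 \<Longrightarrow> coord_norm (C i) p u \<le> b i * norm u"
    by metis
  define M where "M = Max ((\<lambda>(i, j). b i / a j) ` (I \<times> I))"
  have M: "b i / a j \<le> M" if "i \<in> I" "j \<in> I" for i j
    unfolding M_def by (rule Max_ge) (use finite_I that in auto)
  show ?thesis
  proof (rule that[of M])
    obtain i where "i \<in> I" using I_nonempty by blast
    then show "0 \<le> M" using M[of i i] ab(1,2)[of i] by (smt (verit) divide_pos_pos)
    fix h p i assume h: "h \<in> Diff1 A" and i: "i \<in> I" and hp: "h p \<in> disc i 2"
    note k = kap(1)[of p]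
    have p: "p \<in> disc (kap p) 2"
      using kap(2,3)[of p] R[OF k] by (auto simp: disc_def)
    have hi: "h p \<in> fst (C i)" using hp disc_subset by blast
    let ?N = "deriv_norm h p"
    have le: "norm (chart_deriv (C (kap p)) h (C i) p) \<le> b (kap p) / a i * ?N"
      by (rule tangent_onorm_estimates(2)[OF Diff1_C1[OF h] C[OF k] kap(2) C[OF i] hi ab(1)[OF k] ab(2)[OF k] ab(1)[OF i] ab(2)[OF i]
            ab(3)[OF k p] ab(4)[OF k p] ab(3)[OF i hp] ab(4)[OF i hp]])
    \<comment> \<open>Nonnegativity of the operator norm is read off from the estimate
      itself.\<close>
    then have "0 \<le> b (kap p) / a i * ?N" using norm_ge_zero order_trans by blast
    moreover have "0 < b (kap p) / a i" using ab(1)[OF i] ab(2)[OF k] by simp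
    ultimately have "0 \<le> ?N" using zero_le_mult_iff by (metis less_le_not_le)
    then have "b (kap p) / a i * ?N \<le> M * ?N" by (rule mult_right_mono[OF M[OF k i]])
    then show "norm (chart_deriv (C (kap p)) h (C i) p) \<le> M * ?N" using le by linarith
  qed
qed

lemma bounded_imp_finite:
  assumes f: "f \<in> Diff1 A" and S: "S \<subseteq> nonwandering_set f" and n: "\<And>k. finite {p \<in> S. n p = k}"
    and W: "C1_open W" "f \<in> W"
    and bound: "\<And>h p. h \<in> W \<Longrightarrow> p \<in> S \<Longrightarrow> deriv_norm (h ^^ n p) p \<le> B"
  shows "finite S"
proof -
  obtain M where M: "0 \<le> M" "\<And>h p i. h \<in> Diff1 A \<Longrightarrow> i \<in> I \<Longrightarrow> h p \<in> disc i 2 \<Longrightarrow>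
     norm (chart_deriv (C (kap p)) h (C i) p) \<le> M * deriv_norm h p"
    by (rule chart_deriv_le_tangent_onorm) (rule that)
  obtain \<epsilon> where \<epsilon>: "0 < \<epsilon>" "\<epsilon> \<le> 1"
    "\<forall>p n b. (\<forall>h\<in>W. \<forall>i\<in>I. (h ^^ n) p \<in> disc i 2 \<longrightarrow> norm (chart_deriv (C (kap p)) (h ^^ n) (C i) p) \<le> b)
      \<longrightarrow> robustly_bounded \<epsilon> (orbit_deriv f p) n b"
    by (rule perturbed_products_bounded[OF W]) (rule that)
  show ?thesis
  proof (rule bounded_products_imp_finite[OF f \<epsilon>(1,2) S n])
    fix p assume p: "p \<in> S"
    show "robustly_bounded \<epsilon> (orbit_deriv f p) (n p) (M * B)"
    proof (rule \<epsilon>(3)[THEN spec, THEN spec, THEN spec, THEN mp], intro ballI impI)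
      fix h i assume h: "h \<in> W" and i: "i \<in> I" "(h ^^ n p) p \<in> disc i 2"
      have hD: "h ^^ n p \<in> Diff1 A" using Diff1_funpow h W(1) C1_open_subset by blast
      have "norm (chart_deriv (C (kap p)) (h ^^ n p) (C i) p) \<le> M * deriv_norm (h ^^ n p) p"
        by (rule M(2)[OF hD i])
      also have "\<dots> \<le> M * B" by (intro mult_left_mono bound h p M(1))
      finally show "norm (chart_deriv (C (kap p)) (h ^^ n p) (C i) p) \<le> M * B" .
    qed
  qed
qed

end

theorem corollary1p4:
  fixes A :: "('a::t2_space, 'b::euclidean_space) chart set"
    and g :: "'a \<Rightarrow> ('a, 'b) tvec \<Rightarrow> ('a, 'b) tvec \<Rightarrow> real"
    and f :: "'a \<Rightarrow> 'a"
    and S :: "'a set"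
  assumes "closed_manifold A"
    and "riemannian_metric A g"
    and "f \<in> Diff1 A"
    and "S \<subseteq> nonwandering_set f"
  shows "finite S \<longleftrightarrow>
    (\<exists>\<U> (n :: 'a \<Rightarrow> nat). neighbourhood_in (C1_topology A) f \<U> \<and>
       finite_preimages n S {1..} \<and>
       (SUP (h, p)\<in>\<U> \<times> S.
          ereal (tangent_onorm A g p ((h ^^ n p) p) (differential A (h ^^ n p) p))) < \<infinity>)"
proof
  interpret riemannian_mfd A g by unfold_locales (use assms in auto)
  assume S: "finite S"
  obtain \<U> where U: "neighbourhood_in (C1_topology A) f \<U>"
    "(SUP (h, p)\<in>\<U> \<times> S. ereal (tangent_onorm A g p (h p) (differential A h p))) < \<infinity>"
    using finite_imp_bounded[OF assms(3) S] by blast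
  have "finite_preimages (\<lambda>_. 1::nat) S {1..}" using S by (simp add: finite_preimages_def)
  moreover have "h ^^ 1 = h" for h :: "'a \<Rightarrow> 'a" by (simp add: fun_eq_iff)
  ultimately show "\<exists>\<U> (n :: 'a \<Rightarrow> nat). neighbourhood_in (C1_topology A) f \<U> \<and>
       finite_preimages n S {1..} \<and>
       (SUP (h, p)\<in>\<U> \<times> S.
          ereal (tangent_onorm A g p ((h ^^ n p) p) (differential A (h ^^ n p) p))) < \<infinity>"
    using U by (intro exI[of _ \<U>] exI[of _ "\<lambda>_. 1"]) (simp del: funpow.simps)
next
  interpret riemannian_mfd A g by unfold_locales (use assms in auto)
  assume "\<exists>\<U> (n :: 'a \<Rightarrow> nat). neighbourhood_in (C1_topology A) f \<U> \<and>
       finite_preimages n S {1..} \<and>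
       (SUP (h, p)\<in>\<U> \<times> S.
          ereal (tangent_onorm A g p ((h ^^ n p) p) (differential A (h ^^ n p) p))) < \<infinity>"
  then obtain \<U> and n :: "'a \<Rightarrow> nat" where U: "neighbourhood_in (C1_topology A) f \<U>"
    and n: "finite_preimages n S {1..}"
    and sup: "(SUP (h, p)\<in>\<U> \<times> S. ereal (tangent_onorm A g p ((h ^^ n p) p) (differential A (h ^^ n p) p))) < \<infinity>"
    by blast
  obtain W where W: "openin (C1_topology A) W" "f \<in> W" "W \<subseteq> \<U>" using U
    by (auto simp: neighbourhood_in_def)
  \<comment> \<open>For empty S the supremum is minus infinity, so a real upper bound is extracted
    and not a real value.\<close>
  obtain B where B:
    "(SUP (h, p)\<in>\<U> \<times> S. ereal (tangent_onorm A g p ((h ^^ n p) p) (differential A (h ^^ n p) p))) \<le> ereal B"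
  proof -
    from sup have "(SUP (h, p)\<in>\<U> \<times> S. ereal (tangent_onorm A g p ((h ^^ n p) p) (differential A (h ^^ n p) p))) \<noteq> \<infinity>"
      by (rule less_imp_neq)
    then show ?thesis unfolding less_PInf_Ex_of_nat by (elim exE) (rule that[OF less_imp_le])
  qed
  have bound: "tangent_onorm A g p ((h ^^ n p) p) (differential A (h ^^ n p) p) \<le> B" if "h \<in> W" "p \<in> S"
    for h p
  proof -
    have "ereal (tangent_onorm A g p ((h ^^ n p) p) (differential A (h ^^ n p) p))
      \<le> (SUP (h, p)\<in>\<U> \<times> S. ereal (tangent_onorm A g p ((h ^^ n p) p) (differential A (h ^^ n p) p)))"
      by (rule SUP_upper2[of "(h, p)"]) (use that W(3) in auto)
    then have "ereal (tangent_onorm A g p ((h ^^ n p) p) (differential A (h ^^ n p) p)) \<le> ereal B"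
      using B by (rule order_trans)
    then show ?thesis by simp
  qed
  \<comment> \<open>\<open>finite_preimages\<close> speaks of values in \<open>{1..}\<close>; the
    value 0 is not attained on S.\<close>
  have fin: "finite {p \<in> S. n p = k}" for k
  proof (cases "k = 0")
    case True
    have "n p \<noteq> 0" if "p \<in> S" for p
      using n that by (auto simp: finite_preimages_def Pi_iff)
    then have "{p \<in> S. n p = k} = {}" using True by blast
    then show ?thesis by (metis finite.emptyI)
  next
    case False
    then have "k \<in> {1..}" by simp
    then show ?thesis using n unfolding finite_preimages_def by blast
  qed
  obtain I C R where "finite I" "\<And>i. i \<in> I \<Longrightarrow> C i \<in> A" "\<And>i. i \<in> I \<Longrightarrow> 0 < R i"
    "\<And>i. i \<in> I \<Longrightarrow> cball (snd (C i) i) (3 * R i) \<subseteq> snd (C i) ` fst (C i)"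
    "\<And>x. \<exists>i\<in>I. x \<in> fst (C i) \<and> snd (C i) x \<in> ball (snd (C i) i) (R i)"
    by (rule finite_cover_exists) (rule that)
  then interpret riemannian_cover A g I C R by unfold_locales
  show "finite S" by (rule bounded_imp_finite[OF assms(3,4) fin W(1,2) bound])
qed

end
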